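(* Fix the mesh size $h$ and parameters $\delta,\varepsilon>0$, and let $v^0_h\in\mathcal{K}_h$ be an initial guess. For each $n$ let $c_1>0$ (possibly depending on $n$) be a constant such that $\tau_n\le(1+c_1)^{-1}$ implies $\|v^{n+1}_h-v^n_h\|^2_{L^2(\Omega)}+J_{\delta,\varepsilon,h}(v^{n+1}_h)\le J_{\delta,\varepsilon,h}(v^n_h)$ for the scheme (S) of the context; here $c_1$ depends only on $\Omega,h,\delta,\xi_0,r_0,L_0,\|\mathbb{C}_0\|_{L^\infty(\Omega)},\|\mathbb{C}_1\|_{L^\infty(\Omega)},\|u^\delta_{N,h}(v^n_h)\|_{W^{1,\infty}(\Omega)},\|u^\delta_{D,h}(v^n_h)\|_{W^{1,\infty}(\Omega)}$. Then there exists a sequence of time steps $\tau_n$ with $0<\beta\le\tau_n\le(1+c_1)^{-1}$ for all $n\ge 0$, where $\beta$ depends on the data and possibly on $h$ (but not on $n$), and the corresponding sequence $v^n_h$ generated by (S) has a subsequence (still denoted $v^n_h$) converging in $W^{1,\infty}(\Omega)$, $v^n_h\to v_h$ as $n\to+\infty$, where $v_h\in\mathcal{K}_h$ satisfies the discrete optimality condition $$J'_{\delta,\varepsilon,h}(v_h)[\omega_h-v_h]\ge0\qquad\forall\,\omega_h\in\mathcal{K}_h.$$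
   Context: Let $d\in\{2,3\}$. Displacement fields take values in $\mathbb{R}^d$; $A:B=\sum a_{ij}b_{ij}$, $\widehat A=\frac12(A+A^T)$, $\widehat\nabla u=\frac12(\nabla u+(\nabla u)^T)$. $\Omega\subset\mathbb{R}^d$ is a bounded polygonal/polyhedral Lipschitz domain (Lipschitz constants $r_0,L_0$), $\partial\Omega=\Sigma_N\cup\Sigma_D$ with $|\Sigma_N|,|\Sigma_D|>0$, $\Sigma_D$ closed. $\mathbb{C}_0=\mathbb{C}_0(x)$ is a uniformly bounded fourth-order tensor field with $(\mathbb{C}_0)_{ijkh}=(\mathbb{C}_0)_{jikh}=(\mathbb{C}_0)_{khij}$ and $\mathbb{C}_0\widehat A:\widehat A\ge\xi_0|\widehat A|^2$ a.e. in $\Omega$ for all $A$, with $\xi_0>0$. $\delta>0$ is a fixed (small) parameter, $\mathbb{C}_1=\delta\mathbb{C}_0$, $\mathbb{C}^\delta(v)=\mathbb{C}_0+(\mathbb{C}_1-\mathbb{C}_0)v$. $g\in L^2(\Sigma_N)$; $f$ is a boundary displacement on $\Sigma_N$ having a lifting $u^f\in H^1(\Omega)$ with trace $f$ on $\Sigma_N$ and $0$ on $\Sigma_D$. $\Omega^{d_0}=\{x\in\Omega:\mathrm{dist}(x,\partial\Omega)\le d_0\}$, $d_0>0$ fixed; $\mathcal{K}=\{v\in H^1(\Omega):0\le v\le1\text{ a.e.},\ v=0\text{ a.e. in }\Omega^{d_0}\}$. $(\mathcal{T}_h)_{0<h\le h_0}$ is a regular triangulation of $\Omega$; $\mathcal{V}_h$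 is the space of continuous functions on $\overline\Omega$ that are polynomials of degree one on each element (scalar or $\mathbb{R}^d$-valued as appropriate); $\mathcal{V}_{h,\Sigma_D}=\mathcal{V}_h\cap H^1_{\Sigma_D}(\Omega)$ (zero trace on $\Sigma_D$), $\mathcal{V}_{h,0}=\mathcal{V}_h\cap H^1_0(\Omega)$, $\mathcal{K}_h=\mathcal{V}_h\cap\mathcal{K}$. $g_h,u^f_h$ are continuous piecewise linear approximations of $g,u^f$, with $g_h\to g$ in $L^2(\Sigma_N)$ and $u^f_h\to u^f$ in $H^1(\Omega)$ as $h\to0$; $f_h=u^f_h|_{\Sigma_N}$. For $v_h\in\mathcal{K}_h$, $u^\delta_{N,h}(v_h)\in\mathcal{V}_{h,\Sigma_D}$ solves $\int_\Omega\mathbb{C}^\delta(v_h)\widehat\nabla u^\delta_{N,h}(v_h):\widehat\nabla\varphi_h\,dx=\int_{\Sigma_N}g_h\cdot\varphi_h\,d\sigma$ for all $\varphi_h\in\mathcal{V}_{h,\Sigma_D}$; $u^\delta_{D,h}(v_h)\in u^f_h+\mathcal{V}_{h,0}$ solves $\int_\Omega\mathbb{C}^\delta(v_h)\widehat\nabla u^\delta_{D,h}(v_h):\widehat\nabla\psi_h\,dx=0$ for all $\psi_h\in\mathcal{V}_{h,0}$. $J_{\delta,\varepsilon,h}(v_h)=\frac12\int_\Omega\mathbb{C}^\delta(v_h)\widehat\nabla u^\delta_{N,h}(v_h):\widehat\nabla u^\delta_{N,h}(v_h)\,dx+\frac12\int_\Omega\mathbb{C}^\delta(v_h)\widehat\nabla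 u^\delta_{D,h}(v_h):\widehat\nabla u^\delta_{D,h}(v_h)\,dx-\int_{\Sigma_N}f_h\cdot g_h\,d\sigma+\gamma\int_\Omega(\varepsilon|\nabla v_h|^2+\frac1\varepsilon v_h(1-v_h))\,dx$, with $\gamma>0$ fixed, and $$\begin{aligned}J'_{\delta,\varepsilon,h}(v_h)[\omega_h-v_h]=&\tfrac12\int_\Omega(\omega_h-v_h)(\mathbb{C}_1-\mathbb{C}_0)\widehat\nabla u^\delta_{D,h}(v_h):\widehat\nabla u^\delta_{D,h}(v_h)\,dx-\tfrac12\int_\Omega(\omega_h-v_h)(\mathbb{C}_1-\mathbb{C}_0)\widehat\nabla u^\delta_{N,h}(v_h):\widehat\nabla u^\delta_{N,h}(v_h)\,dx\\&+2\gamma\varepsilon\int_\Omega\nabla v_h\cdot\nabla(\omega_h-v_h)\,dx+\tfrac\gamma\varepsilon\int_\Omega(1-2v_h)(\omega_h-v_h)\,dx.\end{aligned}$$ Scheme (S): given $v^n_h\in\mathcal{K}_h$ and a time step $\tau_n>0$, $v^{n+1}_h\in\mathcal{K}_h$ is determined by $$\begin{aligned}&\tfrac1{\tau_n}\int_\Omega(v^{n+1}_h-v^n_h)(\omega_h-v^{n+1}_h)\,dx-\tfrac12\int_\Omega(\omega_h-v^{n+1}_h)(\mathbb{C}_1-\mathbb{C}_0)\widehat\nabla u^\delta_{N,h}(v^n_h):\widehat\nabla u^\delta_{N,h}(v^n_h)\,dx\\&+\tfrac12\int_\Omega(\omega_h-v^{n+1}_h)(\mathbb{C}_1-\mathbb{C}_0)\widehat\nabla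 u^\delta_{D,h}(v^n_h):\widehat\nabla u^\delta_{D,h}(v^n_h)\,dx+2\gamma\varepsilon\int_\Omega\nabla v^{n+1}_h\cdot\nabla(\omega_h-v^{n+1}_h)\,dx\\&+\tfrac\gamma\varepsilon\int_\Omega(1-2v^n_h)(\omega_h-v^{n+1}_h)\,dx\ge0\qquad\forall\,\omega_h\in\mathcal{K}_h.\end{aligned}$$
   Formalization: The constant c_1 is taken to be a positive function of the two W^{1,∞} norms that is bounded on bounded sets of their values and gives the energy decrease for every v_h in K_h; for an arbitrary function of the norms c_1 could blow up along the iterates and no β > 0 would exist. *)

theory Defs
  imports "HOL-Analysis.Analysis" "HOL-Probability.Essential_Supremum"
begin

section \<open>Surface measure\<close>

text \<open>\<^term>\<open>s\<close>-dimensional Hausdorff measure (meant for \<open>s > 0\<close>), normalised so that it agrees with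
  Lebesgue measure on \<open>s\<close>-dimensional planes. Boundedness is demanded of the covering sets because
  \<^const>\<open>diameter\<close> is unspecified on unbounded sets.\<close>

definition hausdorff_pre :: "nat \<Rightarrow> real \<Rightarrow> 'a::metric_space set \<Rightarrow> ennreal" where
  "hausdorff_pre s r A =
     (INF U \<in> {U :: nat \<Rightarrow> 'a set. A \<subseteq> (\<Union>i. U i) \<and> (\<forall>i. bounded (U i) \<and> diameter (U i) \<le> r)}.
        \<Sum>i. ennreal (unit_ball_vol (real s) * (diameter (U i) / 2) ^ s))"

definition hausdorff_outer :: "nat \<Rightarrow> 'a::metric_space set \<Rightarrow> ennreal" where
  "hausdorff_outer s A = (SUP r \<in> {0<..}. hausdorff_pre s r A)"

definition surface_measure :: "(real ^ 'd) measure" where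
  "surface_measure = measure_of UNIV (sets borel) (hausdorff_outer (CARD('d) - 1))"

abbreviation surface_on :: "(real ^ 'd) set \<Rightarrow> (real ^ 'd) measure" where
  "surface_on S \<equiv> restrict_space surface_measure S"

text \<open>\<^const>\<open>measure_of\<close> silently yields the zero measure unless its argument is countably additive, so
  we check that Hausdorff measure is (Caratheodory's criterion for metric outer measures).\<close>

lemma hausdorff_pre_le:
  assumes "A \<subseteq> (\<Union>i. U i)" "\<And>i. bounded (U i)" "\<And>i. diameter (U i) \<le> r"
  shows "hausdorff_pre s r A \<le> (\<Sum>i. ennreal (unit_ball_vol (real s) * (diameter (U i) / 2) ^ s))"
  unfolding hausdorff_pre_def by (rule INF_lower) (use assms in auto)

lemma hausdorff_pre_mono: "A \<subseteq> B \<Longrightarrow> hausdorff_pre s r A \<le> hausdorff_pre s r B"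
  unfolding hausdorff_pre_def by (rule INF_superset_mono) auto

lemma hausdorff_pre_antimono: "r \<le> r' \<Longrightarrow> hausdorff_pre s r' A \<le> hausdorff_pre s r A"
  unfolding hausdorff_pre_def by (rule INF_superset_mono) (auto intro: order_trans)

lemma hausdorff_pre_le_outer: "r > 0 \<Longrightarrow> hausdorff_pre s r A \<le> hausdorff_outer s A"
  unfolding hausdorff_outer_def by (rule SUP_upper) auto

lemma hausdorff_outer_mono: "A \<subseteq> B \<Longrightarrow> hausdorff_outer s A \<le> hausdorff_outer s B"
  unfolding hausdorff_outer_def by (rule SUP_mono) (use hausdorff_pre_mono in blast)

lemma hausdorff_outer_empty:
  assumes "s > 0"
  shows "hausdorff_outer s ({} :: 'a::metric_space set) = 0"
proof -
  have "hausdorff_pre s r ({} :: 'a set) \<le> 0" if "r > 0" for r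
  proof -
    have "hausdorff_pre s r ({} :: 'a set) \<le>
        (\<Sum>i::nat. ennreal (unit_ball_vol (real s) * (diameter ({} :: 'a set) / 2) ^ s))"
      by (rule hausdorff_pre_le[where U = "\<lambda>_. {}"]) (use that in auto)
    also have "\<dots> = 0" using assms by (simp add: power_0_left)
    finally show ?thesis .
  qed
  then have "hausdorff_outer s ({} :: 'a set) \<le> 0"
    unfolding hausdorff_outer_def by (intro SUP_least) auto
  then show ?thesis by simp
qed

lemma hausdorff_pre_countably_subadditive:
  "hausdorff_pre s r (\<Union>i. A i) \<le> (\<Sum>i. hausdorff_pre s r (A i))"
proof (rule ennreal_le_epsilon)
  let ?z = "\<lambda>S. ennreal (unit_ball_vol (real s) * (diameter S / 2) ^ s)"
  fix e :: real
  assume e: "0 < e" and fin: "(\<Sum>i. hausdorff_pre s r (A i)) < top"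
  have *: "hausdorff_pre s r (A n) < hausdorff_pre s r (A n) + e * (1/2) ^ Suc n" for n
    using e fin by (auto simp add: less_top dest!: ennreal_suminf_lessD)
  have "\<exists>U. A n \<subseteq> (\<Union>i. U i) \<and> (\<forall>i. bounded (U i) \<and> diameter (U i) \<le> r) \<and>
      (\<Sum>i. ?z (U i)) < hausdorff_pre s r (A n) + e * (1/2) ^ Suc n" for n
    using *[of n] unfolding hausdorff_pre_def by (subst (asm) INF_less_iff) blast
  then obtain B where B: "\<And>n. A n \<subseteq> (\<Union>i. B n i)" "\<And>n i. bounded (B n i)"
    "\<And>n i. diameter (B n i) \<le> r"
    and Ble: "\<And>n. (\<Sum>i. ?z (B n i)) < hausdorff_pre s r (A n) + e * (1/2) ^ Suc n"
    by metis
  define C where "C = case_prod B o prod_decode"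
  have "(\<Union>i. A i) \<subseteq> (\<Union>i. C i)"
    using B(1) by (auto simp add: C_def subset_eq) (metis prod.case prod_encode_inverse)
  then have "hausdorff_pre s r (\<Union>i. A i) \<le> (\<Sum>i. ?z (C i))"
    by (rule hausdorff_pre_le) (auto simp: C_def B split: prod.split)
  also have "\<dots> = (\<Sum>n. \<Sum>i. ?z (B n i))"
    unfolding C_def comp_def
    using suminf_ennreal_2dimen[of "\<lambda>n. \<Sum>i. ?z (B n i)" "\<lambda>(n, i). ?z (B n i)"]
    by (simp add: case_prod_unfold)
  also have "\<dots> \<le> (\<Sum>n. hausdorff_pre s r (A n) + e * (1/2) ^ Suc n)"
    using Ble by (intro suminf_le allI) (auto intro: less_imp_le)
  also have "\<dots> = (\<Sum>n. hausdorff_pre s r (A n)) + (\<Sum>n. ennreal e * ennreal ((1/2) ^ Suc n))"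
    using e by (subst suminf_add[symmetric])
      (auto simp del: ennreal_suminf_cmult simp add: ennreal_mult[symmetric])
  also have "\<dots> = (\<Sum>n. hausdorff_pre s r (A n)) + e"
    unfolding ennreal_suminf_cmult
    by (subst suminf_ennreal_eq[OF zero_le_power power_half_series]) auto
  finally show "hausdorff_pre s r (\<Union>i. A i) \<le> (\<Sum>n. hausdorff_pre s r (A n)) + e" .
qed

lemma hausdorff_outer_countably_subadditive:
  "hausdorff_outer s (\<Union>i. A i) \<le> (\<Sum>i. hausdorff_outer s (A i))"
  unfolding hausdorff_outer_def[of s "\<Union>i. A i"]
proof (rule SUP_least)
  fix r :: real assume "r \<in> {0<..}"
  then have "(\<Sum>i. hausdorff_pre s r (A i)) \<le> (\<Sum>i. hausdorff_outer s (A i))"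
    by (intro suminf_le allI hausdorff_pre_le_outer) auto
  then show "hausdorff_pre s r (\<Union>i. A i) \<le> (\<Sum>i. hausdorff_outer s (A i))"
    using hausdorff_pre_countably_subadditive order_trans by blast
qed

lemma hausdorff_outer_space:
  assumes "s > 0"
  shows "outer_measure_space UNIV (hausdorff_outer s :: 'a::metric_space set \<Rightarrow> ennreal)"
  unfolding outer_measure_space_def positive_def increasing_def countably_subadditive_def
  using assms by (auto simp: hausdorff_outer_empty hausdorff_outer_countably_subadditive
      intro: hausdorff_outer_mono)

lemma hausdorff_outer_Un:
  assumes "s > 0"
  shows "hausdorff_outer s (A \<union> B) \<le> hausdorff_outer s A + hausdorff_outer s B"
proof -
  interpret sigma_algebra UNIV "UNIV :: 'a set set"
    using sigma_algebra_Pow[of "UNIV :: 'a set"] by simp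
  have "hausdorff_outer s (A \<union> B) = hausdorff_outer s (A \<union> (B - A))" by simp
  also have "\<dots> \<le> hausdorff_outer s A + hausdorff_outer s (B - A)"
    using countably_subadditive_subadditive[of "hausdorff_outer s"] hausdorff_outer_space[OF assms]
    unfolding outer_measure_space_def subadditive_def by blast
  also have "\<dots> \<le> hausdorff_outer s A + hausdorff_outer s B"
    by (intro add_left_mono hausdorff_outer_mono) auto
  finally show ?thesis .
qed

lemma hausdorff_outer_separated:
  assumes s: "s > 0" and e: "e > 0" and sep: "\<And>a b. a \<in> A \<Longrightarrow> b \<in> B \<Longrightarrow> dist a b \<ge> e"
  shows "hausdorff_outer s A + hausdorff_outer s B \<le> hausdorff_outer s (A \<union> B)"
proof -
  let ?z = "\<lambda>S. ennreal (unit_ball_vol (real s) * (diameter S / 2) ^ s)"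
  have pre: "hausdorff_pre s r A + hausdorff_pre s r B \<le> hausdorff_pre s r (A \<union> B)" if r: "r < e" for r
    unfolding hausdorff_pre_def[of s r "A \<union> B"]
  proof (safe intro!: INF_greatest)
    fix U :: "nat \<Rightarrow> 'a set"
    assume U: "A \<union> B \<subseteq> (\<Union>i. U i)" "\<forall>i. bounded (U i) \<and> diameter (U i) \<le> r"
    have mono: "?z (U i \<inter> S) \<le> ?z (U i)" for i S
      using U(2) by (intro ennreal_leI mult_left_mono power_mono divide_right_mono diameter_subset)
        (auto simp: diameter_ge_0 bounded_Int)
    have dm: "diameter (U i \<inter> S) \<le> r" for i S
      using U(2) diameter_subset[of "U i \<inter> S" "U i"] by (meson inf_le1 order_trans)
    have "hausdorff_pre s r S \<le> (\<Sum>i. ?z (U i \<inter> S))" if "S \<subseteq> A \<union> B" for S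
      by (rule hausdorff_pre_le) (use U that dm in \<open>auto simp: bounded_Int\<close>)
    then have "hausdorff_pre s r A + hausdorff_pre s r B \<le> (\<Sum>i. ?z (U i \<inter> A)) + (\<Sum>i. ?z (U i \<inter> B))"
      by (intro add_mono) auto
    also have "\<dots> = (\<Sum>i. ?z (U i \<inter> A) + ?z (U i \<inter> B))"
      by (subst suminf_add) auto
    also have "\<dots> \<le> (\<Sum>i. ?z (U i))"
    proof (intro suminf_le allI)
      fix i
      have "U i \<inter> A = {} \<or> U i \<inter> B = {}"
      proof (rule ccontr)
        assume "\<not> ?thesis"
        then obtain a b where ab: "a \<in> U i" "a \<in> A" "b \<in> U i" "b \<in> B" by blast
        then have "dist a b \<le> r"
          using U(2) diameter_bounded_bound[of "U i" a b] by (meson order_trans)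
        then show False using sep[OF ab(2,4)] r by simp
      qed
      then show "?z (U i \<inter> A) + ?z (U i \<inter> B) \<le> ?z (U i)"
        using mono[of i] s by (auto simp: power_0_left)
    qed auto
    finally show "hausdorff_pre s r A + hausdorff_pre s r B \<le> (\<Sum>i. ?z (U i))" .
  qed
  have "hausdorff_pre s r A + hausdorff_pre s r' B \<le> hausdorff_outer s (A \<union> B)"
    if "r > 0" "r' > 0" for r r'
  proof -
    define q where "q = min (min r r') (e/2)"
    have q: "q > 0" "q < e" "q \<le> r" "q \<le> r'" using that e by (auto simp: q_def)
    have "hausdorff_pre s r A + hausdorff_pre s r' B \<le> hausdorff_pre s q A + hausdorff_pre s q B"
      by (intro add_mono hausdorff_pre_antimono q)
    also have "\<dots> \<le> hausdorff_outer s (A \<union> B)"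
      using pre[OF q(2)] hausdorff_pre_le_outer[OF q(1)] order_trans by blast
    finally show ?thesis .
  qed
  then have "hausdorff_pre s r A + hausdorff_outer s B \<le> hausdorff_outer s (A \<union> B)" if "r > 0" for r
    using that unfolding hausdorff_outer_def[of s B]
    by (subst ennreal_SUP_add_right) (auto intro!: SUP_least)
  then show ?thesis
    unfolding hausdorff_outer_def[of s A]
    by (subst ennreal_SUP_add_left[symmetric]) (auto intro!: SUP_least)
qed

lemma hausdorff_outer_closed_split:
  fixes C X :: "'a::metric_space set"
  assumes s: "s > 0" and C: "closed C"
  shows "hausdorff_outer s (X \<inter> C) + hausdorff_outer s (X - C) \<le> hausdorff_outer s X"
proof (cases "C = {} \<or> hausdorff_outer s X = top")
  case True
  then show ?thesis using s by (auto simp: hausdorff_outer_empty)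
next
  case False
  let ?H = "hausdorff_outer s :: 'a set \<Rightarrow> ennreal"
  have ne: "C \<noteq> {}" and fin: "?H X < top" using False by (auto simp: less_top)
  define Y where "Y n = {x \<in> X. infdist x C \<ge> 1 / real (Suc n)}" for n
  define R where "R n = Y (Suc n) - Y n" for n
  have YX: "Y n \<subseteq> X" for n by (auto simp: Y_def)
  have RX: "R n \<subseteq> X" for n using YX by (auto simp: R_def)
  have part: "(\<Sum>i<n. ?H (R (2 * i + b))) \<le> ?H (\<Union>i<n. R (2 * i + b))" for n b
  proof (induction n)
    case (Suc n)
    show ?case
    proof (cases n)
      case 0
      then have "{..<Suc n} = {0}" by auto
      then show ?thesis using 0 by simp
    next
      case (Suc m)
      let ?k = "2 * n + b"
      have "?H (\<Union>i<n. R (2 * i + b)) + ?H (R ?k) \<le> ?H ((\<Union>i<n. R (2 * i + b)) \<union> R ?k)"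
      proof (rule hausdorff_outer_separated[OF s])
        let ?e = "1 / real ?k - 1 / real (Suc ?k)"
        have "?k > 0" using Suc by simp
        then show "?e > 0" by (simp add: divide_strict_left_mono del: of_nat_add of_nat_mult)
        fix x y assume "x \<in> (\<Union>i<n. R (2 * i + b))" and y: "y \<in> R ?k"
        then obtain i where i: "i < n" "x \<in> R (2 * i + b)" by auto
        have "infdist x C \<ge> 1 / real (Suc (Suc (2 * i + b)))" using i by (auto simp: R_def Y_def)
        moreover have "1 / real (Suc (Suc (2 * i + b))) \<ge> 1 / real ?k"
          using i by (intro divide_left_mono) auto
        moreover have "infdist y C < 1 / real (Suc ?k)" using y by (auto simp: R_def Y_def)
        ultimately show "dist x y \<ge> ?e"
          using infdist_triangle[of x C y] by linarith
      qed
      moreover have "(\<Union>i<n. R (2 * i + b)) \<union> R ?k = (\<Union>i<Suc n. R (2 * i + b))"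
        by (auto simp: less_Suc_eq)
      ultimately show ?thesis
        using Suc.IH by simp (meson add_right_mono order_trans)
    qed
  qed (simp add: hausdorff_outer_empty s)
  have half: "(\<Sum>i<n. ?H (R (2 * i + b))) \<le> ?H X" for n b
    by (rule order_trans[OF part hausdorff_outer_mono]) (use RX in auto)
  have tot: "(\<Sum>k<n. ?H (R k)) \<le> ?H X + ?H X" for n
  proof -
    have "(\<Sum>k<n. ?H (R k)) \<le> (\<Sum>k<2 * n. ?H (R k))"
      by (rule sum_mono2) auto
    also have "\<dots> = (\<Sum>i<n. ?H (R (2 * i + 0))) + (\<Sum>i<n. ?H (R (2 * i + 1)))"
      by (induction n) (auto simp: ac_simps)
    also have "\<dots> \<le> ?H X + ?H X" by (intro add_mono half)
    finally show ?thesis .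
  qed
  define a where "a k = enn2real (?H (R k))" for k
  have HR: "?H (R k) = ennreal (a k)" for k
    using hausdorff_outer_mono[OF RX, of s k] fin unfolding a_def
    by (metis ennreal_enn2real le_less_trans)
  have apos: "a k \<ge> 0" for k by (simp add: a_def)
  have "(\<Sum>k. ?H (R k)) \<le> ?H X + ?H X"
    unfolding suminf_eq_SUP by (rule SUP_least) (use tot in auto)
  also have "\<dots> < top" using fin by simp
  finally have sm: "summable a"
    unfolding HR using apos by (intro summable_suminf_not_top) auto
  show ?thesis
  proof (rule ennreal_le_epsilon)
    fix e :: real assume e: "e > 0"
    obtain n where n: "norm (\<Sum>i. a (i + n)) < e"
      using suminf_exist_split[OF e sm] by blast
    have smn: "summable (\<lambda>i. a (i + n))" using sm by (simp add: summable_iff_shift)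
    have cover: "X - C \<subseteq> Y n \<union> (\<Union>i. R (i + n))"
    proof
      fix x assume x: "x \<in> X - C"
      then have "infdist x C > 0"
        using C ne by (metis DiffD2 in_closed_iff_infdist_zero infdist_nonneg less_eq_real_def)
      then obtain m where "1 / real (Suc m) < infdist x C"
        using nat_approx_posE by metis
      then have ex: "\<exists>m. x \<in> Y m" using x by (auto simp: Y_def intro!: exI[of _ m] less_imp_le)
      define m0 where "m0 = (LEAST m. x \<in> Y m)"
      have m0: "x \<in> Y m0" unfolding m0_def using ex by (rule LeastI_ex)
      show "x \<in> Y n \<union> (\<Union>i. R (i + n))"
      proof (cases "m0 \<le> n")
        case True
        have "1 / real (Suc n) \<le> 1 / real (Suc m0)" using True by (intro divide_left_mono) auto
        then have "x \<in> Y n" using m0 by (auto simp: Y_def)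
        then show ?thesis by simp
      next
        case False
        then obtain j where j: "m0 = Suc (j + n)"
          by (metis add.commute less_imp_Suc_add not_le add_Suc_right)
        have "x \<notin> Y (j + n)" using not_less_Least[of "j + n" "\<lambda>m. x \<in> Y m"] j
          by (simp add: m0_def)
        then have "x \<in> R (j + n)" using m0 j by (simp add: R_def)
        then show ?thesis by auto
      qed
    qed
    have "?H (X - C) \<le> ?H (Y n) + ?H (\<Union>i. R (i + n))"
      using hausdorff_outer_mono[OF cover] hausdorff_outer_Un[OF s] order_trans by blast
    also have "?H (\<Union>i. R (i + n)) \<le> (\<Sum>i. ?H (R (i + n)))"
      by (rule hausdorff_outer_countably_subadditive)
    also have "\<dots> = ennreal (\<Sum>i. a (i + n))"
      unfolding HR using apos smn by (intro suminf_ennreal2) auto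
    also have "\<dots> \<le> ennreal e" using n by (intro ennreal_leI) auto
    finally have "?H (X - C) \<le> ?H (Y n) + ennreal e" by (simp add: add_left_mono)
    then have "?H (X \<inter> C) + ?H (X - C) \<le> (?H (X \<inter> C) + ?H (Y n)) + ennreal e"
      by (simp add: add.assoc add_left_mono)
    also have "?H (X \<inter> C) + ?H (Y n) \<le> ?H ((X \<inter> C) \<union> Y n)"
    proof (rule hausdorff_outer_separated[OF s])
      show "1 / real (Suc n) > 0" by simp
      fix x y assume "x \<in> X \<inter> C" "y \<in> Y n"
      then show "dist x y \<ge> 1 / real (Suc n)"
        using infdist_le[of x C y] by (auto simp: Y_def dist_commute)
    qed
    also have "\<dots> \<le> ?H X" by (rule hausdorff_outer_mono) (use YX in auto)
    finally show "?H (X \<inter> C) + ?H (X - C) \<le> ?H X + ennreal e" by (simp add: add_right_mono)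
  qed
qed

lemma measure_space_hausdorff_outer:
  assumes s: "s > 0"
  shows "measure_space UNIV (sets borel) (hausdorff_outer s :: 'a::metric_space set \<Rightarrow> ennreal)"
proof -
  let ?H = "hausdorff_outer s :: 'a set \<Rightarrow> ennreal"
  interpret sigma_algebra UNIV "UNIV :: 'a set set"
    using sigma_algebra_Pow[of "UNIV :: 'a set"] by simp
  have ms: "measure_space UNIV (lambda_system UNIV UNIV ?H) ?H"
    by (rule caratheodory_lemma[OF hausdorff_outer_space[OF s]])
  then have sa: "sigma_algebra UNIV (lambda_system UNIV UNIV ?H)"
    by (simp add: measure_space_def)
  have "C \<in> lambda_system UNIV UNIV ?H" if "closed C" for C
    unfolding lambda_system_eq
  proof safe
    fix X :: "'a set"
    have "?H X \<le> ?H (X \<inter> C) + ?H (X - C)"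
      using hausdorff_outer_Un[OF s, of "X \<inter> C" "X - C"] by (simp add: Int_Diff_Un)
    then show "?H (X \<inter> C) + ?H (X - C) = ?H X"
      using hausdorff_outer_closed_split[OF s that, of X] by (rule antisym[rotated])
  qed auto
  then have "sets borel \<subseteq> lambda_system UNIV UNIV ?H"
    unfolding borel_eq_closed
    using sigma_algebra.sigma_sets_subset[OF sa, of "Collect closed"] by (simp add: subset_iff)
  then show ?thesis
    using measure_down[OF ms] sets.sigma_algebra_axioms[of "borel :: 'a measure"] by simp
qed

lemma sets_surface_measure [simp, measurable_cong]: "sets surface_measure = sets borel"
  unfolding surface_measure_def
  by (metis sets.sigma_sets_eq sets_measure_of space_borel top.extremum Pow_UNIV)

lemma space_surface_measure [simp]: "space surface_measure = UNIV"
  unfolding surface_measure_def by (simp add: space_measure_of_conv)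

lemma emeasure_surface_measure:
  fixes A :: "(real ^ 'd) set"
  assumes "CARD('d) \<ge> 2" "A \<in> sets borel"
  shows "emeasure surface_measure A = hausdorff_outer (CARD('d) - 1) A"
proof -
  have "measure_space UNIV (sets borel) (hausdorff_outer (CARD('d) - 1) :: (real ^ 'd) set \<Rightarrow> ennreal)"
    by (rule measure_space_hausdorff_outer) (use assms in auto)
  then show ?thesis
    unfolding surface_measure_def using assms
    by (intro emeasure_measure_of_sigma)
      (auto simp: measure_space_def)
qed

section \<open>Lipschitz polyhedral domains\<close>

text \<open>Around each boundary point \<open>p\<close> the domain is, in suitable rigid coordinates centred at \<open>p\<close>, the
  part of the ball of radius \<open>r\<close> above the graph of an \<open>L\<close>-Lipschitz function; the last coordinate axis
  is spanned by the unit vector \<open>e\<close>, the others span its orthogonal complement.\<close>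

definition lipschitz_domain :: "(real ^ 'd) set \<Rightarrow> real \<Rightarrow> real \<Rightarrow> bool" where
  "lipschitz_domain \<Omega> r L \<longleftrightarrow> open \<Omega> \<and> connected \<Omega> \<and> \<Omega> \<noteq> {} \<and> r > 0 \<and> L > 0 \<and>
     (\<forall>p \<in> frontier \<Omega>. \<exists>e \<psi>. norm e = 1 \<and> \<psi> 0 = 0 \<and>
        L-lipschitz_on {y \<in> ball 0 r. y \<bullet> e = 0} \<psi> \<and>
        \<Omega> \<inter> ball p r =
          {x \<in> ball p r. (x - p) \<bullet> e > \<psi> ((x - p) - ((x - p) \<bullet> e) *\<^sub>R e)})"

definition polyhedral_domain :: "(real ^ 'd) set \<Rightarrow> bool" where
  "polyhedral_domain \<Omega> \<longleftrightarrow> (\<exists>F. finite F \<and> (\<forall>P\<in>F. polytope P) \<and> closure \<Omega> = \<Union>F)"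

section \<open>Sobolev spaces\<close>

definition partial :: "'d \<Rightarrow> (real ^ 'd \<Rightarrow> real) \<Rightarrow> real ^ 'd \<Rightarrow> real" where
  "partial i \<phi> x = frechet_derivative \<phi> (at x) (axis i 1)"

primrec Ck :: "nat \<Rightarrow> (real ^ 'd \<Rightarrow> real) \<Rightarrow> bool" where
  "Ck 0 \<phi> \<longleftrightarrow> continuous_on UNIV \<phi>"
| "Ck (Suc k) \<phi> \<longleftrightarrow> \<phi> differentiable_on UNIV \<and> (\<forall>i. Ck k (partial i \<phi>))"

definition test_function :: "(real ^ 'd) set \<Rightarrow> (real ^ 'd \<Rightarrow> real) \<Rightarrow> bool" where
  "test_function \<Omega> \<phi> \<longleftrightarrow>
     (\<forall>k. Ck k \<phi>) \<and> compact (closure {x. \<phi> x \<noteq> 0}) \<and> closure {x. \<phi> x \<noteq> 0} \<subseteq> \<Omega>"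

definition has_weak_gradient ::
  "(real ^ 'd) set \<Rightarrow> (real ^ 'd \<Rightarrow> real) \<Rightarrow> (real ^ 'd \<Rightarrow> real ^ 'd) \<Rightarrow> bool" where
  "has_weak_gradient \<Omega> u G \<longleftrightarrow>
     (\<forall>K. compact K \<and> K \<subseteq> \<Omega> \<longrightarrow> u absolutely_integrable_on K \<and> G absolutely_integrable_on K) \<and>
     (\<forall>\<phi> i. test_function \<Omega> \<phi> \<longrightarrow>
        (LINT x|lebesgue_on \<Omega>. u x * partial i \<phi> x) = - (LINT x|lebesgue_on \<Omega>. G x $ i * \<phi> x))"

text \<open>Weak gradients are unique up to null sets, and only used up to null sets below.\<close>

definition weak_grad :: "(real ^ 'd) set \<Rightarrow> (real ^ 'd \<Rightarrow> real) \<Rightarrow> real ^ 'd \<Rightarrow> real ^ 'd" where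
  "weak_grad \<Omega> u = (SOME G. has_weak_gradient \<Omega> u G)"

definition weak_jacobian ::
  "(real ^ 'd) set \<Rightarrow> (real ^ 'd \<Rightarrow> real ^ 'm) \<Rightarrow> real ^ 'd \<Rightarrow> real ^ 'd ^ 'm" where
  "weak_jacobian \<Omega> u x = (\<chi> i. weak_grad \<Omega> (\<lambda>y. u y $ i) x)"

definition square_integrable ::
  "'a measure \<Rightarrow> ('a \<Rightarrow> 'b::{real_normed_vector, second_countable_topology}) \<Rightarrow> bool" where
  "square_integrable M w \<longleftrightarrow> w \<in> borel_measurable M \<and> integrable M (\<lambda>x. (norm (w x))\<^sup>2)"

definition H1 :: "(real ^ 'd) set \<Rightarrow> (real ^ 'd \<Rightarrow> real) set" where
  "H1 \<Omega> = {u. square_integrable (lebesgue_on \<Omega>) u \<and>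
     (\<exists>G. has_weak_gradient \<Omega> u G \<and> square_integrable (lebesgue_on \<Omega>) G)}"

definition H1_norm :: "(real ^ 'd) set \<Rightarrow> (real ^ 'd \<Rightarrow> real) \<Rightarrow> real" where
  "H1_norm \<Omega> u =
     sqrt ((LINT x|lebesgue_on \<Omega>. (u x)\<^sup>2) + (LINT x|lebesgue_on \<Omega>. (norm (weak_grad \<Omega> u x))\<^sup>2))"

definition H1_tendsto ::
  "(real ^ 'd) set \<Rightarrow> ('k \<Rightarrow> real ^ 'd \<Rightarrow> real) \<Rightarrow> (real ^ 'd \<Rightarrow> real) \<Rightarrow> 'k filter \<Rightarrow> bool" where
  "H1_tendsto \<Omega> U u F \<longleftrightarrow> u \<in> H1 \<Omega> \<and> (\<forall>\<^sub>F k in F. U k \<in> H1 \<Omega>) \<and>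
     ((\<lambda>k. H1_norm \<Omega> (\<lambda>x. U k x - u x)) \<longlongrightarrow> 0) F"

definition L2_tendsto ::
  "'a measure \<Rightarrow> ('k \<Rightarrow> 'a \<Rightarrow> 'b::{real_normed_vector, second_countable_topology}) \<Rightarrow> ('a \<Rightarrow> 'b) \<Rightarrow>
     'k filter \<Rightarrow> bool" where
  "L2_tendsto M W w F \<longleftrightarrow> square_integrable M w \<and> (\<forall>\<^sub>F k in F. square_integrable M (W k)) \<and>
     ((\<lambda>k. sqrt (LINT x|M. (norm (W k x - w x))\<^sup>2)) \<longlongrightarrow> 0) F"

text \<open>The trace on a part \<open>S\<close> of the boundary of a Lipschitz domain: restriction for functions that are
  continuous up to the boundary, extended to \<open>H\<^sup>1\<close> by continuity. Like every trace it is only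
  determined up to null sets of the surface measure.\<close>

definition has_trace ::
  "(real ^ 'd) set \<Rightarrow> (real ^ 'd) set \<Rightarrow> (real ^ 'd \<Rightarrow> real) \<Rightarrow> (real ^ 'd \<Rightarrow> real) \<Rightarrow> bool" where
  "has_trace \<Omega> S u t \<longleftrightarrow>
     (if continuous_on (closure \<Omega>) u
      then AE x in surface_on S. u x = t x
      else \<exists>w. (\<forall>k. continuous_on (closure \<Omega>) (w k)) \<and>
             H1_tendsto \<Omega> w u sequentially \<and> L2_tendsto (surface_on S) w t sequentially)"

definition H1_vec :: "(real ^ 'd) set \<Rightarrow> (real ^ 'd \<Rightarrow> real ^ 'm) set" where
  "H1_vec \<Omega> = {u. \<forall>i. (\<lambda>x. u x $ i) \<in> H1 \<Omega>}"

definition has_trace_vec ::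
  "(real ^ 'd) set \<Rightarrow> (real ^ 'd) set \<Rightarrow> (real ^ 'd \<Rightarrow> real ^ 'm) \<Rightarrow> (real ^ 'd \<Rightarrow> real ^ 'm) \<Rightarrow> bool" where
  "has_trace_vec \<Omega> S u t \<longleftrightarrow> (\<forall>i. has_trace \<Omega> S (\<lambda>x. u x $ i) (\<lambda>x. t x $ i))"

definition H1_vec_zero_on :: "(real ^ 'd) set \<Rightarrow> (real ^ 'd) set \<Rightarrow> (real ^ 'd \<Rightarrow> real ^ 'm) set" where
  "H1_vec_zero_on \<Omega> S = {u \<in> H1_vec \<Omega>. has_trace_vec \<Omega> S u (\<lambda>_. 0)}"

definition W1inf_norm :: "(real ^ 'd) set \<Rightarrow> (real ^ 'd \<Rightarrow> real) \<Rightarrow> ennreal" where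
  "W1inf_norm \<Omega> u = esssup (lebesgue_on \<Omega>) (\<lambda>x. ennreal \<bar>u x\<bar>) +
     esssup (lebesgue_on \<Omega>) (\<lambda>x. ennreal (norm (weak_grad \<Omega> u x)))"

definition W1inf_norm_vec :: "(real ^ 'd) set \<Rightarrow> (real ^ 'd \<Rightarrow> real ^ 'm) \<Rightarrow> ennreal" where
  "W1inf_norm_vec \<Omega> u = esssup (lebesgue_on \<Omega>) (\<lambda>x. ennreal (norm (u x))) +
     esssup (lebesgue_on \<Omega>) (\<lambda>x. ennreal (norm (weak_jacobian \<Omega> u x)))"

section \<open>Elasticity tensors\<close>

type_synonym 'd tensor4 = "'d \<Rightarrow> 'd \<Rightarrow> 'd \<Rightarrow> 'd \<Rightarrow> real"

text \<open>For matrices, \<open>A : B\<close> is the library's inner product \<open>A \<bullet> B\<close> and \<open>|A|\<close> is \<open>norm A\<close>.\<close>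

definition tensor_app :: "'d::finite tensor4 \<Rightarrow> real ^ 'd ^ 'd \<Rightarrow> real ^ 'd ^ 'd" where
  "tensor_app C A = (\<chi> i j. \<Sum>k\<in>UNIV. \<Sum>l\<in>UNIV. C i j k l * A $ k $ l)"

definition sym_part :: "real ^ 'd ^ 'd \<Rightarrow> real ^ 'd ^ 'd" where
  "sym_part A = (1/2) *\<^sub>R (A + transpose A)"

definition sym_grad :: "(real ^ 'd) set \<Rightarrow> (real ^ 'd \<Rightarrow> real ^ 'd) \<Rightarrow> real ^ 'd \<Rightarrow> real ^ 'd ^ 'd" where
  "sym_grad \<Omega> u x = sym_part (weak_jacobian \<Omega> u x)"

definition elasticity_field ::
  "(real ^ 'd) set \<Rightarrow> real \<Rightarrow> (real ^ 'd \<Rightarrow> 'd tensor4) \<Rightarrow> bool" where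
  "elasticity_field \<Omega> \<xi> C \<longleftrightarrow> \<xi> > 0 \<and>
     (\<forall>i j k l. (\<lambda>x. C x i j k l) \<in> borel_measurable (lebesgue_on \<Omega>)) \<and>
     (\<exists>M. AE x in lebesgue_on \<Omega>. \<forall>i j k l. \<bar>C x i j k l\<bar> \<le> M) \<and>
     (AE x in lebesgue_on \<Omega>. \<forall>i j k l. C x i j k l = C x j i k l \<and> C x i j k l = C x k l i j) \<and>
     (AE x in lebesgue_on \<Omega>. \<forall>A.
        tensor_app (C x) (sym_part A) \<bullet> sym_part A \<ge> \<xi> * (norm (sym_part A))\<^sup>2)"

section \<open>Meshes and piecewise affine functions\<close>

text \<open>\<^const>\<open>triangulation\<close> is the library's notion of a conforming simplicial complex: two elements
  meet in a common (possibly empty) face.\<close>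

definition regular_triangulations ::
  "(real ^ 'd) set \<Rightarrow> real \<Rightarrow> (real \<Rightarrow> (real ^ 'd) set set) \<Rightarrow> bool" where
  "regular_triangulations \<Omega> H \<T> \<longleftrightarrow> H > 0 \<and>
     (\<forall>h \<in> {0<..H}. triangulation (\<T> h) \<and> \<Union>(\<T> h) = closure \<Omega> \<and>
        (\<forall>T \<in> \<T> h. int CARD('d) simplex T \<and> diameter T \<le> h)) \<and>
     (\<exists>\<kappa>>0. \<forall>h \<in> {0<..H}. \<forall>T \<in> \<T> h. \<exists>z. cball z (\<kappa> * diameter T) \<subseteq> T)"

definition continuous_pw_affine ::
  "(real ^ 'd) set set \<Rightarrow> (real ^ 'd) set \<Rightarrow> (real ^ 'd \<Rightarrow> 'b::real_normed_vector) set" where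
  "continuous_pw_affine \<T> S =
     {u. continuous_on S u \<and> (\<forall>T\<in>\<T>. \<exists>l b. linear l \<and> (\<forall>x \<in> S \<inter> T. u x = l x + b))}"

section \<open>The discrete cavity problem\<close>

text \<open>The data: domain and boundary parts with Lipschitz constants; tensor \<open>C0\<close> with ellipticity
  constant; the parameters; the meshes; the traction \<open>g\<close>, the boundary displacement \<open>f\<close>, its lifting,
  and the discrete approximations of traction and lifting indexed by the mesh size.\<close>

record 'd cavity_data =
  Omega :: "(real ^ 'd) set"
  SigmaN :: "(real ^ 'd) set"
  SigmaD :: "(real ^ 'd) set"
  r0 :: real
  L0 :: real
  C0 :: "real ^ 'd \<Rightarrow> 'd tensor4"
  xi0 :: real
  delta :: real
  epsilon :: real
  gam :: real
  d0 :: real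
  h0 :: real
  mesh :: "real \<Rightarrow> (real ^ 'd) set set"
  traction :: "real ^ 'd \<Rightarrow> real ^ 'd"
  bdry_disp :: "real ^ 'd \<Rightarrow> real ^ 'd"
  lifting :: "real ^ 'd \<Rightarrow> real ^ 'd"
  traction_h :: "real \<Rightarrow> real ^ 'd \<Rightarrow> real ^ 'd"
  lifting_h :: "real \<Rightarrow> real ^ 'd \<Rightarrow> real ^ 'd"

definition Vh :: "('d::finite) cavity_data \<Rightarrow> real \<Rightarrow> (real ^ 'd \<Rightarrow> 'b::real_normed_vector) set" where
  "Vh P h = continuous_pw_affine (mesh P h) (closure (Omega P))"

definition Vh_SigmaD :: "('d::finite) cavity_data \<Rightarrow> real \<Rightarrow> (real ^ 'd \<Rightarrow> real ^ 'd) set" where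
  "Vh_SigmaD P h = Vh P h \<inter> H1_vec_zero_on (Omega P) (SigmaD P)"

definition Vh_0 :: "('d::finite) cavity_data \<Rightarrow> real \<Rightarrow> (real ^ 'd \<Rightarrow> real ^ 'd) set" where
  "Vh_0 P h = Vh P h \<inter> H1_vec_zero_on (Omega P) (frontier (Omega P))"

definition boundary_layer :: "('d::finite) cavity_data \<Rightarrow> (real ^ 'd) set" where
  "boundary_layer P = {x \<in> Omega P. infdist x (frontier (Omega P)) \<le> d0 P}"

definition K :: "('d::finite) cavity_data \<Rightarrow> (real ^ 'd \<Rightarrow> real) set" where
  "K P = {v \<in> H1 (Omega P). (AE x in lebesgue_on (Omega P). 0 \<le> v x \<and> v x \<le> 1) \<and>
     (AE x in lebesgue_on (boundary_layer P). v x = 0)}"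

definition Kh :: "('d::finite) cavity_data \<Rightarrow> real \<Rightarrow> (real ^ 'd \<Rightarrow> real) set" where
  "Kh P h = Vh P h \<inter> K P"

definition admissible_geometry :: "('d::finite) cavity_data \<Rightarrow> bool" where
  "admissible_geometry P \<longleftrightarrow>
     bounded (Omega P) \<and> polyhedral_domain (Omega P) \<and> lipschitz_domain (Omega P) (r0 P) (L0 P) \<and>
     frontier (Omega P) = SigmaN P \<union> SigmaD P \<and> SigmaN P \<in> sets borel \<and> closed (SigmaD P) \<and>
     emeasure surface_measure (SigmaN P) > 0 \<and> emeasure surface_measure (SigmaD P) > 0"

definition admissible_boundary_data :: "('d::finite) cavity_data \<Rightarrow> bool" where
  "admissible_boundary_data P \<longleftrightarrow>
     square_integrable (surface_on (SigmaN P)) (traction P) \<and>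
     lifting P \<in> H1_vec (Omega P) \<and>
     has_trace_vec (Omega P) (SigmaN P) (lifting P) (bdry_disp P) \<and>
     has_trace_vec (Omega P) (SigmaD P) (lifting P) (\<lambda>_. 0)"

definition admissible_discretization :: "('d::finite) cavity_data \<Rightarrow> bool" where
  "admissible_discretization P \<longleftrightarrow>
     regular_triangulations (Omega P) (h0 P) (mesh P) \<and>
     (\<forall>h \<in> {0<..h0 P}. traction_h P h \<in> continuous_pw_affine (mesh P h) (SigmaN P) \<and>
        lifting_h P h \<in> Vh P h) \<and>
     L2_tendsto (surface_on (SigmaN P)) (traction_h P) (traction P) (at_right 0) \<and>
     (\<forall>i. H1_tendsto (Omega P) (\<lambda>h x. lifting_h P h x $ i) (\<lambda>x. lifting P x $ i) (at_right 0))"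

definition admissible :: "('d::finite) cavity_data \<Rightarrow> bool" where
  "admissible P \<longleftrightarrow>
     admissible_geometry P \<and> elasticity_field (Omega P) (xi0 P) (C0 P) \<and>
     delta P > 0 \<and> epsilon P > 0 \<and> gam P > 0 \<and> d0 P > 0 \<and>
     admissible_boundary_data P \<and> admissible_discretization P"

definition C1 :: "('d::finite) cavity_data \<Rightarrow> real ^ 'd \<Rightarrow> 'd tensor4" where
  "C1 P x i j k l = delta P * C0 P x i j k l"

definition C_diff :: "('d::finite) cavity_data \<Rightarrow> real ^ 'd \<Rightarrow> 'd tensor4" where
  "C_diff P x i j k l = C1 P x i j k l - C0 P x i j k l"

definition C_delta :: "('d::finite) cavity_data \<Rightarrow> (real ^ 'd \<Rightarrow> real) \<Rightarrow> real ^ 'd \<Rightarrow> 'd tensor4" where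
  "C_delta P v x i j k l = C0 P x i j k l + C_diff P x i j k l * v x"

definition elastic_form :: "('d::finite) cavity_data \<Rightarrow> (real ^ 'd \<Rightarrow> real) \<Rightarrow>
    (real ^ 'd \<Rightarrow> real ^ 'd) \<Rightarrow> (real ^ 'd \<Rightarrow> real ^ 'd) \<Rightarrow> real" where
  "elastic_form P v u w = (LINT x|lebesgue_on (Omega P).
     tensor_app (C_delta P v x) (sym_grad (Omega P) u x) \<bullet> sym_grad (Omega P) w x)"

definition solves_N ::
  "('d::finite) cavity_data \<Rightarrow> real \<Rightarrow> (real ^ 'd \<Rightarrow> real) \<Rightarrow> (real ^ 'd \<Rightarrow> real ^ 'd) \<Rightarrow> bool" where
  "solves_N P h v u \<longleftrightarrow> u \<in> Vh_SigmaD P h \<and>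
     (\<forall>\<phi> \<in> Vh_SigmaD P h.
        elastic_form P v u \<phi> = (LINT x|surface_on (SigmaN P). traction_h P h x \<bullet> \<phi> x))"

definition solves_D ::
  "('d::finite) cavity_data \<Rightarrow> real \<Rightarrow> (real ^ 'd \<Rightarrow> real) \<Rightarrow> (real ^ 'd \<Rightarrow> real ^ 'd) \<Rightarrow> bool" where
  "solves_D P h v u \<longleftrightarrow> (\<lambda>x. u x - lifting_h P h x) \<in> Vh_0 P h \<and>
     (\<forall>\<psi> \<in> Vh_0 P h. elastic_form P v u \<psi> = 0)"

text \<open>The solutions are unique on the closure of the domain; only their values outside it, which
  never matter, depend on the choice.\<close>

definition uN :: "('d::finite) cavity_data \<Rightarrow> real \<Rightarrow> (real ^ 'd \<Rightarrow> real) \<Rightarrow> real ^ 'd \<Rightarrow> real ^ 'd" where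
  "uN P h v = (SOME u. solves_N P h v u)"

definition uD :: "('d::finite) cavity_data \<Rightarrow> real \<Rightarrow> (real ^ 'd \<Rightarrow> real) \<Rightarrow> real ^ 'd \<Rightarrow> real ^ 'd" where
  "uD P h v = (SOME u. solves_D P h v u)"

definition J :: "('d::finite) cavity_data \<Rightarrow> real \<Rightarrow> (real ^ 'd \<Rightarrow> real) \<Rightarrow> real" where
  "J P h v =
     1/2 * elastic_form P v (uN P h v) (uN P h v)
     + 1/2 * elastic_form P v (uD P h v) (uD P h v)
     - (LINT x|surface_on (SigmaN P). lifting_h P h x \<bullet> traction_h P h x)
     + gam P * (LINT x|lebesgue_on (Omega P).
         epsilon P * (norm (weak_grad (Omega P) v x))\<^sup>2 + 1 / epsilon P * (v x * (1 - v x)))"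

definition shape_term :: "('d::finite) cavity_data \<Rightarrow> (real ^ 'd \<Rightarrow> real) \<Rightarrow>
    (real ^ 'd \<Rightarrow> real ^ 'd) \<Rightarrow> real" where
  "shape_term P \<eta> u = (LINT x|lebesgue_on (Omega P).
     \<eta> x * (tensor_app (C_diff P x) (sym_grad (Omega P) u x) \<bullet> sym_grad (Omega P) u x))"

definition J_deriv ::
  "('d::finite) cavity_data \<Rightarrow> real \<Rightarrow> (real ^ 'd \<Rightarrow> real) \<Rightarrow> (real ^ 'd \<Rightarrow> real) \<Rightarrow> real" where
  "J_deriv P h v \<eta> =
     1/2 * shape_term P \<eta> (uD P h v)
     - 1/2 * shape_term P \<eta> (uN P h v)
     + 2 * gam P * epsilon P *
         (LINT x|lebesgue_on (Omega P). weak_grad (Omega P) v x \<bullet> weak_grad (Omega P) \<eta> x)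
     + gam P / epsilon P * (LINT x|lebesgue_on (Omega P). (1 - 2 * v x) * \<eta> x)"

text \<open>One step of the scheme, from \<open>v\<close> to \<open>w\<close> with time step \<open>\<tau>\<close>.\<close>

definition scheme_step :: "('d::finite) cavity_data \<Rightarrow> real \<Rightarrow> real \<Rightarrow>
    (real ^ 'd \<Rightarrow> real) \<Rightarrow> (real ^ 'd \<Rightarrow> real) \<Rightarrow> bool" where
  "scheme_step P h \<tau> v w \<longleftrightarrow> w \<in> Kh P h \<and>
     (\<forall>\<omega> \<in> Kh P h.
        1 / \<tau> * (LINT x|lebesgue_on (Omega P). (w x - v x) * (\<omega> x - w x))
        - 1/2 * shape_term P (\<lambda>x. \<omega> x - w x) (uN P h v)
        + 1/2 * shape_term P (\<lambda>x. \<omega> x - w x) (uD P h v)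
        + 2 * gam P * epsilon P * (LINT x|lebesgue_on (Omega P).
            weak_grad (Omega P) w x \<bullet> weak_grad (Omega P) (\<lambda>y. \<omega> y - w y) x)
        + gam P / epsilon P * (LINT x|lebesgue_on (Omega P). (1 - 2 * v x) * (\<omega> x - w x)) \<ge> 0)"

definition norm_uN :: "('d::finite) cavity_data \<Rightarrow> real \<Rightarrow> (real ^ 'd \<Rightarrow> real) \<Rightarrow> real" where
  "norm_uN P h v = enn2real (W1inf_norm_vec (Omega P) (uN P h v))"

definition norm_uD :: "('d::finite) cavity_data \<Rightarrow> real \<Rightarrow> (real ^ 'd \<Rightarrow> real) \<Rightarrow> real" where
  "norm_uD P h v = enn2real (W1inf_norm_vec (Omega P) (uD P h v))"

text \<open>For fixed data and mesh size, \<open>c\<close> gives a constant that depends on the current iterate \<open>v\<close> only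
  through the two \<open>W\<^sup>1\<^sup>,\<^sup>\<infinity>\<close> norms and stays bounded as long as these do (without the latter the time
  steps could be forced to zero), and that guarantees energy decrease.\<close>

definition time_step_constant ::
  "('d::finite) cavity_data \<Rightarrow> real \<Rightarrow> (real \<Rightarrow> real \<Rightarrow> real) \<Rightarrow> bool" where
  "time_step_constant P h c \<longleftrightarrow>
     (\<forall>a\<ge>0. \<forall>b\<ge>0. c a b > 0) \<and>
     (\<forall>R. \<exists>M. \<forall>a \<in> {0..R}. \<forall>b \<in> {0..R}. c a b \<le> M) \<and>
     (\<forall>v \<in> Kh P h. \<forall>\<tau> w. 0 < \<tau> \<and> \<tau> \<le> 1 / (1 + c (norm_uN P h v) (norm_uD P h v)) \<and>
        scheme_step P h \<tau> v w \<longrightarrow>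
        (LINT x|lebesgue_on (Omega P). (w x - v x)\<^sup>2) + J P h w \<le> J P h v)"

end

theory Submission
  imports Defs
begin

text \<open>Functions in \<open>Kh\<close> are piecewise affine with values in \<open>[0, 1]\<close>, so \<open>Kh\<close> is compact for uniform
  convergence, and on piecewise affine functions uniform convergence controls the gradients as well. An
  infinitesimal rigid motion that vanishes on a boundary part of positive surface measure is zero, hence
  by compactness Korn's inequality holds on the discrete spaces. It makes the elastic problems uniquely
  solvable, with solutions that are bounded uniformly in \<open>v \<in> Kh\<close> and depend continuously on \<open>v\<close>.
  Therefore \<open>c\<^sub>1\<close> is bounded along every sequence of iterates, and \<open>\<tau>\<^sub>n = 1 / (1 + c\<^sub>1)\<close> stays away from
  zero; a step of the scheme exists because it is the variational inequality of a continuous functional on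
  the compact convex set \<open>Kh\<close>. Since the energy is bounded below and decreases by at least
  \<open>\<parallel>v\<^sub>n\<^sub>+\<^sub>1 - v\<^sub>n\<parallel>\<^sup>2\<close>, these increments tend to zero. So \<open>v\<^sub>n\<close> and \<open>v\<^sub>n\<^sub>+\<^sub>1\<close> have the same limit
  along a subsequence, the term with \<open>1 / \<tau>\<^sub>n\<close> disappears, and the limit of the scheme is the optimality
  condition.\<close>

subsection \<open>Smooth functions\<close>

text \<open>Two encodings have to be made concrete before the analysis can start.
  \<open>weak_grad\<close> is an arbitrary choice among weak gradients, so every integral stays
  opaque until a piecewise affine function is known to have its classical gradient
  \<open>cgrad\<close> as weak gradient and weak gradients are known to agree almost everywhere.
  This takes explicit test functions and an integration by parts that does without a divergence
  theorem. The surface measure is given through coverings only, yet two facts about it are needed: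
  sets of dimension d - 2 are null, so that a nonzero rigid motion cannot vanish on
  \<open>SigmaD P\<close>, and the boundary has finite measure, so that the traction is a bounded
  functional. Both come from counting the cells of one grid. Since C1 is \<open>delta P\<close>
  times C0, the tensor C_delta(v) is a scalar weight times C0, and one weighted form serves all
  elastic terms. Compactness gives no explicit constants, but all its bounds are uniform over
  \<open>Kh P h\<close>; this is why \<beta> can be fixed before the initial guess.\<close>

lemma partial_eq:
  assumes "(f has_derivative f') (at x)"
  shows "partial i f x = f' (axis i 1)"
  unfolding partial_def using frechet_derivative_at[OF assms] by simp

lemma Ck_const: "Ck k (\<lambda>_::real^'d. c)"
proof (induction k arbitrary: c)
  case (Suc k)
  have "partial i (\<lambda>_::real^'d. c) = (\<lambda>_. 0)" for i
    by (rule ext, subst partial_eq[where f' = "\<lambda>_. 0"]) auto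
  then show ?case using Suc by simp
qed simp

lemma Ck_Suc_imp: "Ck (Suc k) f \<Longrightarrow> Ck k f"
proof (induction k arbitrary: f)
  case 0 then show ?case by (simp add: differentiable_imp_continuous_on)
qed auto

lemma Ck_add: "Ck k f \<Longrightarrow> Ck k g \<Longrightarrow> Ck k (\<lambda>x. f x + g x)"
proof (induction k arbitrary: f g)
  case 0 then show ?case by (auto intro: continuous_intros)
next
  case (Suc k)
  have df: "\<And>x. f differentiable (at x)" "\<And>x. g differentiable (at x)"
    using Suc.prems by (auto simp: differentiable_on_def)
  have "partial i (\<lambda>x. f x + g x) = (\<lambda>x. partial i f x + partial i g x)" for i
    by (rule ext, subst partial_eq[OF has_derivative_add[OF
          df(1)[unfolded frechet_derivative_works] df(2)[unfolded frechet_derivative_works]]])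
      (simp add: partial_def)
  then show ?case using Suc by (auto intro: differentiable_on_add)
qed

lemma Ck_mult: "Ck k f \<Longrightarrow> Ck k g \<Longrightarrow> Ck k (\<lambda>x. f x * g x)"
proof (induction k arbitrary: f g)
  case 0 then show ?case by (auto intro: continuous_intros)
next
  case (Suc k)
  have df: "\<And>x. f differentiable (at x)" "\<And>x. g differentiable (at x)"
    using Suc.prems by (auto simp: differentiable_on_def)
  have "partial i (\<lambda>x. f x * g x) = (\<lambda>x. f x * partial i g x + partial i f x * g x)" for i
    by (rule ext, subst partial_eq[OF has_derivative_mult[OF
          df(1)[unfolded frechet_derivative_works] df(2)[unfolded frechet_derivative_works]]])
      (simp add: partial_def)
  then show ?case
    using Suc Ck_Suc_imp[OF Suc.prems(1)] Ck_Suc_imp[OF Suc.prems(2)]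
    by (auto intro!: Ck_add differentiable_on_mult)
qed

lemma Ck_prod: "finite I \<Longrightarrow> (\<And>i. i \<in> I \<Longrightarrow> Ck k (f i)) \<Longrightarrow> Ck k (\<lambda>x. \<Prod>i\<in>I. f i x)"
  by (induction I rule: finite_induct) (auto intro: Ck_const Ck_mult)

text \<open>Induction on k with m free: a partial derivative either moves from \<open>F m\<close> to
  \<open>F (Suc m)\<close> or is zero.\<close>

lemma Ck_coord:
  fixes F :: "nat \<Rightarrow> real \<Rightarrow> real"
  assumes "\<And>m s. (F m has_real_derivative F (Suc m) s) (at s)"
  shows "Ck k (\<lambda>x::real^'d. F m (x $ i))"
proof (induction k arbitrary: m)
  case 0
  have "continuous_on UNIV (F m)"
    using assms DERIV_continuous_on by blast
  then show ?case
    using continuous_on_compose2[of UNIV "F m" UNIV "\<lambda>x::real^'d. x $ i"]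
    by (simp add: continuous_on_component)
next
  case (Suc k)
  have d: "((\<lambda>x::real^'d. F m (x $ i)) has_derivative (\<lambda>y. y $ i * F (Suc m) (x $ i))) (at x)" for x
    by (rule DERIV_compose_FDERIV[OF assms bounded_linear_imp_has_derivative[OF bounded_linear_vec_nth]])
  have "partial j (\<lambda>x::real^'d. F m (x $ i)) =
      (if i = j then (\<lambda>x. F (Suc m) (x $ i)) else (\<lambda>_. 0))" for j
    by (rule ext, subst partial_eq[OF d]) (auto simp: axis_def)
  then show ?case using Suc d Ck_const[of k 0]
    by (auto simp: differentiable_on_def differentiable_def intro!: exI)
qed

section \<open>Flat functions and smooth bumps supported on boxes\<close>

definition flat :: "real \<Rightarrow> real poly \<Rightarrow> real \<Rightarrow> real" where
  "flat c p s = (if s > 0 then poly p (1/s) * exp (- (c/s)) else 0)"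

text \<open>The derivative of p(1/s) exp(-c/s) is (1/s^2) (c p - p')(1/s) exp(-c/s); the factor
  \<open>[:0, 0, 1:]\<close> stands for 1/s^2. The polynomial prefactor in \<open>flat\<close> makes
  the family closed under differentiation.\<close>

definition flat_step :: "real \<Rightarrow> real poly \<Rightarrow> real poly" where
  "flat_step c p = [:0, 0, 1:] * (smult c p - pderiv p)"

lemma poly_times_exp_tendsto_0:
  assumes "c > 0"
  shows "((\<lambda>t. poly q t * exp (- (c * t))) \<longlongrightarrow> (0::real)) at_top"
proof -
  have "((\<lambda>t. t ^ k * exp (- (c * t))) \<longlongrightarrow> (0::real)) at_top" for k
  proof -
    have "((\<lambda>t. (c * t) ^ k / exp (c * t)) \<longlongrightarrow> 0) at_top"
      by (rule filterlim_compose[OF tendsto_power_div_exp_0])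
        (use assms in \<open>auto intro: filterlim_tendsto_pos_mult_at_top[OF tendsto_const _ filterlim_ident]\<close>)
    then have "((\<lambda>t. (1 / c ^ k) * ((c * t) ^ k / exp (c * t))) \<longlongrightarrow> (1 / c ^ k) * 0) at_top"
      by (intro tendsto_mult tendsto_const)
    then show ?thesis using assms by (simp add: power_mult_distrib exp_minus field_simps)
  qed
  then have "((\<lambda>t. \<Sum>i\<le>degree q. coeff q i * (t ^ i * exp (- (c * t)))) \<longlongrightarrow> (\<Sum>i\<le>degree q. coeff q i * 0)) at_top"
    by (intro tendsto_intros)
  then show ?thesis by (simp add: poly_altdef sum_distrib_right mult.assoc)
qed

lemma flat_has_derivative:
  assumes c: "c > 0"
  shows "(flat c p has_real_derivative flat c (flat_step c p) s) (at s)"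
proof -
  consider "s > 0" | "s < 0" | "s = 0" by linarith
  then show ?thesis
  proof cases
    case 1
    have "((\<lambda>s. poly p (1/s) * exp (- (c/s))) has_real_derivative flat c (flat_step c p) s) (at s)"
      using 1 by (auto intro!: derivative_eq_intros poly_DERIV[THEN DERIV_chain2]
          simp: flat_def flat_step_def field_simps power2_eq_square)
    then show ?thesis
      by (rule DERIV_cong_ev[THEN iffD1, rotated -1, OF _ refl])
        (use 1 in \<open>auto simp: flat_def intro!: eventually_mono[OF eventually_nhds_in_open[of "{0<..}"]]\<close>)
  next
    case 2
    have "((\<lambda>s. 0) has_real_derivative flat c (flat_step c p) s) (at s)"
      using 2 by (auto simp: flat_def)
    then show ?thesis
      by (rule DERIV_cong_ev[THEN iffD1, rotated -1, OF _ refl])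
        (use 2 in \<open>auto simp: flat_def intro!: eventually_mono[OF eventually_nhds_in_open[of "{..<0}"]]\<close>)
  next
    case 3
    \<comment> \<open>With t = 1/h the difference quotient \<open>flat c p h / h\<close> is t p(t)
      exp(-c t), and \<open>pCons 0 p\<close> is the polynomial t p(t).\<close>
    have *: "((\<lambda>t. poly (pCons 0 p) t * exp (- (c * t))) \<longlongrightarrow> (0::real)) at_top"
      by (rule poly_times_exp_tendsto_0[OF c])
    have "((\<lambda>h. poly (pCons 0 p) (inverse h) * exp (- (c * inverse h))) \<longlongrightarrow> 0) (at_right 0)"
      by (rule filterlim_compose[OF * filterlim_inverse_at_top_right])
    then have r: "((\<lambda>h. flat c p h / h) \<longlongrightarrow> 0) (at_right 0)"
      by (rule Lim_transform_eventually)
        (auto simp: flat_def eventually_at_right_less field_simps intro!: eventually_mono[OF eventually_at_right_less])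
    have l: "((\<lambda>h. flat c p h / h) \<longlongrightarrow> 0) (at_left 0)"
      by (rule Lim_transform_eventually[OF tendsto_const])
        (auto simp: flat_def eventually_at_left_field intro: exI[of _ "-1"])
    from l r have "((\<lambda>h. flat c p h / h) \<longlongrightarrow> 0) (at 0)"
      by (simp add: filterlim_split_at)
    then show ?thesis using 3 by (simp add: DERIV_def flat_def)
  qed
qed

primrec flat_poly :: "real \<Rightarrow> nat \<Rightarrow> real poly" where
  "flat_poly c 0 = 1"
| "flat_poly c (Suc k) = flat_step c (flat_poly c k)"

lemma Ck_flat_coord:
  assumes c: "c > 0"
  shows "Ck k (\<lambda>x::real^'d. flat c 1 (\<alpha> * x $ i + \<beta>))"
proof -
  \<comment> \<open>The power of \<alpha> collects the chain rule factors, so that \<open>F\<close>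
    is a family of the kind required by \<open>Ck_coord\<close>.\<close>
  define F where "F m s = \<alpha> ^ m * flat c (flat_poly c m) (\<alpha> * s + \<beta>)" for m s
  have "(F m has_real_derivative F (Suc m) s) (at s)" for m s
  proof -
    have "((\<lambda>s. flat c (flat_poly c m) (\<alpha> * s + \<beta>)) has_real_derivative
        flat c (flat_poly c (Suc m)) (\<alpha> * s + \<beta>) * \<alpha>) (at s)"
      unfolding flat_poly.simps
      by (rule DERIV_chain2[OF flat_has_derivative[OF c]]) (auto intro!: derivative_eq_intros)
    from DERIV_cmult[OF this, of "\<alpha> ^ m"] show ?thesis
      unfolding F_def by (simp add: mult_ac)
  qed
  from Ck_coord[of F, OF this, of k 0 i] show ?thesis by (simp add: F_def)
qed

text \<open>A smooth function that is nonzero exactly on the open box. The parameter c is there to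
  be sent to zero, which turns the bump into the indicator of the box.\<close>

definition bump :: "real ^ 'd \<Rightarrow> real ^ 'd \<Rightarrow> real \<Rightarrow> real ^ 'd \<Rightarrow> real" where
  "bump a b c x = (\<Prod>i\<in>UNIV. flat c 1 (x $ i - a $ i) * flat c 1 (b $ i - x $ i))"

lemma flat_one_bounds: "c > 0 \<Longrightarrow> 0 \<le> flat c 1 s" "c > 0 \<Longrightarrow> flat c 1 s \<le> 1"
  by (auto simp: flat_def)

lemma bump_bounds:
  assumes "c > 0"
  shows "0 \<le> bump a b c x" "bump a b c x \<le> 1"
proof -
  have "0 \<le> flat c 1 s * flat c 1 t" "flat c 1 s * flat c 1 t \<le> 1" for s t
    using flat_one_bounds[OF assms] by (auto intro: mult_le_one)
  note * = this
  show "0 \<le> bump a b c x"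
    unfolding bump_def by (rule prod_nonneg) (rule *(1))
  show "bump a b c x \<le> 1"
    unfolding bump_def by (rule prod_le_1) (rule conjI *)+
qed

lemma bump_nonzero_iff: "bump a b c x \<noteq> 0 \<longleftrightarrow> x \<in> box a b"
  by (auto simp: bump_def flat_def mem_box_cart split: if_splits)

lemma test_function_bump:
  assumes c: "c > 0" and sub: "cbox a b \<subseteq> \<Omega>"
  shows "test_function \<Omega> (bump a b c)"
proof -
  have "Ck k (bump a b c)" for k
  proof -
    have "Ck k (\<lambda>x. \<Prod>i\<in>UNIV. flat c 1 (1 * x $ i + - a $ i) * flat c 1 (-1 * x $ i + b $ i))"
      by (intro Ck_prod Ck_mult Ck_flat_coord[OF c]) auto
    then show ?thesis unfolding bump_def[abs_def] by simp
  qed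
  moreover have "closure {x. bump a b c x \<noteq> 0} \<subseteq> cbox a b"
    unfolding bump_nonzero_iff using closure_minimal[OF box_subset_cbox closed_cbox] by simp
  moreover have "compact (closure {x. bump a b c x \<noteq> 0})"
    unfolding bump_nonzero_iff by (simp add: bounded_box)
  ultimately show ?thesis unfolding test_function_def using sub by auto
qed

text \<open>For s > 0 the factor exp(-c/s) tends to 1 as c tends to 0; off the box the bump is zero
  for every c.\<close>

lemma bump_tendsto: "(\<lambda>n. bump a b (1 / real (Suc n)) x) \<longlonglongrightarrow> indicator (box a b) x"
proof (cases "x \<in> box a b")
  case True
  have fl: "(\<lambda>n. flat (1 / real (Suc n)) 1 s) \<longlonglongrightarrow> 1" if "s > 0" for s
  proof -
    have "(\<lambda>n. exp (- (1 / real (Suc n) / s))) \<longlonglongrightarrow> exp (- (0 / s))"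
      by (intro tendsto_intros LIMSEQ_Suc lim_1_over_n) (use that in auto)
    then show ?thesis using that by (simp add: flat_def)
  qed
  have "(\<lambda>n. bump a b (1 / real (Suc n)) x) \<longlonglongrightarrow> (\<Prod>i\<in>(UNIV::'a set). 1 * 1)"
    unfolding bump_def
    by (intro tendsto_prod tendsto_mult fl) (use True in \<open>auto simp: mem_box_cart\<close>)
  then show ?thesis using True by simp
next
  case False
  then have "bump a b (1 / real (Suc n)) x = 0" for n using bump_nonzero_iff by blast
  then show ?thesis using False by simp
qed

subsection \<open>Uniqueness of weak gradients\<close>

text \<open>The positive and negative parts of f are densities of two finite measures that agree on
  boxes. Boxes form an intersection-stable generator, so the measures coincide, and so do their
  densities almost everywhere.\<close>

lemma integrable_box_zero_imp_AE_zero: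
  fixes f :: "'a::euclidean_space \<Rightarrow> real"
  assumes f: "integrable lborel f"
    and z: "\<And>a b. (LINT x|lborel. indicator (box a b) x * f x) = 0"
  shows "AE x in lborel. f x = 0"
proof -
  have [measurable]: "f \<in> borel_measurable borel" using f by auto
  define p where "p x = ennreal (max (f x) 0)" for x
  define m where "m x = ennreal (max (- f x) 0)" for x
  have [measurable]: "p \<in> borel_measurable borel" "m \<in> borel_measurable borel"
    by (simp_all add: p_def[abs_def] m_def[abs_def])
  have eq: "emeasure (density lborel p) (box a b) = emeasure (density lborel m) (box a b)" for a b
  proof -
    have i: "integrable lborel (\<lambda>x. indicator (box a b) x * max (f x) 0)"
      "integrable lborel (\<lambda>x. indicator (box a b) x * max (- f x) 0)"
      by (rule Bochner_Integration.integrable_bound[OF f]; auto split: split_indicator)+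
    have "(LINT x|lborel. indicator (box a b) x * max (f x) 0)
        - (LINT x|lborel. indicator (box a b) x * max (- f x) 0) = (LINT x|lborel. indicator (box a b) x * f x)"
      by (subst Bochner_Integration.integral_diff[OF i, symmetric])
        (auto intro!: Bochner_Integration.integral_cong split: split_indicator)
    then have e: "(LINT x|lborel. indicator (box a b) x * max (f x) 0)
        = (LINT x|lborel. indicator (box a b) x * max (- f x) 0)" using z by simp
    have "emeasure (density lborel p) (box a b) = (\<integral>\<^sup>+x. ennreal (indicator (box a b) x * max (f x) 0) \<partial>lborel)"
      by (subst emeasure_density) (auto simp: p_def intro!: nn_integral_cong split: split_indicator)
    also have "\<dots> = (\<integral>\<^sup>+x. ennreal (indicator (box a b) x * max (- f x) 0) \<partial>lborel)"
      using nn_integral_eq_integral[OF i(1)] nn_integral_eq_integral[OF i(2)] e by auto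
    also have "\<dots> = emeasure (density lborel m) (box a b)"
      by (subst emeasure_density) (auto simp: m_def intro!: nn_integral_cong split: split_indicator)
    finally show ?thesis .
  qed
  have fin: "emeasure (density lborel p) A \<noteq> \<infinity>" if "A \<in> sets borel" for A
  proof -
    have "emeasure (density lborel p) A \<le> (\<integral>\<^sup>+x. ennreal (norm (f x)) \<partial>lborel)"
      using that by (subst emeasure_density) (auto simp: p_def intro!: nn_integral_mono ennreal_leI split: split_indicator)
    also have "\<dots> < \<infinity>" using f by (simp add: integrable_iff_bounded)
    finally show ?thesis by simp
  qed
  have "density lborel p = density lborel m"
  proof (rule measure_eqI_generator_eq)
    let ?E = "range (\<lambda>(a, b). box a b::'a set)"
    show "Int_stable ?E"
      by (auto simp: Int_stable_def box_Int_box)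
    show "?E \<subseteq> Pow UNIV" "sets (density lborel p) = sigma_sets UNIV ?E"
      "sets (density lborel m) = sigma_sets UNIV ?E"
      by (simp_all add: borel_eq_box)
    let ?A = "\<lambda>n::nat. box (- (real n *\<^sub>R One)) (real n *\<^sub>R One) :: 'a set"
    show "range ?A \<subseteq> ?E" "(\<Union>i. ?A i) = UNIV"
      unfolding UN_box_eq_UNIV by auto
    show "emeasure (density lborel p) (?A i) \<noteq> \<infinity>" for i by (rule fin) auto
    show "emeasure (density lborel p) X = emeasure (density lborel m) X" if "X \<in> ?E" for X
      using that eq by auto
  qed
  then have "AE x in lborel. p x = m x"
    by (subst (asm) sigma_finite_measure.density_unique_iff[OF sigma_finite_lborel]) auto
  then show ?thesis
    by (rule AE_mp) (auto simp: p_def m_def max_def ennreal_eq_0_iff split: if_splits intro!: AE_I2)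
qed

text \<open>The fundamental lemma of the calculus of variations. Bumps with c tending to 0 show by
  dominated convergence that H has integral zero over each box inside \<Omega>; hence H vanishes
  almost everywhere on each such box, and countably many of them exhaust \<Omega>.\<close>

lemma AE_zero_if_test_integrals_zero:
  fixes H :: "real ^ 'd \<Rightarrow> real"
  assumes op: "open \<Omega>" and loc: "\<And>K. compact K \<Longrightarrow> K \<subseteq> \<Omega> \<Longrightarrow> H absolutely_integrable_on K"
    and z: "\<And>\<phi>. test_function \<Omega> \<phi> \<Longrightarrow> (LINT x|lebesgue_on \<Omega>. H x * \<phi> x) = 0"
  shows "AE x in lebesgue_on \<Omega>. H x = 0"
proof -
  have Om: "\<Omega> \<in> sets lebesgue" using op by auto
  have box0: "(LINT x|lebesgue. indicator (box a b) x * H x) = 0" if sub: "cbox a b \<subseteq> \<Omega>" for a b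
  proof -
    have iH: "integrable lebesgue (\<lambda>x. indicator (cbox a b) x * H x)"
      using loc[OF compact_cbox sub] by (simp add: set_integrable_def)
    have "(\<lambda>n. LINT x|lebesgue. (indicator (cbox a b) x * H x) * bump a b (1 / real (Suc n)) x)
        \<longlonglongrightarrow> (LINT x|lebesgue. (indicator (cbox a b) x * H x) * indicator (box a b) x)"
    proof (rule integral_dominated_convergence[where w = "\<lambda>x. norm (indicator (cbox a b) x * H x)"])
      show "(\<lambda>x. indicator (cbox a b) x * H x * indicator (box a b) x) \<in> borel_measurable lebesgue"
        using borel_measurable_integrable[OF iH] by (intro borel_measurable_times[of "\<lambda>x. _ x * _ x"] borel_measurable_indicator) auto
      have c: "bump a b (1 / real (Suc n)) \<in> borel_measurable lebesgue" for n
      proof -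
        have "Ck 0 (bump a b (1 / real (Suc n)))"
          using test_function_bump[of "1 / real (Suc n)" a b UNIV] unfolding test_function_def by auto
        then have "bump a b (1 / real (Suc n)) \<in> borel_measurable borel"
          by (auto intro: borel_measurable_continuous_onI)
        then show ?thesis by (intro measurable_completion) simp
      qed
      show "(\<lambda>x. indicator (cbox a b) x * H x * bump a b (1 / real (Suc n)) x) \<in> borel_measurable lebesgue" for n
        by (rule borel_measurable_times[OF borel_measurable_integrable[OF iH] c])
      show "AE x in lebesgue. (\<lambda>n. indicator (cbox a b) x * H x * bump a b (1 / real (Suc n)) x)
          \<longlonglongrightarrow> indicator (cbox a b) x * H x * indicator (box a b) x"
        by (intro AE_I2 tendsto_mult tendsto_const bump_tendsto)
      show "AE x in lebesgue. norm (indicator (cbox a b) x * H x * bump a b (1 / real (Suc n)) x)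
            \<le> norm (indicator (cbox a b) x * H x)" for n
        using bump_bounds[of "1 / real (Suc n)" a b]
        by (intro AE_I2) (auto simp: abs_mult intro!: mult_left_le)
    qed (use iH in auto)
    moreover have "(LINT x|lebesgue. (indicator (cbox a b) x * H x) * bump a b (1 / real (Suc n)) x) = 0" for n
    proof -
      have "(LINT x|lebesgue_on \<Omega>. H x * bump a b (1 / real (Suc n)) x) = 0"
        by (intro z test_function_bump sub) auto
      moreover have "(LINT x|lebesgue_on \<Omega>. H x * bump a b (1 / real (Suc n)) x)
          = (LINT x|lebesgue. (indicator (cbox a b) x * H x) * bump a b (1 / real (Suc n)) x)"
        unfolding integral_restrict_space[of \<Omega> lebesgue, simplified, OF Om]
        using bump_nonzero_iff[of a b "1 / real (Suc n)"] sub box_subset_cbox[of a b]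
        by (intro Bochner_Integration.integral_cong refl) (auto split: split_indicator)
      ultimately show ?thesis by simp
    qed
    moreover have "indicator (cbox a b) x * H x * indicator (box a b) x = indicator (box a b) x * H x" for x
      using box_subset_cbox[of a b] by (auto split: split_indicator)
    ultimately show ?thesis by (simp add: LIMSEQ_const_iff)
  qed
  have ae: "AE x in lebesgue. x \<in> box a b \<longrightarrow> H x = 0" if sub: "cbox a b \<subseteq> \<Omega>" for a b
  proof -
    have iH: "integrable lebesgue (\<lambda>x. indicator (box a b) x * H x)"
    proof -
      have "H absolutely_integrable_on box a b"
        by (rule set_integrable_subset[OF loc[OF compact_cbox sub]]) (auto simp: box_subset_cbox)
      then show ?thesis by (simp add: set_integrable_def)
    qed
    \<comment> \<open>H is only Lebesgue measurable, whereas the statement about boxes concerns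
      Borel functions; a Borel representative bridges the gap.\<close>
    obtain f where f: "f \<in> borel_measurable lborel" "AE x in lborel. indicator (box a b) x * H x = f x"
      using completion_ex_borel_measurable_real[of "\<lambda>x. indicator (box a b) x * H x" lborel] iH by auto
    have f': "AE x in lebesgue. indicator (box a b) x * H x = f x" using f(2) by (rule AE_completion)
    have fl: "f \<in> borel_measurable lebesgue" using f(1) by (rule measurable_completion)
    have "integrable lebesgue f"
      by (rule Bochner_Integration.integrable_cong_AE_imp[OF iH fl]) (use f' in auto)
    then have fi: "integrable lborel f" using f(1) by (simp add: integrable_completion)
    have "(LINT x|lborel. indicator (box u v) x * f x) = 0" for u v
    proof -
      have "(LINT x|lborel. indicator (box u v) x * f x) = (LINT x|lebesgue. indicator (box u v) x * f x)"
        using f(1) by (intro integral_completion[symmetric]) auto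
      also have "\<dots> = (LINT x|lebesgue. indicator (box u v) x * (indicator (box a b) x * H x))"
        by (rule integral_cong_AE)
          (use f' in \<open>auto intro!: borel_measurable_times[OF _ fl] borel_measurable_times[OF _ borel_measurable_integrable[OF iH]] borel_measurable_indicator\<close>)
      also have "\<dots> = (LINT x|lebesgue. indicator (box u v \<inter> box a b) x * H x)"
        by (intro Bochner_Integration.integral_cong) (auto split: split_indicator)
      also have "\<dots> = 0"
      proof (cases "box u v \<inter> box a b = {}")
        case False
        \<comment> \<open>The intersection is again a box, and since it is nonempty its closed
          version is its closure, which stays inside \<open>cbox a b\<close> and thus inside
          \<Omega>.\<close>
        obtain u' v' where uv: "box u v \<inter> box a b = box u' v'" using that[OF box_Int_box] .
        then have "cbox u' v' = closure (box u' v')" using False closure_box[of u' v'] by simp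
        also have "\<dots> \<subseteq> cbox a b" using uv box_subset_cbox[of a b] by (intro closure_minimal) auto
        finally show ?thesis unfolding uv by (intro box0) (use sub in auto)
      qed simp
      finally show ?thesis .
    qed
    from integrable_box_zero_imp_AE_zero[OF fi this] have "AE x in lebesgue. f x = 0" by (rule AE_completion)
    with f' show ?thesis by eventually_elim auto
  qed
  obtain \<D> where D: "countable \<D>" "\<D> \<subseteq> Pow \<Omega>" "\<And>X. X \<in> \<D> \<Longrightarrow> \<exists>a b. X = cbox a b" "\<Union>\<D> = \<Omega>"
    using open_countable_Union_open_cbox[OF op] by metis
  have "AE x in lebesgue. x \<in> X \<longrightarrow> H x = 0" if X: "X \<in> \<D>" for X
  proof -
    obtain a b where X': "X = cbox a b" using D(3)[OF X] by auto
    have "cbox a b \<subseteq> \<Omega>" using X X' D(2) by auto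
    from ae[OF this] have "AE x in lebesgue. x \<in> box a b \<longrightarrow> H x = 0" .
    \<comment> \<open>The countable cover uses closed boxes, while the vanishing is known on open
      ones; the difference is null.\<close>
    moreover have "AE x in lebesgue. x \<notin> cbox a b - box a b"
      by (intro AE_not_in) (metis negligible_frontier_interval negligible_iff_null_sets)
    ultimately show ?thesis unfolding X' by eventually_elim auto
  qed
  then have "AE x in lebesgue. \<forall>X\<in>\<D>. x \<in> X \<longrightarrow> H x = 0"
    by (subst AE_ball_countable[OF D(1)]) auto
  then have "AE x in lebesgue. x \<in> \<Omega> \<longrightarrow> H x = 0"
    by eventually_elim (use D(4) in auto)
  then show ?thesis using Om by (subst AE_restrict_space_iff) auto
qed

subsection \<open>Measurability and integrals on subsets of Euclidean space\<close>

text \<open>By completeness of Lebesgue measure nothing has to be assumed about g. This matters for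
  \<open>weak_grad\<close>, which is accessible only almost everywhere.\<close>

lemma lebesgue_on_borel_measurable_cong_AE:
  assumes S: "S \<in> sets lebesgue" and f: "f \<in> borel_measurable (lebesgue_on S)"
    and ae: "AE x in lebesgue_on S. f x = g x"
  shows "g \<in> borel_measurable (lebesgue_on S)"
proof (rule measurableI)
  fix A :: "'b set" assume A: "A \<in> sets borel"
  define N where "N = {x \<in> S. f x \<noteq> g x}"
  have "AE x in lebesgue. x \<notin> N"
    using ae S unfolding N_def by (subst (asm) AE_restrict_space_iff) auto
  then have N: "negligible N"
    by (simp add: AE_iff_null_sets negligible_iff_null_sets completion.AE_iff_null_sets)
  have 1: "{x \<in> S. f x \<in> A} \<in> sets lebesgue"
  proof -
    have "f -` A \<inter> space (lebesgue_on S) \<in> sets (lebesgue_on S)" by (rule measurable_sets[OF f A])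
    then show ?thesis using S by (auto simp: sets_restrict_space_iff vimage_def Int_def conj_commute)
  qed
  have "g -` A \<inter> space (lebesgue_on S) = ({x \<in> S. f x \<in> A} - N) \<union> (N \<inter> {x. g x \<in> A})"
    by (auto simp: N_def)
  moreover have "N \<inter> {x. g x \<in> A} \<in> sets lebesgue" "N \<in> sets lebesgue"
    using N by (auto intro!: negligible_imp_sets negligible_Int)
  ultimately have "g -` A \<inter> space (lebesgue_on S) \<in> sets lebesgue" using 1 by auto
  then show "g -` A \<inter> space (lebesgue_on S) \<in> sets (lebesgue_on S)"
    using S by (auto simp: sets_restrict_space_iff)
qed auto

text \<open>Free of measurability hypotheses: if one function is not measurable, neither is the
  other, and both integrals take the default value 0.\<close>

lemma lebesgue_on_integral_cong_AE:
  fixes f g :: "_ \<Rightarrow> _ :: {banach, second_countable_topology}"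
  assumes S: "S \<in> sets lebesgue" and ae: "AE x in lebesgue_on S. f x = g x"
  shows "(LINT x|lebesgue_on S. f x) = (LINT x|lebesgue_on S. g x)"
proof (cases "f \<in> borel_measurable (lebesgue_on S)")
  case True
  then show ?thesis
    using lebesgue_on_borel_measurable_cong_AE[OF S True ae] ae by (intro integral_cong_AE)
next
  case False
  then have "g \<notin> borel_measurable (lebesgue_on S)"
    using lebesgue_on_borel_measurable_cong_AE[OF S, of g f] ae by (auto simp: eq_commute)
  then show ?thesis using False by (metis not_integrable_integral_eq borel_measurable_integrable)
qed

text \<open>Each component of the difference of two weak gradients integrates to zero against every
  test function, so the fundamental lemma applies to it.\<close>

lemma has_weak_gradient_unique:
  fixes u :: "real ^ 'd \<Rightarrow> real"
  assumes op: "open \<Omega>" and G: "has_weak_gradient \<Omega> u G" and G': "has_weak_gradient \<Omega> u G'"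
  shows "AE x in lebesgue_on \<Omega>. G x = G' x"
proof -
  have Om: "\<Omega> \<in> sets lebesgue" using op by auto
  \<comment> \<open>A weak gradient is only locally integrable. The compact support of \<phi> makes
    the product integrable on all of \<Omega>, which is required to split the integral of the
    difference.\<close>
  have int: "integrable (lebesgue_on \<Omega>) (\<lambda>x. F x $ i * \<phi> x)"
    if F: "has_weak_gradient \<Omega> u F" and \<phi>: "test_function \<Omega> \<phi>" for F i \<phi>
  proof -
    define C where "C = closure {x. \<phi> x \<noteq> 0}"
    have C: "compact C" "C \<subseteq> \<Omega>" using \<phi> by (auto simp: test_function_def C_def)
    have c: "continuous_on UNIV \<phi>" using \<phi> unfolding test_function_def by (metis Ck.simps(1))
    obtain B where B: "\<And>x. x \<in> C \<Longrightarrow> \<bar>\<phi> x\<bar> \<le> B"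
      using compact_imp_bounded[OF compact_continuous_image[OF continuous_on_subset[OF c] C(1)]]
      by (auto simp: bounded_iff)
    have z: "\<phi> x = 0" if "x \<notin> C" for x using that closure_subset[of "{x. \<phi> x \<noteq> 0}"] by (auto simp: C_def)
    have iF: "integrable lebesgue (\<lambda>x. indicator C x *\<^sub>R F x)"
      using F C unfolding has_weak_gradient_def set_integrable_def by auto
    have iFi: "integrable lebesgue (\<lambda>x. (indicator C x *\<^sub>R F x) $ i)"
      by (rule integrable_bounded_linear[OF bounded_linear_vec_nth iF])
    have mphi: "\<phi> \<in> borel_measurable lebesgue"
      by (rule measurable_completion) (simp add: c borel_measurable_continuous_onI)
    have "integrable lebesgue (\<lambda>x. (indicator C x *\<^sub>R F x) $ i * \<phi> x)"
    proof (rule Bochner_Integration.integrable_bound)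
      show "integrable lebesgue (\<lambda>x. (indicator C x *\<^sub>R F x) $ i * B)"
        by (rule integrable_mult_left) (rule iFi)
      show "(\<lambda>x. (indicator C x *\<^sub>R F x) $ i * \<phi> x) \<in> borel_measurable lebesgue"
        by (rule borel_measurable_times[OF borel_measurable_integrable[OF iFi] mphi])
      have "norm ((indicator C x *\<^sub>R F x) $ i * \<phi> x) \<le> norm ((indicator C x *\<^sub>R F x) $ i * B)" for x
      proof (cases "x \<in> C")
        case True
        then have "\<bar>\<phi> x\<bar> \<le> \<bar>B\<bar>" using B[of x] by linarith
        then show ?thesis by (auto simp: abs_mult intro: mult_left_mono)
      qed simp
      then show "AE x in lebesgue. norm ((indicator C x *\<^sub>R F x) $ i * \<phi> x) \<le> norm ((indicator C x *\<^sub>R F x) $ i * B)"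
        by simp
    qed
    moreover have "(indicator C x *\<^sub>R F x) $ i * \<phi> x = indicator \<Omega> x *\<^sub>R (F x $ i * \<phi> x)" for x
      using C z[of x] by (auto split: split_indicator)
    then have "(\<lambda>x. (indicator C x *\<^sub>R F x) $ i * \<phi> x) = (\<lambda>x. indicator \<Omega> x *\<^sub>R (F x $ i * \<phi> x))"
      by (rule ext)
    ultimately have "integrable lebesgue (\<lambda>x. indicator \<Omega> x *\<^sub>R (F x $ i * \<phi> x))" by argo
    then show ?thesis
      by (subst integrable_restrict_space) (use Om in auto)
  qed
  have "AE x in lebesgue_on \<Omega>. G x $ i - G' x $ i = 0" for i
  proof (rule AE_zero_if_test_integrals_zero[OF op])
    fix K assume K: "compact K" "K \<subseteq> \<Omega>"
    have "G absolutely_integrable_on K" "G' absolutely_integrable_on K"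
      using K G G' by (auto simp: has_weak_gradient_def)
    then have "(\<lambda>x. G x - G' x) absolutely_integrable_on K" by (rule set_integral_diff)
    then have "integrable lebesgue (\<lambda>x. (indicator K x *\<^sub>R (G x - G' x)) $ i)"
      unfolding set_integrable_def by (rule integrable_bounded_linear[OF bounded_linear_vec_nth])
    then show "(\<lambda>x. G x $ i - G' x $ i) absolutely_integrable_on K"
      by (simp add: set_integrable_def)
  next
    fix \<phi> assume \<phi>: "test_function \<Omega> \<phi>"
    have "(LINT x|lebesgue_on \<Omega>. G x $ i * \<phi> x) = (LINT x|lebesgue_on \<Omega>. G' x $ i * \<phi> x)"
    proof -
      have "(LINT x|lebesgue_on \<Omega>. u x * partial i \<phi> x) = - (LINT x|lebesgue_on \<Omega>. G x $ i * \<phi> x)"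
        "(LINT x|lebesgue_on \<Omega>. u x * partial i \<phi> x) = - (LINT x|lebesgue_on \<Omega>. G' x $ i * \<phi> x)"
        using G G' \<phi> unfolding has_weak_gradient_def by blast+
      then show ?thesis by simp
    qed
    then show "(LINT x|lebesgue_on \<Omega>. (G x $ i - G' x $ i) * \<phi> x) = 0"
      unfolding left_diff_distrib Bochner_Integration.integral_diff[OF int[OF G \<phi>] int[OF G' \<phi>]] by simp
  qed
  then have "AE x in lebesgue_on \<Omega>. \<forall>i. G x $ i - G' x $ i = 0"
    by (subst AE_all_countable) auto
  then show ?thesis by eventually_elim (simp add: vec_eq_iff)
qed

subsection \<open>Piecewise affine functions\<close>

text \<open>The classical gradient. On the mesh skeleton, where u need not be differentiable,
  \<open>frechet_derivative\<close> is unspecified, so only the values on \<open>mesh_int\<close>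
  carry meaning.\<close>

definition cgrad :: "(real ^ 'd \<Rightarrow> real) \<Rightarrow> real ^ 'd \<Rightarrow> real ^ 'd" where
  "cgrad u x = (\<chi> i. partial i u x)"

lemma cgrad_eqI:
  assumes "(u has_derivative (\<lambda>y. g \<bullet> y)) (at x)"
  shows "cgrad u x = g"
  unfolding cgrad_def by (simp add: partial_eq[OF assms] inner_axis vec_eq_iff)

locale mesh_domain =
  fixes \<Omega> :: "(real ^ 'd) set" and \<T> :: "(real ^ 'd) set set"
  assumes open_dom: "open \<Omega>" and bounded_dom: "bounded \<Omega>"
    and finite_mesh: "finite \<T>" and Union_mesh: "\<Union>\<T> = closure \<Omega>"
    and mesh_simplex: "T \<in> \<T> \<Longrightarrow> int CARD('d) simplex T"
begin

abbreviation PA :: "(real ^ 'd \<Rightarrow> 'b::real_normed_vector) set" where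
  "PA \<equiv> continuous_pw_affine \<T> (closure \<Omega>)"

definition mesh_int :: "(real ^ 'd) set" where "mesh_int = (\<Union>T\<in>\<T>. interior T)"

lemma dom_sets: "\<Omega> \<in> sets lebesgue" and dom_lmeasurable: "\<Omega> \<in> lmeasurable"
  using open_dom bounded_dom by (auto intro: lmeasurable_open)

sublocale finite_measure "lebesgue_on \<Omega>"
  by (rule finite_measure_lebesgue_on[OF dom_lmeasurable])

lemma compact_closure_dom: "compact (closure \<Omega>)"
  using bounded_dom by (simp add: compact_closure)

lemma mesh_subset: "T \<in> \<T> \<Longrightarrow> T \<subseteq> closure \<Omega>"
  using Union_mesh by blast

lemma mesh_convex_hull: assumes "T \<in> \<T>" obtains C where "finite C" "T = convex hull C"
  using mesh_simplex[OF assms] unfolding simplex by blast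

lemma mesh_convex: "T \<in> \<T> \<Longrightarrow> convex T" and mesh_compact: "T \<in> \<T> \<Longrightarrow> compact T"
  and mesh_closed: "T \<in> \<T> \<Longrightarrow> closed T"
  by (metis mesh_convex_hull convex_convex_hull, metis mesh_convex_hull finite_imp_compact_convex_hull,
      metis mesh_convex_hull finite_imp_compact_convex_hull compact_imp_closed)

lemma mesh_interior_nonempty: assumes "T \<in> \<T>" shows "interior T \<noteq> {}"
proof -
  have ad: "aff_dim T = int DIM(real ^ 'd)" using aff_dim_simplex[OF mesh_simplex[OF assms]] by simp
  then have "T \<noteq> {}" by (auto simp: aff_dim_empty)
  moreover have "rel_interior T = interior T"
    using ad by (intro rel_interior_interior) (simp only: aff_dim_eq_full)
  ultimately show ?thesis using rel_interior_eq_empty[OF mesh_convex[OF assms]] by simp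
qed

text \<open>The mesh is finite and its elements have nonempty interior, so one radius suits all of
  them. It determines the constant of the inverse estimate.\<close>

lemma mesh_inner_radius:
  obtains \<rho> where "\<rho> > 0" "\<And>T. T \<in> \<T> \<Longrightarrow> \<exists>z. cball z \<rho> \<subseteq> T"
proof -
  have "\<exists>r>0. \<exists>z. cball z r \<subseteq> T" if "T \<in> \<T>" for T
    using mesh_interior_nonempty[OF that] mem_interior_cball by (metis ex_in_conv)
  then obtain r where r: "\<And>T. T \<in> \<T> \<Longrightarrow> r T > 0 \<and> (\<exists>z. cball z (r T) \<subseteq> T)" by metis
  \<comment> \<open>The extra member 1 keeps the set nonempty, so that \<open>Min\<close> is
    meaningful.\<close>
  define \<rho> where "\<rho> = Min (insert 1 (r ` \<T>))"
  have "\<rho> > 0" unfolding \<rho>_def using r finite_mesh by (subst Min_gr_iff) auto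
  moreover have "\<exists>z. cball z \<rho> \<subseteq> T" if "T \<in> \<T>" for T
  proof -
    have "\<rho> \<le> r T" unfolding \<rho>_def using that finite_mesh by (intro Min_le) auto
    then show ?thesis using r[OF that] by (meson subset_cball order_trans)
  qed
  ultimately show ?thesis using that by blast
qed

lemma negligible_minus_mesh_int: "negligible (\<Omega> - mesh_int)"
proof -
  have "negligible (\<Union>T\<in>\<T>. frontier T)"
    using finite_mesh mesh_convex by (auto intro!: negligible_Union negligible_convex_frontier)
  moreover have "\<Omega> - mesh_int \<subseteq> (\<Union>T\<in>\<T>. frontier T)"
  proof
    fix x assume x: "x \<in> \<Omega> - mesh_int"
    then obtain T where "T \<in> \<T>" "x \<in> T" using Union_mesh closure_subset[of \<Omega>] by blast
    then show "x \<in> (\<Union>T\<in>\<T>. frontier T)"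
      using x closure_subset[of T] unfolding mesh_int_def frontier_def by blast
  qed
  ultimately show ?thesis by (rule negligible_subset)
qed

lemma AE_mesh_int: "AE x in lebesgue_on \<Omega>. x \<in> mesh_int"
proof -
  have "AE x in lebesgue. x \<notin> \<Omega> - mesh_int"
    using negligible_minus_mesh_int by (intro AE_not_in) (simp add: negligible_iff_null_sets)
  then show ?thesis using dom_sets by (subst AE_restrict_space_iff) (auto elim: eventually_mono)
qed

lemma AE_domI:
  assumes "\<And>x. x \<in> \<Omega> \<Longrightarrow> x \<in> mesh_int \<Longrightarrow> P x"
  shows "AE x in lebesgue_on \<Omega>. P x"
  using AE_mesh_int AE_space by eventually_elim (use assms in simp)

lemma PA_continuous: "u \<in> PA \<Longrightarrow> continuous_on (closure \<Omega>) u"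
  by (simp add: continuous_pw_affine_def)

lemma PA_affineE:
  assumes "u \<in> PA" "T \<in> \<T>"
  obtains l b where "linear l" "\<And>x. x \<in> T \<Longrightarrow> u x = l x + b"
  using assms mesh_subset[OF assms(2)] unfolding continuous_pw_affine_def by fastforce

lemma PA_gradE:
  fixes u :: "real ^ 'd \<Rightarrow> real"
  assumes "u \<in> PA" "T \<in> \<T>"
  obtains g b where "\<And>x. x \<in> T \<Longrightarrow> u x = g \<bullet> x + b"
    "\<And>x. x \<in> interior T \<Longrightarrow> (u has_derivative (\<lambda>y. g \<bullet> y)) (at x)"
    "\<And>x. x \<in> interior T \<Longrightarrow> cgrad u x = g"
proof -
  obtain l b where l: "linear l" "\<And>x. x \<in> T \<Longrightarrow> u x = l x + b" using PA_affineE[OF assms] by metis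
  \<comment> \<open>The Riesz representative of the linear functional l.\<close>
  define g where "g = adjoint l 1"
  have lg: "l x = g \<bullet> x" for x
    using adjoint_works[OF l(1), of x 1] by (simp add: g_def inner_commute)
  have d: "(u has_derivative (\<lambda>y. g \<bullet> y)) (at x)" if "x \<in> interior T" for x
  proof -
    have "((\<lambda>x. g \<bullet> x + b) has_derivative (\<lambda>y. g \<bullet> y)) (at x)" by (auto intro!: derivative_eq_intros)
    then show ?thesis
      by (rule has_derivative_transform_within_open[OF _ open_interior that])
        (use l(2) lg interior_subset in force)
  qed
  have "cgrad u x = g" if "x \<in> interior T" for x by (rule cgrad_eqI[OF d[OF that]])
  then show ?thesis using that[of g b] l(2) lg d by simp
qed

lemma PA_has_derivative:
  fixes u :: "real ^ 'd \<Rightarrow> real"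
  assumes "u \<in> PA" "x \<in> mesh_int"
  shows "(u has_derivative (\<lambda>y. cgrad u x \<bullet> y)) (at x)"
proof -
  obtain T where T: "T \<in> \<T>" "x \<in> interior T" using assms by (auto simp: mesh_int_def)
  show ?thesis by (rule PA_gradE[OF assms(1) T(1)]) (use T(2) in metis)
qed

lemma PA_lincomb:
  assumes "u \<in> PA" "w \<in> PA"
  shows "(\<lambda>x. a *\<^sub>R u x + c *\<^sub>R w x) \<in> PA"
  unfolding continuous_pw_affine_def
proof safe
  show "continuous_on (closure \<Omega>) (\<lambda>x. a *\<^sub>R u x + c *\<^sub>R w x)"
    using assms by (intro continuous_intros PA_continuous)
  fix T assume T: "T \<in> \<T>"
  obtain l b l' b' where l: "linear l" "linear l'" "\<And>x. x \<in> T \<Longrightarrow> u x = l x + b" "\<And>x. x \<in> T \<Longrightarrow> w x = l' x + b'"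
    using PA_affineE[OF assms(1) T] PA_affineE[OF assms(2) T] by metis
  show "\<exists>l b. linear l \<and> (\<forall>x\<in>closure \<Omega> \<inter> T. a *\<^sub>R u x + c *\<^sub>R w x = l x + b)"
    using l by (intro exI[of _ "\<lambda>x. a *\<^sub>R l x + c *\<^sub>R l' x"] exI[of _ "a *\<^sub>R b + c *\<^sub>R b'"])
      (auto intro!: linear_compose_add linear_compose_scale_right simp: algebra_simps)
qed

lemma PA_lincomb_real:
  fixes u w :: "real ^ 'd \<Rightarrow> real"
  shows "u \<in> PA \<Longrightarrow> w \<in> PA \<Longrightarrow> (\<lambda>x. a * u x + c * w x) \<in> PA"
  using PA_lincomb[of u w a c] by simp

lemma PA_diff: "u \<in> PA \<Longrightarrow> w \<in> PA \<Longrightarrow> (\<lambda>x. u x - w x) \<in> PA"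
  using PA_lincomb[of u w 1 "-1"] by simp

lemma PA_add: "u \<in> PA \<Longrightarrow> w \<in> PA \<Longrightarrow> (\<lambda>x. u x + w x) \<in> PA"
  using PA_lincomb[of u w 1 1] by simp

lemma PA_zero: "(\<lambda>_. 0) \<in> PA"
  by (auto simp: continuous_pw_affine_def intro!: exI[of _ "\<lambda>_. 0"] exI[of _ 0] linear_zero)

lemma PA_component:
  fixes u :: "real ^ 'd \<Rightarrow> real ^ 'm"
  assumes "u \<in> PA" shows "(\<lambda>x. u x $ i) \<in> PA"
  unfolding continuous_pw_affine_def
proof safe
  show "continuous_on (closure \<Omega>) (\<lambda>x. u x $ i)"
    using PA_continuous[OF assms] by (rule continuous_on_component)
  fix T assume T: "T \<in> \<T>"
  obtain l b where l: "linear l" "\<And>x. x \<in> T \<Longrightarrow> u x = l x + b" using PA_affineE[OF assms T] by metis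
  show "\<exists>l b. linear l \<and> (\<forall>x\<in>closure \<Omega> \<inter> T. u x $ i = l x + b)"
    using l by (intro exI[of _ "\<lambda>x. l x $ i"] exI[of _ "b $ i"])
      (auto simp: linear_iff)
qed

lemma cgrad_lincomb:
  fixes u w :: "real ^ 'd \<Rightarrow> real"
  assumes "u \<in> PA" "w \<in> PA" "x \<in> mesh_int"
  shows "cgrad (\<lambda>x. a * u x + c * w x) x = a *\<^sub>R cgrad u x + c *\<^sub>R cgrad w x"
  by (rule cgrad_eqI) (auto intro!: derivative_eq_intros PA_has_derivative assms simp: inner_simps)

text \<open>The points of \<Omega> whose value lies outside C form an open null set, which is empty;
  continuity carries the inclusion to the closure.\<close>

lemma AE_closed_imp_closure:
  fixes f :: "real ^ 'd \<Rightarrow> 'b::topological_space"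
  assumes f: "continuous_on (closure \<Omega>) f" and C: "closed C" and ae: "AE x in lebesgue_on \<Omega>. f x \<in> C"
    and x: "x \<in> closure \<Omega>"
  shows "f x \<in> C"
proof -
  define A where "A = \<Omega> \<inter> f -` (- C)"
  have "open A"
    unfolding A_def using C
    by (intro continuous_open_preimage[OF continuous_on_subset[OF f closure_subset] open_dom]) auto
  moreover have "AE x in lebesgue. x \<in> \<Omega> \<longrightarrow> f x \<in> C"
    using ae dom_sets by (subst (asm) AE_restrict_space_iff) auto
  then have "AE x in lebesgue. x \<notin> A" by eventually_elim (auto simp: A_def)
  then have "negligible A"
    by (simp add: AE_iff_null_sets negligible_iff_null_sets completion.AE_iff_null_sets)
  ultimately have "A = {}" using open_not_negligible by blast
  then have "f ` closure \<Omega> \<subseteq> C" by (intro image_closure_subset[OF f C]) (auto simp: A_def)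
  then show ?thesis using x by blast
qed

section \<open>Bounds, the inverse estimate and measurability\<close>

lemma PA_bounded:
  fixes u :: "real ^ 'd \<Rightarrow> 'b::real_normed_vector"
  assumes "u \<in> PA" obtains B where "B \<ge> 0" "\<And>x. x \<in> closure \<Omega> \<Longrightarrow> norm (u x) \<le> B"
proof -
  have "bounded (u ` closure \<Omega>)"
    using PA_continuous[OF assms] compact_closure_dom compact_continuous_image compact_imp_bounded by blast
  then obtain B where "B > 0" "\<And>x. x \<in> closure \<Omega> \<Longrightarrow> norm (u x) \<le> B" by (auto simp: bounded_pos)
  then show ?thesis using that[of B] by simp
qed

text \<open>Moving from the centre of an inscribed ball by \<rho> in the direction of the gradient g
  raises u by \<rho> |g|, while u can change by at most 2 e on the closure. For g = 0 the move is
  trivial since \<open>sgn 0 = 0\<close>.\<close>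

lemma inverse_estimate:
  obtains C where "C \<ge> 0"
    "\<And>(u :: real ^ 'd \<Rightarrow> real) e x. u \<in> PA \<Longrightarrow> (\<And>x. x \<in> closure \<Omega> \<Longrightarrow> \<bar>u x\<bar> \<le> e) \<Longrightarrow> x \<in> mesh_int \<Longrightarrow>
       norm (cgrad u x) \<le> C * e"
proof -
  obtain \<rho> where \<rho>: "\<rho> > 0" "\<And>T. T \<in> \<T> \<Longrightarrow> \<exists>z. cball z \<rho> \<subseteq> T" using mesh_inner_radius by metis
  show ?thesis
  proof (rule that[of "2 / \<rho>"])
    fix u :: "real ^ 'd \<Rightarrow> real" and e x
    assume u: "u \<in> PA" and e: "\<And>x. x \<in> closure \<Omega> \<Longrightarrow> \<bar>u x\<bar> \<le> e" and x: "x \<in> mesh_int"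
    obtain T where T: "T \<in> \<T>" "x \<in> interior T" using x by (auto simp: mesh_int_def)
    obtain g b where g: "\<And>x. x \<in> T \<Longrightarrow> u x = g \<bullet> x + b" "\<And>x. x \<in> interior T \<Longrightarrow> cgrad u x = g"
      using PA_gradE[OF u T(1)] by metis
    obtain z where z: "cball z \<rho> \<subseteq> T" using \<rho>(2)[OF T(1)] by blast
    define y where "y = z + \<rho> *\<^sub>R sgn g"
    have "norm (sgn g) \<le> 1" by (simp add: norm_sgn)
    then have yz: "y \<in> T" "z \<in> T" using z \<rho>(1) by (auto simp: y_def dist_norm subset_iff)
    have "g \<bullet> sgn g = norm g"
      by (cases "g = 0") (auto simp: sgn_div_norm dot_square_norm power2_eq_square)
    then have "u y - u z = \<rho> * norm g" using g(1) yz by (simp add: y_def inner_simps)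
    moreover have "\<bar>u y\<bar> \<le> e" "\<bar>u z\<bar> \<le> e" using e yz mesh_subset[OF T(1)] by auto
    ultimately have "\<rho> * norm g \<le> 2 * e" by linarith
    then show "norm (cgrad u x) \<le> 2 / \<rho> * e" using g(2)[OF T(2)] \<rho>(1) by (simp add: field_simps)
  qed (use \<rho> in simp)
qed

text \<open>A preimage is a union of open elements together with a part of the skeleton, which is
  null and therefore measurable whatever values f takes there.\<close>

lemma measurable_if_const_on_mesh:
  fixes f :: "real ^ 'd \<Rightarrow> 'b::topological_space"
  assumes "\<And>T x y. T \<in> \<T> \<Longrightarrow> x \<in> interior T \<Longrightarrow> y \<in> interior T \<Longrightarrow> f x = f y"
  shows "f \<in> borel_measurable (lebesgue_on \<Omega>)"
proof (rule measurableI)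
  fix A :: "'b set" assume "A \<in> sets borel"
  define I where "I = {T \<in> \<T>. \<exists>x \<in> interior T. f x \<in> A}"
  have "f -` A \<inter> space (lebesgue_on \<Omega>) =
      (\<Omega> \<inter> (\<Union>T\<in>I. interior T)) \<union> ((\<Omega> - mesh_int) \<inter> f -` A)"
  proof (intro set_eqI iffI)
    fix x assume "x \<in> f -` A \<inter> space (lebesgue_on \<Omega>)"
    then show "x \<in> (\<Omega> \<inter> (\<Union>T\<in>I. interior T)) \<union> ((\<Omega> - mesh_int) \<inter> f -` A)"
      by (auto simp: I_def mesh_int_def)
  next
    fix x assume x: "x \<in> (\<Omega> \<inter> (\<Union>T\<in>I. interior T)) \<union> ((\<Omega> - mesh_int) \<inter> f -` A)"
    show "x \<in> f -` A \<inter> space (lebesgue_on \<Omega>)"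
    proof (cases "x \<in> (\<Omega> - mesh_int) \<inter> f -` A")
      case False
      then obtain T where T: "T \<in> I" "x \<in> interior T" "x \<in> \<Omega>" using x by blast
      then obtain y where "T \<in> \<T>" "y \<in> interior T" "f y \<in> A" by (auto simp: I_def)
      then have "f x \<in> A" using assms[of T x y] T by simp
      then show ?thesis using T by simp
    qed simp
  qed
  moreover have "(\<Omega> - mesh_int) \<inter> f -` A \<in> sets lebesgue"
    by (intro negligible_imp_sets negligible_Int) (simp add: negligible_minus_mesh_int)
  moreover have "open (\<Omega> \<inter> (\<Union>T\<in>I. interior T))" using open_dom by auto
  then have "\<Omega> \<inter> (\<Union>T\<in>I. interior T) \<in> sets lebesgue" by simp
  ultimately show "f -` A \<inter> space (lebesgue_on \<Omega>) \<in> sets (lebesgue_on \<Omega>)"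
    using dom_sets by (auto simp: sets_restrict_space_iff)
qed auto

lemma cgrad_measurable: "u \<in> PA \<Longrightarrow> cgrad u \<in> borel_measurable (lebesgue_on \<Omega>)"
  by (rule measurable_if_const_on_mesh) (metis PA_gradE)

lemma PA_measurable: "u \<in> PA \<Longrightarrow> u \<in> borel_measurable (lebesgue_on \<Omega>)"
  by (rule continuous_imp_measurable_on_sets_lebesgue[OF continuous_on_subset[OF PA_continuous] dom_sets])
    (auto simp: closure_subset)

lemma cgrad_bounded:
  fixes u :: "real ^ 'd \<Rightarrow> real"
  assumes "u \<in> PA" obtains B where "B \<ge> 0" "\<And>x. x \<in> mesh_int \<Longrightarrow> norm (cgrad u x) \<le> B"
proof -
  obtain B where B: "B \<ge> 0" "\<And>x. x \<in> closure \<Omega> \<Longrightarrow> norm (u x) \<le> B" using PA_bounded[OF assms] by metis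
  obtain C where C: "C \<ge> 0" "\<And>(u :: real ^ 'd \<Rightarrow> real) e x. u \<in> PA \<Longrightarrow> (\<And>x. x \<in> closure \<Omega> \<Longrightarrow> \<bar>u x\<bar> \<le> e) \<Longrightarrow> x \<in> mesh_int \<Longrightarrow>
       norm (cgrad u x) \<le> C * e" using inverse_estimate by metis
  show ?thesis by (rule that[of "C * B"]) (use B C assms in auto)
qed

lemma integrable_bounded:
  fixes f :: "real ^ 'd \<Rightarrow> 'b::{banach, second_countable_topology}"
  assumes "f \<in> borel_measurable (lebesgue_on \<Omega>)" "\<And>x. x \<in> \<Omega> \<Longrightarrow> x \<in> mesh_int \<Longrightarrow> norm (f x) \<le> B"
  shows "integrable (lebesgue_on \<Omega>) f"
  by (rule integrable_const_bound[where B = B, OF AE_domI]) (use assms in auto)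

lemma absolutely_integrable_subset:
  fixes f :: "real ^ 'd \<Rightarrow> 'b::euclidean_space"
  assumes "integrable (lebesgue_on \<Omega>) f" "compact A" "A \<subseteq> \<Omega>"
  shows "f absolutely_integrable_on A"
proof -
  have "set_integrable lebesgue \<Omega> f"
    using assms(1) dom_sets by (simp add: integrable_restrict_space set_integrable_def)
  then show ?thesis
    by (rule set_integrable_subset)
      (use assms in \<open>auto intro: fmeasurableD lmeasurable_compact\<close>)
qed

end

subsection \<open>Weak gradients of piecewise affine functions\<close>

lemma has_real_derivative_along:
  fixes F :: "'a::real_normed_vector \<Rightarrow> real"
  assumes "(F has_derivative D) (at (x + t *\<^sub>R e))"
  shows "((\<lambda>t. F (x + t *\<^sub>R e)) has_real_derivative D e) (at t)"
proof -
  have "((\<lambda>t. F (x + t *\<^sub>R e)) has_derivative (\<lambda>h. D (h *\<^sub>R e))) (at t)"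
    by (rule has_derivative_compose[of "\<lambda>t. x + t *\<^sub>R e" "\<lambda>h. h *\<^sub>R e" t UNIV F D, OF _ assms])
      (auto intro!: derivative_eq_intros)
  moreover have "D (h *\<^sub>R e) = D e * h" for h
    using linear_cmul[OF has_derivative_linear[OF assms], of h e] by simp
  ultimately show ?thesis by (simp add: has_field_derivative_def mult_commute_abs)
qed

lemma lborel_integral_translate:
  fixes F :: "'a::euclidean_space \<Rightarrow> real"
  assumes "integrable lborel F"
  shows "integrable lborel (\<lambda>x. F (x + c))" "(LINT x|lborel. F (x + c)) = (LINT x|lborel. F x)"
proof -
  have F: "F \<in> borel_measurable borel" using assms by auto
  have "integrable (distr lborel borel ((+) c)) F" using assms by (simp add: lborel_distr_plus)
  then show "integrable lborel (\<lambda>x. F (x + c))"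
    by (subst (asm) integrable_distr_eq) (use F in \<open>auto simp: add.commute\<close>)
  have "(LINT x|distr lborel borel ((+) c). F x) = (LINT x|lborel. F (c + x))"
    by (rule integral_distr) (use F in auto)
  then show "(LINT x|lborel. F (x + c)) = (LINT x|lborel. F x)"
    by (simp add: lborel_distr_plus add.commute)
qed

lemma borel_measurable_component:
  fixes f :: "'a \<Rightarrow> real ^ 'm"
  shows "f \<in> borel_measurable M \<Longrightarrow> (\<lambda>x. f x $ i) \<in> borel_measurable M"
  by (rule measurable_compose[OF _ borel_measurable_continuous_onI]) (auto intro: continuous_intros)

lemma test_functionD:
  assumes "test_function \<Omega> \<phi>"
  shows "continuous_on UNIV \<phi>" "(\<phi> has_derivative frechet_derivative \<phi> (at x)) (at x)"
    "continuous_on UNIV (partial i \<phi>)"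
proof -
  have "Ck 0 \<phi>" "Ck (Suc 0) \<phi>" using assms unfolding test_function_def by blast+
  then show "continuous_on UNIV \<phi>" "(\<phi> has_derivative frechet_derivative \<phi> (at x)) (at x)"
    "continuous_on UNIV (partial i \<phi>)"
    by (auto simp: differentiable_on_def frechet_derivative_works[symmetric])
qed

context mesh_domain
begin

text \<open>Difference quotients of the zero extension of \<open>u \<phi>\<close> have integral zero by translation
  invariance, are bounded because \<open>u \<phi>\<close> is Lipschitz along short segments, and converge off the mesh
  skeleton.\<close>

lemma cgrad_integration_by_parts:
  fixes u :: "real ^ 'd \<Rightarrow> real"
  assumes u: "u \<in> PA" and \<phi>: "test_function \<Omega> \<phi>"
  shows "(LINT x|lebesgue_on \<Omega>. u x * partial i \<phi> x) = - (LINT x|lebesgue_on \<Omega>. cgrad u x $ i * \<phi> x)"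
proof -
  define e where "e = (axis i 1 :: real ^ 'd)"
  have e1: "norm e = 1" by (simp add: e_def norm_axis_1)
  define C where "C = closure {x. \<phi> x \<noteq> 0}"
  define F where "F x = (if x \<in> \<Omega> then u x * \<phi> x else 0)" for x
  have C: "compact C" "C \<subseteq> \<Omega>" "closed C" using \<phi> by (auto simp: test_function_def C_def)
  note c = test_functionD(1)[OF \<phi>] and cp = test_functionD(3)[OF \<phi>, of i]
  have z: "\<phi> x = 0" if "x \<notin> C" for x using that closure_subset[of "{x. \<phi> x \<noteq> 0}"] by (auto simp: C_def)
  have F0: "F x = 0" if "x \<notin> C" for x using z[OF that] by (simp add: F_def)
  have zp: "partial i \<phi> x = 0" if "x \<notin> C" for x
  proof -
    have "((\<lambda>_. 0) has_derivative (\<lambda>_. 0)) (at x)" by simp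
    then have "(\<phi> has_derivative (\<lambda>_. 0)) (at x)"
      by (rule has_derivative_transform_within_open[where s = "- C"]) (use z C that in auto)
    then show ?thesis by (simp add: partial_eq)
  qed
  have bd: "\<exists>B\<ge>0. \<forall>x. \<bar>f x\<bar> \<le> B" if "continuous_on UNIV f" "\<And>x. x \<notin> C \<Longrightarrow> f x = 0" for f :: "_ \<Rightarrow> real"
  proof -
    have "bounded (f ` C)"
      by (rule compact_imp_bounded[OF compact_continuous_image[OF continuous_on_subset[OF that(1)] C(1)]]) simp
    then obtain B where B: "B > 0" "\<And>x. x \<in> C \<Longrightarrow> \<bar>f x\<bar> \<le> B" by (auto simp: bounded_pos)
    then have "\<bar>f x\<bar> \<le> B" for x by (cases "x \<in> C") (use that in auto)
    then show ?thesis using B(1) by (intro exI[of _ B]) auto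
  qed
  obtain B1 where B1: "B1 \<ge> 0" "\<And>x. \<bar>\<phi> x\<bar> \<le> B1" using bd[OF c z] by metis
  obtain B2 where B2: "B2 \<ge> 0" "\<And>x. \<bar>partial i \<phi> x\<bar> \<le> B2" using bd[OF cp zp] by metis
  obtain Bu where Bu: "Bu \<ge> 0" "\<And>x. x \<in> closure \<Omega> \<Longrightarrow> \<bar>u x\<bar> \<le> Bu"
    using PA_bounded[OF u] by (metis real_norm_def)
  obtain Bg where Bg: "Bg \<ge> 0" "\<And>x. x \<in> mesh_int \<Longrightarrow> norm (cgrad u x) \<le> Bg" using cgrad_bounded[OF u] by metis
  \<comment> \<open>The product rule bound for the derivative of u \<phi> along the unit vector
    e.\<close>
  define L where "L = Bu * B2 + B1 * Bg"
  have L0: "L \<ge> 0" using B1 B2 Bu Bg by (simp add: L_def)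
  have \<phi>lip: "\<bar>\<phi> (x + a *\<^sub>R e) - \<phi> (x + b *\<^sub>R e)\<bar> \<le> B2 * \<bar>a - b\<bar>" for x a b
  proof -
    have d: "((\<lambda>t. \<phi> (x + t *\<^sub>R e)) has_real_derivative partial i \<phi> (x + t *\<^sub>R e)) (at t)" for t
      using has_real_derivative_along[OF test_functionD(2)[OF \<phi>]] by (simp add: partial_def e_def)
    have "norm (\<phi> (x + a *\<^sub>R e) - \<phi> (x + b *\<^sub>R e)) \<le> B2 * norm (a - b)"
      by (rule field_differentiable_bound[of UNIV "\<lambda>t. \<phi> (x + t *\<^sub>R e)" "\<lambda>t. partial i \<phi> (x + t *\<^sub>R e)"]) (use d B2 in auto)
    then show ?thesis by simp
  qed
  have lipT: "L-lipschitz_on {t. x + t *\<^sub>R e \<in> T} (\<lambda>t. u (x + t *\<^sub>R e) * \<phi> (x + t *\<^sub>R e))" if T: "T \<in> \<T>" for x T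
  proof (rule lipschitz_onI)
    fix s t assume s: "s \<in> {t. x + t *\<^sub>R e \<in> T}" and t: "t \<in> {t. x + t *\<^sub>R e \<in> T}"
    let ?a = "x + s *\<^sub>R e" and ?b = "x + t *\<^sub>R e"
    obtain g b where g: "\<And>x. x \<in> T \<Longrightarrow> u x = g \<bullet> x + b" "\<And>x. x \<in> interior T \<Longrightarrow> cgrad u x = g"
      using PA_gradE[OF u T] by metis
    obtain y where "y \<in> interior T" using mesh_interior_nonempty[OF T] by blast
    then have ng: "norm g \<le> Bg" using g(2) Bg(2)[of y] T by (auto simp: mesh_int_def)
    have "u ?a - u ?b = (s - t) * (g \<bullet> e)" using g(1) s t by (simp add: inner_simps algebra_simps)
    moreover have "\<bar>g \<bullet> e\<bar> \<le> Bg" using Cauchy_Schwarz_ineq2[of g e] e1 ng by simp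
    ultimately have du: "\<bar>u ?a - u ?b\<bar> \<le> Bg * \<bar>s - t\<bar>"
      by (simp add: abs_mult mult.commute[of Bg] mult_left_mono)
    have "u ?a * \<phi> ?a - u ?b * \<phi> ?b = u ?a * (\<phi> ?a - \<phi> ?b) + \<phi> ?b * (u ?a - u ?b)" by algebra
    then have "\<bar>u ?a * \<phi> ?a - u ?b * \<phi> ?b\<bar> \<le> \<bar>u ?a\<bar> * \<bar>\<phi> ?a - \<phi> ?b\<bar> + \<bar>\<phi> ?b\<bar> * \<bar>u ?a - u ?b\<bar>"
      by (metis abs_mult abs_triangle_ineq)
    also have "\<dots> \<le> Bu * (B2 * \<bar>s - t\<bar>) + B1 * (Bg * \<bar>s - t\<bar>)"
      using s t mesh_subset[OF T] B1 B2 Bu Bg \<phi>lip du by (intro add_mono mult_mono) auto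
    also have "\<dots> = L * \<bar>s - t\<bar>" by (simp add: L_def algebra_simps)
    finally show "dist (u ?a * \<phi> ?a) (u ?b * \<phi> ?b) \<le> L * dist s t" by (simp add: dist_real_def)
  qed (rule L0)
  \<comment> \<open>A margin between the support of \<phi> and the complement of \<Omega>: a segment
    shorter than d with an endpoint in C stays in \<Omega>, where \<open>F\<close> equals u
    \<phi>.\<close>
  obtain d where d: "d > 0" "\<And>x y. x \<in> C \<Longrightarrow> y \<notin> \<Omega> \<Longrightarrow> d \<le> dist x y"
  proof -
    have "closed (- \<Omega>)" "C \<inter> - \<Omega> = {}" using open_dom C(2) by auto
    from separate_compact_closed[OF C(1) this] show ?thesis using that by (meson ComplI)
  qed
  have lip: "\<bar>F (x + s *\<^sub>R e) - F x\<bar> \<le> L * s" if s: "0 \<le> s" "s < d" for x s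
  proof (cases "x \<in> C \<or> x + s *\<^sub>R e \<in> C")
    case True
    have seg: "x + t *\<^sub>R e \<in> \<Omega>" if t: "t \<in> {0..s}" for t
    proof -
      have "dist x (x + t *\<^sub>R e) < d" "dist (x + s *\<^sub>R e) (x + t *\<^sub>R e) < d"
        using t s e1 by (auto simp: dist_norm algebra_simps simp flip: scaleR_left_diff_distrib)
      then show ?thesis using True d(2) by (meson not_le)
    qed
    define U where "U T = {t. x + t *\<^sub>R e \<in> T}" for T
    \<comment> \<open>The elements cut the segment into finitely many closed pieces with the same
      constant L, and Lipschitz continuity glues across them without loss.\<close>
    have "L-lipschitz_on {0..s} (\<lambda>t. u (x + t *\<^sub>R e) * \<phi> (x + t *\<^sub>R e))"
    proof (rule lipschitz_on_closed_Union[where I = \<T> and U = U])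
      show "closed (U T)" if "T \<in> \<T>" for T
      proof -
        have "closed ((\<lambda>t. x + t *\<^sub>R e) -` T)"
          by (rule continuous_closed_vimage) (auto intro: mesh_closed that continuous_intros)
        then show ?thesis by (simp add: U_def vimage_def)
      qed
      show "{0..s} \<subseteq> (\<Union>T\<in>\<T>. U T)"
        using seg Union_mesh closure_subset[of \<Omega>] by (fastforce simp: U_def)
    qed (use lipT L0 finite_mesh in \<open>auto simp: U_def\<close>)
    then have "dist (u (x + s *\<^sub>R e) * \<phi> (x + s *\<^sub>R e)) (u (x + 0 *\<^sub>R e) * \<phi> (x + 0 *\<^sub>R e)) \<le> L * dist s 0"
      by (rule lipschitz_onD) (use s in auto)
    then show ?thesis using seg[of 0] seg[of s] s by (simp add: F_def dist_real_def)
  next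
    case False then show ?thesis using F0 L0 s by auto
  qed
  have cF: "continuous_on UNIV F"
  proof -
    have "continuous_on \<Omega> (\<lambda>x. u x * \<phi> x)"
      by (intro continuous_on_mult continuous_on_subset[OF PA_continuous[OF u] closure_subset]
          continuous_on_subset[OF c]) auto
    then have "continuous_on \<Omega> F" by (simp add: F_def cong: continuous_on_cong_simp)
    moreover have "continuous_on (- C) F"
      by (rule continuous_on_eq[of _ "\<lambda>_. 0"]) (use F0 in auto)
    ultimately have "continuous_on (\<Omega> \<union> - C) F"
      using open_dom C(3) by (intro continuous_on_open_Un) auto
    moreover have "\<Omega> \<union> - C = UNIV" using C(2) by blast
    ultimately show ?thesis by simp
  qed
  have iF: "integrable lborel F"
  proof -
    have "integrable lborel (\<lambda>x. indicator C x *\<^sub>R F x)"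
      by (rule borel_integrable_compact[OF C(1) continuous_on_subset[OF cF]]) simp
    moreover have "(\<lambda>x. indicator C x *\<^sub>R F x) = F" using F0 by (auto split: split_indicator)
    ultimately show ?thesis by simp
  qed
  \<comment> \<open>Starting the step sizes at 1 / (N + 1) makes all of them smaller than d.\<close>
  obtain N :: nat where N: "1 / real (Suc N) < d" using d(1) nat_approx_posE by metis
  define s where "s n = 1 / real (Suc (N + n))" for n
  have s: "0 < s n" "s n < d" "s n \<le> 1" for n
  proof -
    have "s n \<le> 1 / real (Suc N)" unfolding s_def by (intro divide_left_mono) auto
    then show "s n < d" using N by simp
  qed (auto simp: s_def)
  have s0: "s \<longlonglongrightarrow> 0"
    unfolding s_def using LIMSEQ_ignore_initial_segment[OF LIMSEQ_Suc[OF lim_1_over_n], of N] by (simp add: add.commute)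
  define q where "q n x = (F (x + s n *\<^sub>R e) - F x) / s n" for n x
  have iq: "integrable lborel (q n)" and q0: "(LINT x|lborel. q n x) = 0" for n
    unfolding q_def using lborel_integral_translate[OF iF, of "s n *\<^sub>R e"] iF by auto
  define H where "H x = u x * partial i \<phi> x + cgrad u x $ i * \<phi> x" for x
  obtain R where R: "\<And>x. x \<in> \<Omega> \<Longrightarrow> norm x \<le> R" using bounded_dom by (auto simp: bounded_iff)
  have m\<phi>: "\<phi> \<in> borel_measurable (lebesgue_on \<Omega>)" "partial i \<phi> \<in> borel_measurable (lebesgue_on \<Omega>)"
    using c cp dom_sets by (auto intro: continuous_imp_measurable_on_sets_lebesgue continuous_on_subset)
  have mg: "(\<lambda>x. cgrad u x $ i) \<in> borel_measurable (lebesgue_on \<Omega>)"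
    by (rule borel_measurable_component[OF cgrad_measurable[OF u]])
  have mH: "H \<in> borel_measurable (lebesgue_on \<Omega>)"
    unfolding H_def by (intro borel_measurable_add borel_measurable_times m\<phi> mg PA_measurable u)
  have lim: "(\<lambda>n. LINT x|lebesgue. q n x) \<longlonglongrightarrow> (LINT x|lebesgue. indicator \<Omega> x *\<^sub>R H x)"
  \<comment> \<open>Since \<open>s n\<close> is at most 1, outside the ball of radius R + 1 neither
    x nor its translate lies in \<Omega>, so the quotient is zero there.\<close>
  proof (rule integral_dominated_convergence[where w = "\<lambda>x. L * indicator (cball 0 (R + 1)) x"])
    show "(\<lambda>x. indicator \<Omega> x *\<^sub>R H x) \<in> borel_measurable lebesgue"
      using mH dom_sets by (subst (asm) borel_measurable_restrict_space_iff) auto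
    show "q n \<in> borel_measurable lebesgue" for n
      by (rule measurable_completion[OF borel_measurable_integrable[OF iq]])
    show "integrable lebesgue (\<lambda>x. L * indicator (cball 0 (R + 1)) x)"
      by (intro integrable_mult_right) (use lmeasurable_cball[of 0 "R + 1"] in \<open>auto simp: integrable_indicator_iff fmeasurable_def\<close>)
    show "AE x in lebesgue. norm (q n x) \<le> L * indicator (cball 0 (R + 1)) x" for n
    proof (rule AE_I2)
      fix x
      show "norm (q n x) \<le> L * indicator (cball 0 (R + 1)) x"
      proof (cases "x \<in> cball 0 (R + 1)")
        case True
        then show ?thesis using lip[of "s n" x] s[of n] by (simp add: q_def pos_divide_le_eq)
      next
        case False
        have "x \<notin> \<Omega>" using False R by fastforce
        moreover have "x + s n *\<^sub>R e \<notin> \<Omega>"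
        proof
          assume "x + s n *\<^sub>R e \<in> \<Omega>"
          then have "norm (x + s n *\<^sub>R e) \<le> R" by (rule R)
          then have "norm x \<le> R + norm (s n *\<^sub>R e)"
            using norm_triangle_ineq4[of "x + s n *\<^sub>R e" "s n *\<^sub>R e"] by simp
          then show False using False s[of n] e1 by simp
        qed
        ultimately show ?thesis using False by (simp add: q_def F_def)
      qed
    qed
    have "AE x in lebesgue. x \<notin> \<Omega> - mesh_int"
      using negligible_minus_mesh_int by (intro AE_not_in) (simp add: negligible_iff_null_sets)
    then show "AE x in lebesgue. (\<lambda>n. q n x) \<longlonglongrightarrow> indicator \<Omega> x *\<^sub>R H x"
    proof eventually_elim
      case (elim x)
      \<comment> \<open>Inside \<Omega> the point lies in an open element and the product rule
        applies; outside \<Omega> the function \<open>F\<close> vanishes on the open set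
        \<open>- C\<close> around x.\<close>
      have "\<exists>D. (F has_derivative D) (at x) \<and> D e = indicator \<Omega> x *\<^sub>R H x"
      proof (cases "x \<in> \<Omega>")
        case True
        then have x: "x \<in> mesh_int" using elim by blast
        have "((\<lambda>x. u x * \<phi> x) has_derivative
            (\<lambda>y. u x * frechet_derivative \<phi> (at x) y + (cgrad u x \<bullet> y) * \<phi> x)) (at x)"
          by (rule has_derivative_mult[OF PA_has_derivative[OF u x] test_functionD(2)[OF \<phi>]])
        then have "(F has_derivative
            (\<lambda>y. u x * frechet_derivative \<phi> (at x) y + (cgrad u x \<bullet> y) * \<phi> x)) (at x)"
          by (rule has_derivative_transform_within_open[OF _ open_dom True]) (simp add: F_def)
        then show ?thesis using True by (force simp: H_def partial_def e_def inner_axis)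
      next
        case False
        have "((\<lambda>_. 0) has_derivative (\<lambda>_. 0)) (at x)" by simp
        then have "(F has_derivative (\<lambda>_. 0)) (at x)"
          by (rule has_derivative_transform_within_open[where s = "- C"]) (use F0 C False in auto)
        then show ?thesis using False by force
      qed
      then obtain D where D: "(F has_derivative D) (at x)" "D e = indicator \<Omega> x *\<^sub>R H x" by blast
      have "((\<lambda>t. F (x + t *\<^sub>R e)) has_real_derivative D e) (at 0)"
        using has_real_derivative_along[of F D x 0 e] D(1) by simp
      then have "((\<lambda>h. (F (x + h *\<^sub>R e) - F x) / h) \<longlongrightarrow> D e) (at 0)"
        by (simp add: DERIV_def)
      moreover have "filterlim s (at 0) sequentially"
        using s0 s(1) by (intro filterlim_atI) (auto intro!: always_eventually simp: less_imp_neq[symmetric])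
      ultimately have "(\<lambda>n. (F (x + s n *\<^sub>R e) - F x) / s n) \<longlonglongrightarrow> D e"
        by (rule filterlim_compose)
      then show ?case by (simp add: q_def D(2))
    qed
  qed
  have "(LINT x|lebesgue. q n x) = 0" for n
    using q0 by (subst integral_completion) (use borel_measurable_integrable[OF iq] in auto)
  then have "(LINT x|lebesgue. indicator \<Omega> x *\<^sub>R H x) = 0"
    using lim by (simp add: LIMSEQ_const_iff)
  then have "(LINT x|lebesgue_on \<Omega>. H x) = 0"
    using dom_sets by (subst integral_restrict_space) auto
  moreover have i1: "integrable (lebesgue_on \<Omega>) (\<lambda>x. u x * partial i \<phi> x)"
    by (rule integrable_bounded[where B = "Bu * B2"])
      (use Bu B2 closure_subset[of \<Omega>] in \<open>auto intro!: borel_measurable_times[OF PA_measurable[OF u] m\<phi>(2)] mult_mono simp: abs_mult\<close>)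
  have i2: "integrable (lebesgue_on \<Omega>) (\<lambda>x. cgrad u x $ i * \<phi> x)"
    by (rule integrable_bounded[where B = "Bg * B1"])
      (use Bg B1 in \<open>auto intro!: borel_measurable_times m\<phi> mg mult_mono order_trans[OF component_le_norm_cart] simp: abs_mult\<close>)
  ultimately show ?thesis
    unfolding H_def Bochner_Integration.integral_add[OF i1 i2] by simp
qed

lemma PA_integrable:
  fixes u :: "real ^ 'd \<Rightarrow> real"
  assumes u: "u \<in> PA" shows "integrable (lebesgue_on \<Omega>) u"
proof -
  obtain B where "B \<ge> 0" "\<And>x. x \<in> closure \<Omega> \<Longrightarrow> norm (u x) \<le> B" using PA_bounded[OF u] by metis
  then show ?thesis
    using closure_subset[of \<Omega>] by (intro integrable_bounded[where B = B] PA_measurable u) auto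
qed

lemma cgrad_integrable:
  assumes u: "u \<in> PA" shows "integrable (lebesgue_on \<Omega>) (cgrad u)"
proof -
  obtain B where "B \<ge> 0" "\<And>x. x \<in> mesh_int \<Longrightarrow> norm (cgrad u x) \<le> B" using cgrad_bounded[OF u] by metis
  then show ?thesis by (intro integrable_bounded[where B = B] cgrad_measurable u) auto
qed

lemma cgrad_weak_gradient:
  assumes u: "u \<in> PA" shows "has_weak_gradient \<Omega> u (cgrad u)"
  unfolding has_weak_gradient_def
  by (intro conjI allI impI absolutely_integrable_subset PA_integrable cgrad_integrable
      cgrad_integration_by_parts u) auto

text \<open>Existence makes the choice in \<open>weak_grad\<close> meaningful and uniqueness ties it
  to the classical gradient. From here on all gradients can be computed element by element.\<close>

lemma weak_grad_eq_cgrad: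
  assumes u: "u \<in> PA" shows "AE x in lebesgue_on \<Omega>. weak_grad \<Omega> u x = cgrad u x"
proof -
  have "has_weak_gradient \<Omega> u (weak_grad \<Omega> u)"
    unfolding weak_grad_def by (rule someI[of "has_weak_gradient \<Omega> u"]) (rule cgrad_weak_gradient[OF u])
  then show ?thesis by (rule has_weak_gradient_unique[OF open_dom _ cgrad_weak_gradient[OF u]])
qed

lemma weak_grad_measurable:
  assumes u: "u \<in> PA" shows "weak_grad \<Omega> u \<in> borel_measurable (lebesgue_on \<Omega>)"
  by (rule lebesgue_on_borel_measurable_cong_AE[OF dom_sets cgrad_measurable[OF u]])
    (use weak_grad_eq_cgrad[OF u] in \<open>simp add: eq_commute\<close>)

lemma PA_H1:
  fixes u :: "real ^ 'd \<Rightarrow> real"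
  assumes u: "u \<in> PA" shows "u \<in> H1 \<Omega>"
proof -
  obtain B where B: "B \<ge> 0" "\<And>x. x \<in> closure \<Omega> \<Longrightarrow> norm (u x) \<le> B" using PA_bounded[OF u] by metis
  obtain B' where B': "B' \<ge> 0" "\<And>x. x \<in> mesh_int \<Longrightarrow> norm (cgrad u x) \<le> B'" using cgrad_bounded[OF u] by metis
  have "square_integrable (lebesgue_on \<Omega>) u"
    unfolding square_integrable_def
  proof
    show "integrable (lebesgue_on \<Omega>) (\<lambda>x. (norm (u x))\<^sup>2)"
      by (rule integrable_bounded[where B = "B\<^sup>2"])
        (use B closure_subset[of \<Omega>] PA_measurable[OF u] in \<open>auto simp flip: abs_le_square_iff\<close>)
  qed (rule PA_measurable[OF u])
  moreover have "square_integrable (lebesgue_on \<Omega>) (cgrad u)"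
    unfolding square_integrable_def
  proof
    show "integrable (lebesgue_on \<Omega>) (\<lambda>x. (norm (cgrad u x))\<^sup>2)"
      by (rule integrable_bounded[where B = "B'\<^sup>2"])
        (use B' cgrad_measurable[OF u] in \<open>auto intro: power_mono\<close>)
  qed (rule cgrad_measurable[OF u])
  ultimately show ?thesis unfolding H1_def using cgrad_weak_gradient[OF u] by blast
qed

lemma PA_H1_vec:
  fixes u :: "real ^ 'd \<Rightarrow> real ^ 'm"
  assumes "u \<in> PA" shows "u \<in> H1_vec \<Omega>"
  unfolding H1_vec_def using PA_H1[OF PA_component[OF assms]] by auto

subsection \<open>Compactness\<close>

text \<open>N consists of the vertices of all elements. The preimage of a ball under an affine map
  is convex, so if it contains the vertices of a simplex it contains the simplex.\<close>

lemma PA_bound_from_nodes: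
  obtains N where "finite N" "N \<subseteq> closure \<Omega>"
    "\<And>(u :: real ^ 'd \<Rightarrow> 'b::real_normed_vector) e x. u \<in> PA \<Longrightarrow> (\<And>x. x \<in> N \<Longrightarrow> norm (u x) \<le> e) \<Longrightarrow>
        x \<in> closure \<Omega> \<Longrightarrow> norm (u x) \<le> e"
proof -
  have "\<exists>C. finite C \<and> T = convex hull C" if "T \<in> \<T>" for T using mesh_convex_hull[OF that] by blast
  then obtain C where C: "\<And>T. T \<in> \<T> \<Longrightarrow> finite (C T) \<and> T = convex hull (C T)" by metis
  show ?thesis
  proof (rule that[of "\<Union>T\<in>\<T>. C T"])
    show "finite (\<Union>T\<in>\<T>. C T)" using C finite_mesh by auto
    show "(\<Union>T\<in>\<T>. C T) \<subseteq> closure \<Omega>"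
      using C mesh_subset hull_subset by (metis UN_least order_trans)
    fix u :: "real ^ 'd \<Rightarrow> 'b::real_normed_vector" and e x
    assume u: "u \<in> PA" and e: "\<And>x. x \<in> (\<Union>T\<in>\<T>. C T) \<Longrightarrow> norm (u x) \<le> e" and x: "x \<in> closure \<Omega>"
    obtain T where T: "T \<in> \<T>" "x \<in> T" using x Union_mesh by blast
    obtain l b where l: "linear l" "\<And>x. x \<in> T \<Longrightarrow> u x = l x + b" using PA_affineE[OF u T(1)] by metis
    let ?S = "{y. l y + b \<in> cball 0 e}"
    have "convex ((\<lambda>y. l y) -` ((\<lambda>y. - b + y) ` cball 0 e))"
      by (intro convex_linear_vimage[OF l(1)] convex_translation) auto
    moreover have "(\<lambda>y. l y) -` ((\<lambda>y. - b + y) ` cball 0 e) = ?S"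
      by (auto simp: image_iff algebra_simps)
    ultimately have "convex ?S" by simp
    moreover have "C T \<subseteq> ?S"
    proof
      fix y assume y: "y \<in> C T"
      then have "y \<in> T" using C[OF T(1)] hull_subset[of "C T" convex] by blast
      then show "y \<in> ?S" using e[of y] y T l(2)[of y] by auto
    qed
    ultimately have "convex hull (C T) \<subseteq> ?S" by (rule hull_minimal[rotated])
    then show "norm (u x) \<le> e" using T C[OF T(1)] l(2)[OF T(2)] by auto
  qed
qed

text \<open>On an element the linear part applied to y is a difference quotient of two values of
  \<open>U n\<close>. Hence the linear parts converge pointwise, and a pointwise limit of linear
  maps is linear.\<close>

lemma PA_closed:
  fixes U :: "nat \<Rightarrow> real ^ 'd \<Rightarrow> 'b::real_normed_vector"
  assumes U: "\<And>n. U n \<in> PA" and lim: "uniform_limit (closure \<Omega>) U u sequentially"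
  shows "u \<in> PA"
  unfolding continuous_pw_affine_def
proof safe
  show "continuous_on (closure \<Omega>) u"
    using lim by (rule uniform_limit_theorem[rotated]) (auto intro!: always_eventually PA_continuous U)
  fix T assume T: "T \<in> \<T>"
  have pw: "(\<lambda>n. U n x) \<longlonglongrightarrow> u x" if "x \<in> closure \<Omega>" for x
    using lim that by (rule tendsto_uniform_limitI)
  have "\<exists>l b. linear l \<and> (\<forall>x\<in>T. U n x = l x + b)" for n using PA_affineE[OF U T] by metis
  then obtain l b where l: "\<And>n. linear (l n)" "\<And>n x. x \<in> T \<Longrightarrow> U n x = l n x + b n" by metis
  obtain z r where z: "r > 0" "cball z r \<subseteq> T"
    using mesh_interior_nonempty[OF T] mem_interior_cball by (metis ex_in_conv)
  have zT: "z \<in> T" using z by auto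
  \<comment> \<open>Rescales an arbitrary y into the ball of radius r, so that both points of the
    difference quotient lie in T.\<close>
  define k where "k y = r / (norm y + 1)" for y :: "real ^ 'd"
  have k: "k y > 0" "z + k y *\<^sub>R y \<in> T" for y
  proof -
    have n: "norm y + 1 > 0" by (simp add: add_nonneg_pos)
    then show "k y > 0" using z by (simp add: k_def)
    then have "norm (k y *\<^sub>R y) \<le> r" using z n by (simp add: k_def field_simps)
    then show "z + k y *\<^sub>R y \<in> T" using z(2) by (auto simp: dist_norm)
  qed
  define m where "m y = (1 / k y) *\<^sub>R (u (z + k y *\<^sub>R y) - u z)" for y
  have lm: "(\<lambda>n. l n y) \<longlonglongrightarrow> m y" for y
  proof -
    have "l n y = (1 / k y) *\<^sub>R (U n (z + k y *\<^sub>R y) - U n z)" for n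
      using k[of y] zT l(2)[of _ n] by (simp add: linear_add[OF l(1)] linear_cmul[OF l(1)])
    then show ?thesis unfolding m_def
      using k zT mesh_subset[OF T] by (auto intro!: tendsto_intros pw)
  qed
  have "linear m"
  proof (rule linearI)
    fix x y c
    have "(\<lambda>n. l n (x + y)) \<longlonglongrightarrow> m x + m y" using tendsto_add[OF lm lm] by (simp add: linear_add[OF l(1)])
    then show "m (x + y) = m x + m y" using lm LIMSEQ_unique by blast
    have "(\<lambda>n. l n (c *\<^sub>R x)) \<longlonglongrightarrow> c *\<^sub>R m x" using tendsto_scaleR[OF tendsto_const lm] by (simp add: linear_cmul[OF l(1)])
    then show "m (c *\<^sub>R x) = c *\<^sub>R m x" using lm LIMSEQ_unique by blast
  qed
  moreover have "u x = m x + (u z - m z)" if x: "x \<in> T" for x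
  proof -
    have "(\<lambda>n. l n x + (U n z - l n z)) \<longlonglongrightarrow> m x + (u z - m z)"
      using zT mesh_subset[OF T] by (intro tendsto_intros lm pw) auto
    moreover have "l n x + (U n z - l n z) = U n x" for n using l(2) x zT by simp
    ultimately have "(\<lambda>n. U n x) \<longlonglongrightarrow> m x + (u z - m z)" by simp
    moreover have "(\<lambda>n. U n x) \<longlonglongrightarrow> u x" using x mesh_subset[OF T] by (intro pw) auto
    ultimately show ?thesis using LIMSEQ_unique by blast
  qed
  ultimately show "\<exists>l b. linear l \<and> (\<forall>x\<in>closure \<Omega> \<inter> T. u x = l x + b)" by blast
qed

end

lemma bounded_common_convergent_subseq:
  fixes f :: "nat \<Rightarrow> 'i \<Rightarrow> 'a::heine_borel"
  assumes "finite I" "\<And>i. i \<in> I \<Longrightarrow> bounded (range (\<lambda>n. f n i))"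
  shows "\<exists>r. strict_mono (r :: nat \<Rightarrow> nat) \<and> (\<forall>i\<in>I. convergent (\<lambda>n. f (r n) i))"
  using assms
proof (induction I rule: finite_induct)
  case empty
  then show ?case by (intro exI[of _ id]) (auto simp: strict_mono_def)
next
  case (insert j I)
  then obtain r where r: "strict_mono (r :: nat \<Rightarrow> nat)" "\<And>i. i \<in> I \<Longrightarrow> convergent (\<lambda>n. f (r n) i)" by auto
  have "bounded (range (\<lambda>n. f (r n) j))"
    by (rule bounded_subset[OF insert.prems[of j]]) auto
  then obtain l s where s: "strict_mono (s :: nat \<Rightarrow> nat)" "((\<lambda>n. f (r n) j) \<circ> s) \<longlonglongrightarrow> l"
    using bounded_imp_convergent_subsequence[of "\<lambda>n. f (r n) j"] by blast
  have "convergent (\<lambda>n. f ((r \<circ> s) n) i)" if "i \<in> insert j I" for i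
  proof (cases "i = j")
    case True then show ?thesis using s(2) by (auto simp: comp_def convergent_def)
  next
    case False
    then have "convergent ((\<lambda>n. f (r n) i) \<circ> s)"
      using that r(2) s(1) by (auto intro: convergent_subseq_convergent)
    then show ?thesis by (simp add: comp_def)
  qed
  then show ?case using strict_mono_o[OF r(1) s(1)] by blast
qed

context mesh_domain
begin

text \<open>Bolzano-Weierstrass at the finitely many nodes suffices: the nodal bound applied to
  differences turns convergence at the nodes into a uniform Cauchy property.\<close>

lemma PA_compact:
  fixes U :: "nat \<Rightarrow> real ^ 'd \<Rightarrow> 'b::euclidean_space"
  assumes U: "\<And>n. U n \<in> PA" and bd: "\<And>n x. x \<in> closure \<Omega> \<Longrightarrow> norm (U n x) \<le> B"
  obtains r u where "strict_mono (r :: nat \<Rightarrow> nat)" "u \<in> PA"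
    "uniform_limit (closure \<Omega>) (\<lambda>n. U (r n)) u sequentially"
proof -
  obtain N where N: "finite N" "N \<subseteq> closure \<Omega>"
    "\<And>(u :: real ^ 'd \<Rightarrow> 'b) e x. u \<in> PA \<Longrightarrow> (\<And>x. x \<in> N \<Longrightarrow> norm (u x) \<le> e) \<Longrightarrow>
        x \<in> closure \<Omega> \<Longrightarrow> norm (u x) \<le> e" using PA_bound_from_nodes by metis
  obtain r where r: "strict_mono (r :: nat \<Rightarrow> nat)" "\<And>x. x \<in> N \<Longrightarrow> convergent (\<lambda>n. U (r n) x)"
  proof -
    have "bounded (range (\<lambda>n. U n x))" if "x \<in> N" for x
      using bd that N(2) by (auto simp: bounded_iff)
    then show ?thesis using bounded_common_convergent_subseq[OF N(1), of U] that by blast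
  qed
  have "uniformly_Cauchy_on (closure \<Omega>) (\<lambda>n. U (r n))"
  proof (rule uniformly_Cauchy_onI')
    fix e :: real assume e: "e > 0"
    have "\<exists>M. \<forall>m\<ge>M. \<forall>n\<ge>M. dist (U (r m) x) (U (r n) x) < e / 2" if "x \<in> N" for x
      using convergent_Cauchy[OF r(2)[OF that]] e unfolding Cauchy_def by (meson half_gt_zero)
    then obtain M where M: "\<And>x m n. x \<in> N \<Longrightarrow> m \<ge> M x \<Longrightarrow> n \<ge> M x \<Longrightarrow> dist (U (r m) x) (U (r n) x) < e / 2" by metis
    \<comment> \<open>A sum of natural numbers dominates each summand; it stands in for a
      maximum.\<close>
    define M0 where "M0 = (\<Sum>x\<in>N. M x)"
    have M0: "M x \<le> M0" if "x \<in> N" for x unfolding M0_def by (rule member_le_sum) (use that N(1) in auto)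
    have "dist (U (r m) x) (U (r n) x) < e" if "x \<in> closure \<Omega>" "m \<ge> M0" "n > m" for x m n
    proof -
      have "norm (U (r m) x - U (r n) x) \<le> e / 2"
      proof (rule N(3)[of "\<lambda>x. U (r m) x - U (r n) x"])
        fix y assume "y \<in> N"
        then show "norm (U (r m) y - U (r n) y) \<le> e / 2"
          using M[of y m n] M0[of y] that by (simp add: dist_norm)
      qed (use that U PA_diff in auto)
      then show ?thesis using e by (simp add: dist_norm)
    qed
    then show "\<exists>M. \<forall>x\<in>closure \<Omega>. \<forall>m\<ge>M. \<forall>n>m. dist (U (r m) x) (U (r n) x) < e" by blast
  qed
  then obtain u where u: "uniform_limit (closure \<Omega>) (\<lambda>n. U (r n)) u sequentially"
    using Cauchy_uniformly_convergent by (auto simp: uniformly_convergent_on_def)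
  show ?thesis by (rule that[OF r(1) PA_closed[OF U u] u])
qed

lemma cgrad_uniform_limit:
  fixes U :: "nat \<Rightarrow> real ^ 'd \<Rightarrow> real"
  assumes U: "\<And>n. U n \<in> PA" and u: "u \<in> PA" and lim: "uniform_limit (closure \<Omega>) U u sequentially"
  shows "uniform_limit mesh_int (\<lambda>n. cgrad (U n)) (cgrad u) sequentially"
proof (rule uniform_limitI)
  fix e :: real assume e: "e > 0"
  obtain C where C: "C \<ge> 0" "\<And>(u :: real ^ 'd \<Rightarrow> real) e x. u \<in> PA \<Longrightarrow> (\<And>x. x \<in> closure \<Omega> \<Longrightarrow> \<bar>u x\<bar> \<le> e) \<Longrightarrow> x \<in> mesh_int \<Longrightarrow>
       norm (cgrad u x) \<le> C * e" using inverse_estimate by metis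
  \<comment> \<open>C may be zero; with C + 1 the quotient is defined and C * (e / (C + 1)) is still
    below e.\<close>
  have "e / (C + 1) > 0" using e C(1) by simp
  from uniform_limitD[OF lim this]
  show "\<forall>\<^sub>F n in sequentially. \<forall>x\<in>mesh_int. dist (cgrad (U n) x) (cgrad u x) < e"
  proof eventually_elim
    case (elim n)
    show ?case
    proof
      fix x assume x: "x \<in> mesh_int"
      have "norm (cgrad (\<lambda>x. U n x - u x) x) \<le> C * (e / (C + 1))"
        by (rule C(2)[OF PA_diff[OF U u] _ x]) (use elim in \<open>auto simp: dist_real_def intro: less_imp_le\<close>)
      also have "\<dots> < e" using e C(1) by (simp add: field_simps)
      finally show "dist (cgrad (U n) x) (cgrad u x) < e"
        using cgrad_lincomb[OF U u x, of 1 n "-1"] by (simp add: dist_norm)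
    qed
  qed
qed

end

subsection \<open>Null sets and finiteness of the surface measure\<close>

text \<open>The definition asks for a sequence of covering sets, so a finite cover is padded with
  empty sets. They contribute nothing because s > 0 excludes the value 0 ^ 0 = 1.\<close>

lemma hausdorff_pre_finite_cover:
  fixes J :: "'j set" and U :: "'j \<Rightarrow> 'a::metric_space set"
  assumes J: "finite J" and s: "s > 0"
    and A: "A \<subseteq> (\<Union>j\<in>J. U j)" and U: "\<And>j. j \<in> J \<Longrightarrow> bounded (U j) \<and> diameter (U j) \<le> r" and r: "r \<ge> 0"
  shows "hausdorff_pre s r A \<le> (\<Sum>j\<in>J. ennreal (unit_ball_vol (real s) * (diameter (U j) / 2) ^ s))"
proof -
  let ?z = "\<lambda>S. ennreal (unit_ball_vol (real s) * (diameter S / 2) ^ s)"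
  obtain f where f: "bij_betw f {0..<card J} J" using ex_bij_betw_nat_finite[OF J] by blast
  define V where "V i = (if i < card J then U (f i) else {})" for i
  have fJ: "f i \<in> J" if "i < card J" for i using f that by (auto simp: bij_betw_def)
  have "hausdorff_pre s r A \<le> (\<Sum>i. ?z (V i))"
  proof (rule hausdorff_pre_le)
    show "A \<subseteq> (\<Union>i. V i)"
    proof
      fix x assume "x \<in> A"
      then obtain j where "j \<in> J" "x \<in> U j" using A by blast
      moreover from \<open>j \<in> J\<close> obtain i where "i < card J" "f i = j"
        using bij_betw_imp_surj_on[OF f] by (metis atLeastLessThan_iff imageE)
      ultimately show "x \<in> (\<Union>i. V i)" by (auto simp: V_def intro!: exI[of _ i])
    qed
  qed (use U fJ r in \<open>auto simp: V_def\<close>)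
  also have "\<dots> = (\<Sum>i\<in>{0..<card J}. ?z (V i))"
    using s by (intro suminf_finite) (auto simp: V_def power_0_left)
  also have "\<dots> = (\<Sum>i\<in>{0..<card J}. ?z (U (f i)))" by (simp add: V_def)
  also have "\<dots> = (\<Sum>j\<in>J. ?z (U j))" by (rule sum.reindex_bij_betw[OF f])
  finally show ?thesis .
qed

text \<open>A bounded set on which the coordinates in \<open>I\<close> control all others is covered by the cells of a grid
  in these coordinates.\<close>

lemma hausdorff_pre_grid:
  fixes S :: "(real ^ 'd) set" and R m s :: nat
  assumes bd: "\<And>x i. x \<in> S \<Longrightarrow> \<bar>x $ i\<bar> \<le> real R"
    and ctrl: "\<And>x y k. x \<in> S \<Longrightarrow> y \<in> S \<Longrightarrow> \<bar>x $ k - y $ k\<bar> \<le> L * (\<Sum>i\<in>I. \<bar>x $ i - y $ i\<bar>)"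
    and L: "L \<ge> 0" and s: "s > 0" and m: "m > 0"
    and D: "D = real CARD('d) * (L * real (card I))"
  shows "hausdorff_pre s (D / real m) S
    \<le> ennreal (((2 * real R + 1) * real m) ^ card I * (unit_ball_vol (real s) * (D / real m / 2) ^ s))"
proof -
  \<comment> \<open>Grid cells are indexed by the integer parts of m x_i for i in I, which lie
    between - R m and R m.\<close>
  define J where "J = PiE I (\<lambda>_. {- int (R * m)..int (R * m)})"
  define U where "U j = {x \<in> S. \<forall>i\<in>I. \<lfloor>real m * x $ i\<rfloor> = j i}" for j
  have D0: "D \<ge> 0" using D L by simp
  have fJ: "finite J" unfolding J_def by (intro finite_PiE) auto
  have cJ: "real (card J) \<le> ((2 * real R + 1) * real m) ^ card I"
  proof -
    have "card J = (2 * R * m + 1) ^ card I" unfolding J_def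
    proof (subst card_PiE)
      have "card {- int (R * m)..int (R * m)} = 2 * R * m + 1"
        by (simp flip: of_nat_mult of_nat_add)
      then show "(\<Prod>i\<in>I. card {- int (R * m)..int (R * m)}) = (2 * R * m + 1) ^ card I" by simp
    qed simp
    also have "real \<dots> = (2 * real R * real m + 1) ^ card I" by (simp add: add.commute)
    \<comment> \<open>m is at least 1 and absorbs the summand 1, which makes the bound homogeneous
      in m.\<close>
    also have "\<dots> \<le> ((2 * real R + 1) * real m) ^ card I"
      using m by (intro power_mono) (auto simp: algebra_simps)
    finally show ?thesis .
  qed
  have cover: "S \<subseteq> (\<Union>j\<in>J. U j)"
  proof
    fix x assume x: "x \<in> S"
    define j where "j = (\<lambda>i\<in>I. \<lfloor>real m * x $ i\<rfloor>)"
    have "- (real R * real m) \<le> real m * x $ i" "real m * x $ i \<le> real R * real m" for i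
    proof -
      have "\<bar>real m * x $ i\<bar> \<le> real R * real m"
        using mult_left_mono[OF bd[OF x, of i], of "real m"] by (simp add: abs_mult mult.commute)
      then show "- (real R * real m) \<le> real m * x $ i" "real m * x $ i \<le> real R * real m" by linarith+
    qed
    then have "\<lfloor>real m * x $ i\<rfloor> \<in> {- int (R * m)..int (R * m)}" for i
      by (simp add: le_floor_iff floor_le_iff) (smt (verit) of_int_mult of_int_of_nat_eq)
    then have "j \<in> J" by (auto simp: j_def J_def PiE_iff)
    moreover have "x \<in> U j" using x by (simp add: U_def j_def)
    ultimately show "x \<in> (\<Union>j\<in>J. U j)" by blast
  qed
  \<comment> \<open>Equal integer parts bound the coordinates in I by 1/m. The control hypothesis
    spreads this to L card(I) / m for every coordinate, and summing over all coordinates gives D /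
    m.\<close>
  have close: "dist x y \<le> D / real m" if xy: "x \<in> U j" "y \<in> U j" for x y j
  proof -
    have c: "\<bar>x $ i - y $ i\<bar> \<le> 1 / real m" if "i \<in> I" for i
    proof -
      have "\<lfloor>real m * x $ i\<rfloor> = \<lfloor>real m * y $ i\<rfloor>" using xy that by (simp add: U_def)
      then have "\<bar>real m * x $ i - real m * y $ i\<bar> \<le> 1" by linarith
      then have "real m * \<bar>x $ i - y $ i\<bar> \<le> 1" by (simp add: abs_mult flip: right_diff_distrib)
      then show ?thesis using m by (simp add: field_simps)
    qed
    have "norm (x - y) \<le> (\<Sum>k\<in>UNIV. \<bar>(x - y) $ k\<bar>)" by (rule norm_le_l1_cart)
    also have "\<dots> \<le> (\<Sum>k\<in>(UNIV::'d set). L * (real (card I) * (1 / real m)))"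
    proof (rule sum_mono)
      fix k
      have "\<bar>(x - y) $ k\<bar> \<le> L * (\<Sum>i\<in>I. \<bar>x $ i - y $ i\<bar>)" using ctrl xy by (simp add: U_def)
      also have "\<dots> \<le> L * (real (card I) * (1 / real m))"
        using L c by (intro mult_left_mono sum_bounded_above) auto
      finally show "\<bar>(x - y) $ k\<bar> \<le> L * (real (card I) * (1 / real m))" .
    qed
    also have "\<dots> = D / real m" by (simp add: D)
    finally show ?thesis by (simp add: dist_norm)
  qed
  have diam: "diameter (U j) \<le> D / real m" for j
    by (rule diameter_le) (use close D0 in \<open>auto simp: dist_norm\<close>)
  have bdU: "bounded (U j)" for j
  proof (cases "U j = {}")
    case False
    then obtain x where "x \<in> U j" by blast
    then have "U j \<subseteq> cball x (D / real m)" using close by auto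
    then show ?thesis using bounded_cball bounded_subset by blast
  qed simp
  have "hausdorff_pre s (D / real m) S \<le> (\<Sum>j\<in>J. ennreal (unit_ball_vol (real s) * (diameter (U j) / 2) ^ s))"
    by (rule hausdorff_pre_finite_cover[OF fJ s cover]) (use diam bdU D0 in auto)
  also have "\<dots> \<le> (\<Sum>j\<in>J. ennreal (unit_ball_vol (real s) * (D / real m / 2) ^ s))"
    using diam bdU by (intro sum_mono ennreal_leI mult_left_mono power_mono divide_right_mono) (auto intro: diameter_ge_0)
  also have "\<dots> = ennreal (real (card J) * (unit_ball_vol (real s) * (D / real m / 2) ^ s))"
    using D0 by (simp add: ennreal_mult' ennreal_of_nat_eq_real_of_nat)
  also have "\<dots> \<le> ennreal (((2 * real R + 1) * real m) ^ card I * (unit_ball_vol (real s) * (D / real m / 2) ^ s))"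
    using cJ D0 by (intro ennreal_leI mult_right_mono) auto
  finally show ?thesis .
qed

lemma bounded_coord_bound:
  assumes "bounded (S :: (real ^ 'd) set)"
  obtains R :: nat where "\<And>x i. x \<in> S \<Longrightarrow> \<bar>x $ i\<bar> \<le> real R"
proof -
  obtain B where B: "\<And>x. x \<in> S \<Longrightarrow> norm x \<le> B" using assms by (auto simp: bounded_iff)
  obtain R :: nat where "B \<le> real R" using real_arch_simple by blast
  then show ?thesis using that[of R] B component_le_norm_cart by (meson order_trans)
qed

lemma ex_nat_div_le: assumes "r > 0" obtains m :: nat where "m > 0" "D / real m \<le> r"
proof -
  obtain m :: nat where m: "real m > \<bar>D\<bar> / r" using reals_Archimedean2 by blast
  have "m > 0" using m assms by (metis abs_ge_zero divide_nonneg_pos gr0I not_less of_nat_0)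
  moreover have "D / real m \<le> r" using m assms \<open>m > 0\<close> by (simp add: field_simps)
  ultimately show ?thesis using that by blast
qed

text \<open>With s controlling coordinates the number of cells grows like m^s, while each cell
  contributes a multiple of m^(-s): the bound does not depend on m.\<close>

lemma hausdorff_outer_finite:
  fixes S :: "(real ^ 'd) set"
  assumes bd: "bounded S" and L: "L \<ge> 0"
    and ctrl: "\<And>x y k. x \<in> S \<Longrightarrow> y \<in> S \<Longrightarrow> \<bar>x $ k - y $ k\<bar> \<le> L * (\<Sum>i\<in>I. \<bar>x $ i - y $ i\<bar>)"
    and s: "s > 0" "card I = s"
  shows "hausdorff_outer s S < \<infinity>"
proof -
  obtain R :: nat where R: "\<And>x i. x \<in> S \<Longrightarrow> \<bar>x $ i\<bar> \<le> real R" using bounded_coord_bound[OF bd] by metis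
  define D where "D = real CARD('d) * (L * real (card I))"
  define B where "B = (2 * real R + 1) ^ s * (unit_ball_vol (real s) * (D / 2) ^ s)"
  have "hausdorff_pre s r S \<le> ennreal B" if r: "r > 0" for r
  proof -
    obtain m :: nat where m: "m > 0" "D / real m \<le> r" using ex_nat_div_le[OF r] by metis
    have "hausdorff_pre s r S \<le> hausdorff_pre s (D / real m) S" by (rule hausdorff_pre_antimono[OF m(2)])
    also have "\<dots> \<le> ennreal (((2 * real R + 1) * real m) ^ card I * (unit_ball_vol (real s) * (D / real m / 2) ^ s))"
      by (rule hausdorff_pre_grid[OF R ctrl L s(1) m(1) D_def])
    also have "((2 * real R + 1) * real m) ^ card I * (unit_ball_vol (real s) * (D / real m / 2) ^ s) = B"
      using m(1) s by (simp add: B_def power_mult_distrib power_divide)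
    finally show ?thesis .
  qed
  then have "hausdorff_outer s S \<le> ennreal B"
    unfolding hausdorff_outer_def by (intro SUP_least) auto
  also have "\<dots> < \<infinity>" by simp
  finally show ?thesis .
qed

text \<open>With one controlling coordinate fewer than s, a factor 1/m survives in the cell count
  and makes the measure arbitrarily small.\<close>

lemma hausdorff_outer_null:
  fixes S :: "(real ^ 'd) set"
  assumes bd: "bounded S" and L: "L \<ge> 0"
    and ctrl: "\<And>x y k. x \<in> S \<Longrightarrow> y \<in> S \<Longrightarrow> \<bar>x $ k - y $ k\<bar> \<le> L * (\<Sum>i\<in>I. \<bar>x $ i - y $ i\<bar>)"
    and s: "s = Suc (card I)"
  shows "hausdorff_outer s S = 0"
proof -
  obtain R :: nat where R: "\<And>x i. x \<in> S \<Longrightarrow> \<bar>x $ i\<bar> \<le> real R" using bounded_coord_bound[OF bd] by metis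
  define D where "D = real CARD('d) * (L * real (card I))"
  define B where "B = (2 * real R + 1) ^ card I * (unit_ball_vol (real s) * (D / 2) ^ s)"
  have B0: "B \<ge> 0" using L by (simp add: B_def D_def)
  have "hausdorff_pre s r S \<le> ennreal e" if r: "r > 0" and e: "e > 0" for r e
  proof -
    have "min r e > 0" using r e by simp
    \<comment> \<open>A single m serves both as the admissible cell size (D / m at most r) and as
      the smallness requirement (B / m at most e).\<close>
    then obtain m :: nat where m: "m > 0" "max D B / real m \<le> min r e" using ex_nat_div_le by metis
    have Dm: "D / real m \<le> r" and Bm: "B / real m \<le> e"
      using m by (auto intro: order_trans[OF divide_right_mono[of _ "max D B"]])
    have "hausdorff_pre s r S \<le> hausdorff_pre s (D / real m) S" by (rule hausdorff_pre_antimono[OF Dm])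
    also have "\<dots> \<le> ennreal (((2 * real R + 1) * real m) ^ card I * (unit_ball_vol (real s) * (D / real m / 2) ^ s))"
      by (rule hausdorff_pre_grid[OF R ctrl L _ m(1) D_def]) (simp_all add: s)
    also have "((2 * real R + 1) * real m) ^ card I * (unit_ball_vol (real s) * (D / real m / 2) ^ s) = B / real m"
      using m(1) s by (simp add: B_def power_mult_distrib power_divide)
    also have "ennreal (B / real m) \<le> ennreal e" using Bm by (rule ennreal_leI)
    finally show ?thesis .
  qed
  note small = this
  have "hausdorff_pre s r S \<le> 0" if "r > 0" for r
  proof (rule ennreal_le_epsilon)
    fix e :: real assume "0 < e"
    then show "hausdorff_pre s r S \<le> 0 + ennreal e" using small[OF that] by simp
  qed
  then have "hausdorff_outer s S \<le> 0"
    unfolding hausdorff_outer_def by (intro SUP_least) auto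
  then show ?thesis by simp
qed

text \<open>Where a_k is nonzero the equation of the hyperplane expresses coordinate k through the
  other d - 1, which therefore control the whole set.\<close>

lemma hausdorff_outer_hyperplane_finite:
  fixes S :: "(real ^ 'd) set"
  assumes card: "CARD('d) \<ge> 2" and bd: "bounded S" and a: "a \<noteq> 0" and S: "S \<subseteq> {x. a \<bullet> x = b}"
  shows "hausdorff_outer (CARD('d) - 1) S < \<infinity>"
proof -
  obtain k where k: "a $ k \<noteq> 0" using a by (auto simp: vec_eq_iff)
  define I where "I = UNIV - {k}"
  define L where "L = 1 + (\<Sum>i\<in>UNIV. \<bar>a $ i\<bar>) / \<bar>a $ k\<bar>"
  have L1: "L \<ge> 1" unfolding L_def by (simp add: sum_nonneg)
  have ctrl: "\<bar>x $ j - y $ j\<bar> \<le> L * (\<Sum>i\<in>I. \<bar>x $ i - y $ i\<bar>)" if "x \<in> S" "y \<in> S" for x y j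
  proof (cases "j = k")
    case True
    have "a \<bullet> (x - y) = 0" using that S by (auto simp: inner_diff_right)
    then have "(\<Sum>i\<in>UNIV. a $ i * (x - y) $ i) = 0" by (simp add: inner_vec_def)
    then have "a $ k * (x - y) $ k + (\<Sum>i\<in>I. a $ i * (x - y) $ i) = 0"
      unfolding I_def by (subst (asm) sum.remove[of _ k]) auto
    then have "\<bar>a $ k * (x - y) $ k\<bar> = \<bar>\<Sum>i\<in>I. a $ i * (x - y) $ i\<bar>" by linarith
    also have "\<dots> \<le> (\<Sum>i\<in>I. \<bar>a $ i\<bar> * \<bar>(x - y) $ i\<bar>)"
      by (rule order_trans[OF sum_abs]) (simp add: abs_mult)
    also have "\<dots> \<le> (\<Sum>i\<in>I. (\<Sum>i\<in>UNIV. \<bar>a $ i\<bar>) * \<bar>(x - y) $ i\<bar>)"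
      by (intro sum_mono mult_right_mono member_le_sum) auto
    also have "\<dots> = (\<Sum>i\<in>UNIV. \<bar>a $ i\<bar>) * (\<Sum>i\<in>I. \<bar>x $ i - y $ i\<bar>)" by (simp add: sum_distrib_left)
    finally have "\<bar>x $ k - y $ k\<bar> \<le> (\<Sum>i\<in>UNIV. \<bar>a $ i\<bar>) / \<bar>a $ k\<bar> * (\<Sum>i\<in>I. \<bar>x $ i - y $ i\<bar>)"
      using k by (simp add: abs_mult pos_le_divide_eq mult.commute)
    also have "\<dots> \<le> L * (\<Sum>i\<in>I. \<bar>x $ i - y $ i\<bar>)" unfolding L_def by (intro mult_right_mono) (auto intro: sum_nonneg)
    finally show ?thesis using True by simp
  next
    case False
    then have "\<bar>x $ j - y $ j\<bar> \<le> (\<Sum>i\<in>I. \<bar>x $ i - y $ i\<bar>)" by (intro member_le_sum) (auto simp: I_def)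
    also have "\<dots> \<le> L * (\<Sum>i\<in>I. \<bar>x $ i - y $ i\<bar>)"
      using mult_right_mono[OF L1, of "\<Sum>i\<in>I. \<bar>x $ i - y $ i\<bar>"] by (simp add: sum_nonneg)
    finally show ?thesis .
  qed
  show ?thesis
    by (rule hausdorff_outer_finite[OF bd _ ctrl]) (use L1 card in \<open>auto simp: I_def card_Diff_subset\<close>)
qed

subsection \<open>Infinitesimal rigid motions\<close>

text \<open>Polarisation: expand the identity at x + y.\<close>

lemma inner_skew_swap:
  assumes "linear A" "\<And>y. A y \<bullet> y = 0"
  shows "A x \<bullet> y = - (A y \<bullet> x)"
proof -
  have "A (x + y) \<bullet> (x + y) = 0" by (rule assms)
  then show ?thesis by (simp add: linear_add[OF assms(1)] inner_simps assms(2))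
qed

text \<open>If \<open>A p q \<noteq> 0\<close> for the skew matrix \<open>A\<close>, the kernel equations \<open>p\<close> and \<open>q\<close> express the coordinates
  \<open>q\<close> and \<open>p\<close> through the remaining ones, so the zero set is at most \<open>(d - 2)\<close>-dimensional.\<close>

lemma skew_affine_zero_set_null:
  fixes A :: "real ^ 'd \<Rightarrow> real ^ 'd"
  assumes card: "CARD('d) \<ge> 2" and lin: "linear A" and skew: "\<And>y. A y \<bullet> y = 0"
    and ne: "\<not> ((\<forall>x. A x = 0) \<and> b = 0)" and bd: "bounded S" and S: "\<And>x. x \<in> S \<Longrightarrow> A x + b = 0"
  shows "hausdorff_outer (CARD('d) - 1) S = 0"
proof (cases "\<forall>x. A x = 0")
  case True
  then have "S = {}" using ne S by auto
  then show ?thesis using card by (simp add: hausdorff_outer_empty)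
next
  case False
  define M where "M p q = A (axis q 1) $ p" for p q
  have Msw: "M p q = - M q p" for p q
    using inner_skew_swap[OF lin skew, of "axis q 1" "axis p 1"] by (simp add: M_def inner_axis)
  have Ax: "A x $ p = (\<Sum>j\<in>UNIV. M p j * x $ j)" for x p
  proof -
    have "A x = A (\<Sum>j\<in>UNIV. x $ j *s axis j 1)" by (simp add: basis_expansion)
    also have "\<dots> = (\<Sum>j\<in>UNIV. x $ j *\<^sub>R A (axis j 1))"
      by (simp add: linear_sum[OF lin] linear_cmul[OF lin] scalar_mult_eq_scaleR)
    finally show ?thesis by (simp add: M_def mult.commute)
  qed
  obtain p q where pq: "M p q \<noteq> 0"
  proof -
    obtain x where "A x \<noteq> 0" using False by blast
    then obtain p where "A x $ p \<noteq> 0" by (auto simp: vec_eq_iff)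
    then have "\<exists>q. M p q * x $ q \<noteq> 0" unfolding Ax by (meson sum.not_neutral_contains_not_neutral)
    then show ?thesis using that by auto
  qed
  have Mpp: "M p p = 0" for p using Msw[of p p] by simp
  have npq: "p \<noteq> q" using pq Mpp by auto
  define I where "I = UNIV - {p, q}"
  define C where "C = (\<Sum>i\<in>UNIV. \<Sum>j\<in>UNIV. \<bar>M i j\<bar>)"
  define L where "L = 1 + C / \<bar>M p q\<bar>"
  have C0: "C \<ge> 0" unfolding C_def by (intro sum_nonneg) auto
  have L1: "L \<ge> 1" unfolding L_def using C0 by simp
  have MC: "\<bar>M i j\<bar> \<le> C" for i j
  proof -
    have "\<bar>M i j\<bar> \<le> (\<Sum>j\<in>UNIV. \<bar>M i j\<bar>)" by (rule member_le_sum) auto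
    also have "\<dots> \<le> C" unfolding C_def
      by (rule member_le_sum[of i UNIV "\<lambda>i. \<Sum>j\<in>UNIV. \<bar>M i j\<bar>"]) (auto intro: sum_nonneg)
    finally show ?thesis .
  qed
  \<comment> \<open>Row a of A d = 0 has zero diagonal entry, so it determines the coordinate b from
    those in I. It is used for (p, q) and for (q, p).\<close>
  have row: "\<bar>d $ b\<bar> \<le> C / \<bar>M a b\<bar> * (\<Sum>i\<in>I. \<bar>d $ i\<bar>)"
    if d: "A d = 0" and ab: "M a b \<noteq> 0" "{a, b} = {p, q}" for d a b
  proof -
    have nab: "a \<noteq> b" using ab Mpp by auto
    have UI: "(UNIV :: 'd set) = insert a (insert b I)" using ab(2) by (auto simp: I_def)
    have "(\<Sum>j\<in>UNIV. M a j * d $ j) = 0" using Ax[of d a] d by simp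
    then have "(\<Sum>j\<in>insert a (insert b I). M a j * d $ j) = 0" using UI by simp
    moreover have "a \<notin> insert b I" "b \<notin> I" "finite I" using ab(2) nab by (auto simp: I_def)
    ultimately have "M a b * d $ b + (\<Sum>j\<in>I. M a j * d $ j) = 0" by (simp add: Mpp)
    then have "\<bar>M a b * d $ b\<bar> = \<bar>\<Sum>j\<in>I. M a j * d $ j\<bar>" by linarith
    also have "\<dots> \<le> (\<Sum>j\<in>I. \<bar>M a j\<bar> * \<bar>d $ j\<bar>)"
      by (rule order_trans[OF sum_abs]) (simp add: abs_mult)
    also have "\<dots> \<le> (\<Sum>j\<in>I. C * \<bar>d $ j\<bar>)" by (intro sum_mono mult_right_mono MC) auto
    also have "\<dots> = C * (\<Sum>j\<in>I. \<bar>d $ j\<bar>)" by (simp add: sum_distrib_left)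
    finally show ?thesis using ab by (simp add: abs_mult pos_le_divide_eq mult.commute)
  qed
  have ctrl: "\<bar>x $ j - y $ j\<bar> \<le> L * (\<Sum>i\<in>I. \<bar>x $ i - y $ i\<bar>)" if "x \<in> S" "y \<in> S" for x y j
  proof (cases "j \<in> I")
    case False
    have "A x = - b" "A y = - b" using S that by (auto simp: eq_neg_iff_add_eq_0)
    then have "A (x - y) = 0" by (simp add: linear_diff[OF lin])
    moreover have "\<exists>a. M a j \<noteq> 0 \<and> {a, j} = {p, q} \<and> \<bar>M a j\<bar> = \<bar>M p q\<bar>"
    proof (cases "j = q")
      case True then show ?thesis using pq by blast
    next
      case False
      then have "j = p" using \<open>j \<notin> I\<close> by (simp add: I_def)
      then show ?thesis using pq Msw[of p q] by (intro exI[of _ q]) auto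
    qed
    ultimately have "\<bar>(x - y) $ j\<bar> \<le> C / \<bar>M p q\<bar> * (\<Sum>i\<in>I. \<bar>(x - y) $ i\<bar>)" using row by metis
    also have "\<dots> \<le> L * (\<Sum>i\<in>I. \<bar>(x - y) $ i\<bar>)" unfolding L_def by (intro mult_right_mono sum_nonneg) auto
    finally show ?thesis by simp
  next
    case True
    then have "\<bar>x $ j - y $ j\<bar> \<le> (\<Sum>i\<in>I. \<bar>x $ i - y $ i\<bar>)" by (intro member_le_sum) (auto simp: I_def)
    also have "\<dots> \<le> L * (\<Sum>i\<in>I. \<bar>x $ i - y $ i\<bar>)"
      using mult_right_mono[OF L1, of "\<Sum>i\<in>I. \<bar>x $ i - y $ i\<bar>"] by (simp add: sum_nonneg)
    finally show ?thesis .
  qed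
  have "card I = CARD('d) - 2" using npq by (simp add: I_def card_Diff_subset)
  then show ?thesis
    by (intro hausdorff_outer_null[OF bd _ ctrl]) (use L1 card in auto)
qed

lemma norm_rescale_less:
  fixes x :: "'a::real_normed_vector"
  assumes "r > 0" shows "norm ((r / (2 * (norm x + 1))) *\<^sub>R x) < r"
proof -
  have n: "norm x + 1 > 0" by (simp add: add_nonneg_pos)
  then have "norm ((r / (2 * (norm x + 1))) *\<^sub>R x) = r * (norm x / (2 * (norm x + 1)))"
    using assms by simp
  also have "\<dots> < r * 1"
    using n assms by (intro mult_strict_left_mono) (auto simp: divide_simps)
  finally show ?thesis by simp
qed

text \<open>Test with a small positive multiple of a - b.\<close>

lemma eq_if_inner_eq_on_ball:
  fixes a b :: "'a::real_inner"
  assumes r: "r > 0" and eq: "\<And>w. norm w < r \<Longrightarrow> a \<bullet> w = b \<bullet> w"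
  shows "a = b"
proof -
  define t where "t = r / (2 * (norm (a - b) + 1))"
  have n: "norm (a - b) + 1 > 0" by (simp add: add_nonneg_pos)
  then have t: "t > 0" using r by (simp add: t_def)
  have "norm (t *\<^sub>R (a - b)) < r" unfolding t_def by (rule norm_rescale_less[OF r])
  from eq[OF this] have "t * ((a - b) \<bullet> (a - b)) = 0" by (simp add: inner_simps algebra_simps)
  then show ?thesis using t by simp
qed

text \<open>The identity \<open>A x \<bullet> w = - v w \<bullet> x\<close> for small \<open>w\<close>, whose right-hand side is linear in \<open>x\<close>, shows
  that the homogeneous extension \<open>A\<close> of \<open>v x = u (p + x) - u p\<close> is linear.\<close>

lemma affine_on_ball_if_difference_orthogonal:
  fixes u :: "'a::real_inner \<Rightarrow> 'a"
  assumes r: "r > 0" and orth: "\<And>x y. x \<in> ball p r \<Longrightarrow> y \<in> ball p r \<Longrightarrow> (u x - u y) \<bullet> (x - y) = 0"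
  obtains A b where "linear A" "\<And>y. A y \<bullet> y = 0" "\<And>x. x \<in> ball p r \<Longrightarrow> u x = A x + b"
proof -
  define v where "v x = u (p + x) - u p" for x
  have inb: "p + x \<in> ball p r" if "norm x < r" for x using that by (simp add: dist_norm)
  have vv: "v x \<bullet> x = 0" if "norm x < r" for x
    using orth[OF inb[OF that], of p] r by (simp add: v_def)
  have vsw: "v x \<bullet> y = - (v y \<bullet> x)" if "norm x < r" "norm y < r" for x y
  proof -
    have "(v x - v y) \<bullet> (x - y) = 0"
      using orth[OF inb[OF that(1)] inb[OF that(2)]] by (simp add: v_def)
    then show ?thesis using vv[OF that(1)] vv[OF that(2)] by (simp add: inner_simps inner_commute)
  qed
  define k where "k x = r / (2 * (norm x + 1))" for x :: 'a
  have k: "k x > 0" "norm (k x *\<^sub>R x) < r" for x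
  proof -
    have n: "norm x + 1 > 0" by (simp add: add_nonneg_pos)
    then show "k x > 0" using r by (simp add: k_def)
    show "norm (k x *\<^sub>R x) < r" unfolding k_def by (rule norm_rescale_less[OF r])
  qed
  define A where "A x = (1 / k x) *\<^sub>R v (k x *\<^sub>R x)" for x
  have Aw: "A x \<bullet> w = - (v w \<bullet> x)" if "norm w < r" for x w
    using vsw[OF k(2)[of x] that] k(1)[of x] by (simp add: A_def)
  have Aeq: "A x = v x" if "norm x < r" for x
    by (rule eq_if_inner_eq_on_ball[OF r]) (simp add: Aw vsw[OF that])
  have lin: "linear A"
    by (rule linearI; rule eq_if_inner_eq_on_ball[OF r]) (simp_all add: Aw inner_simps)
  have Az: "A y \<bullet> y = 0" for y
    using vv[OF k(2)[of y]] k(1)[of y] by (simp add: A_def)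
  show ?thesis
  proof (rule that[OF lin Az])
    fix x assume "x \<in> ball p r"
    then have "A (x - p) = v (x - p)" by (intro Aeq) (simp add: dist_norm norm_minus_commute)
    then show "u x = A x + (u p - A p)" by (simp add: v_def linear_diff[OF lin] algebra_simps)
  qed
qed

lemma linear_eq_on_ball:
  fixes A A' :: "'a::real_normed_vector \<Rightarrow> 'b::real_normed_vector"
  assumes "linear A" "linear A'" "r > 0" "\<And>x. x \<in> ball p r \<Longrightarrow> A x + b = A' x + b'"
  shows "A = A'" "b = b'"
proof -
  show "A = A'"
  proof
    fix x :: 'a
    define k where "k = r / (2 * (norm x + 1))"
    have n: "norm x + 1 > 0" by (simp add: add_nonneg_pos)
    have k: "k > 0" using n assms(3) by (simp add: k_def)
    have "norm (k *\<^sub>R x) < r" unfolding k_def by (rule norm_rescale_less[OF assms(3)])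
    then have "A (p + k *\<^sub>R x) + b = A' (p + k *\<^sub>R x) + b'" "A p + b = A' p + b'"
      using assms(3) by (auto intro!: assms(4) simp: dist_norm)
    then have "(A p + b) + k *\<^sub>R A x = (A' p + b') + k *\<^sub>R A' x" "A p + b = A' p + b'"
      unfolding linear_add[OF assms(1)] linear_add[OF assms(2)]
        linear_cmul[OF assms(1)] linear_cmul[OF assms(2)] by (metis add.assoc add.commute)+
    then have "k *\<^sub>R A x = k *\<^sub>R A' x" by (metis add_left_cancel)
    then show "A x = A' x" using k by simp
  qed
  then show "b = b'" using assms(3) assms(4)[of p] by simp
qed

text \<open>On each ball u is affine with skew linear part. The pair of linear part and offset is
  determined by any small ball, hence locally constant, hence constant on the connected set.\<close>

lemma rigid_if_locally_orthogonal:
  fixes u :: "'a::real_inner \<Rightarrow> 'a"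
  assumes op: "open \<Omega>" and conn: "connected \<Omega>"
    and orth: "\<And>p r x y. ball p r \<subseteq> \<Omega> \<Longrightarrow> x \<in> ball p r \<Longrightarrow> y \<in> ball p r \<Longrightarrow> (u x - u y) \<bullet> (x - y) = 0"
  obtains A b where "linear A" "\<And>y. A y \<bullet> y = 0" "\<And>x. x \<in> \<Omega> \<Longrightarrow> u x = A x + b"
proof (cases "\<Omega> = {}")
  case True
  then show ?thesis using that[of "\<lambda>_. 0" 0] by (simp add: linear_zero)
next
  case False
  define rep where "rep p c \<longleftrightarrow> linear (fst c) \<and> (\<forall>y. fst c y \<bullet> y = 0) \<and>
      (\<exists>r>0. ball p r \<subseteq> \<Omega> \<and> (\<forall>x\<in>ball p r. u x = fst c x + snd c))" for p and c :: "('a \<Rightarrow> 'a) \<times> 'a"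
  have ex: "\<exists>c. rep p c" if p: "p \<in> \<Omega>" for p
  proof -
    obtain r where r: "r > 0" "ball p r \<subseteq> \<Omega>" using op p by (auto simp: open_contains_ball)
    obtain A b where "linear A" "\<And>y. A y \<bullet> y = 0" "\<And>x. x \<in> ball p r \<Longrightarrow> u x = A x + b"
      using affine_on_ball_if_difference_orthogonal[OF r(1), of p u] orth[OF r(2)] by metis
    then have "rep p (A, b)" unfolding rep_def using r by auto
    then show ?thesis by blast
  qed
  have uniq: "c = c'" if "rep p c" "rep p c'" for p c c'
  proof -
    obtain r r' where r: "r > 0" "r' > 0" "\<forall>x\<in>ball p r. u x = fst c x + snd c" "\<forall>x\<in>ball p r'. u x = fst c' x + snd c'"
      using \<open>rep p c\<close> \<open>rep p c'\<close> unfolding rep_def by blast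
    have l: "linear (fst c)" "linear (fst c')" using that by (auto simp: rep_def)
    have "fst c x + snd c = fst c' x + snd c'" if "x \<in> ball p (min r r')" for x
    proof -
      have "x \<in> ball p r" "x \<in> ball p r'" using that by auto
      then show ?thesis using r(3,4) by metis
    qed
    note eq = this
    have "min r r' > 0" using r by simp
    from linear_eq_on_ball[OF l this eq] show ?thesis by (simp add: prod_eq_iff)
  qed
  define f where "f p = (SOME c. rep p c)" for p
  have f: "rep p (f p)" if "p \<in> \<Omega>" for p unfolding f_def using ex[OF that] by (rule someI_ex)
  have loc: "\<forall>\<^sub>F y in at p within \<Omega>. f p = f y" if p: "p \<in> \<Omega>" for p
  proof -
    obtain r where r: "r > 0" "ball p r \<subseteq> \<Omega>" "\<forall>x\<in>ball p r. u x = fst (f p) x + snd (f p)"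
      using f[OF p] unfolding rep_def by blast
    have "f p = f y" if y: "y \<in> ball p r" for y
    proof (rule uniq)
      obtain r' where "r' > 0" "ball y r' \<subseteq> ball p r" using y by (metis open_ball open_contains_ball)
      then show "rep y (f p)" unfolding rep_def using r f[OF p] unfolding rep_def by blast
      show "rep y (f y)" using y r by (intro f) auto
    qed
    moreover have "\<forall>\<^sub>F y in at p within \<Omega>. y \<in> ball p r"
      using r(1) by (auto simp: eventually_at dist_commute)
    ultimately show ?thesis by (auto elim: eventually_mono)
  qed
  obtain p where p: "p \<in> \<Omega>" using False by blast
  have const: "f x = f p" if "x \<in> \<Omega>" for x
    by (rule connected_local_const[OF conn that p]) (use loc in blast)
  show ?thesis
  proof (rule that[of "fst (f p)" "snd (f p)"])
    show "linear (fst (f p))" "fst (f p) y \<bullet> y = 0" for y using f[OF p] by (auto simp: rep_def)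
    fix x assume "x \<in> \<Omega>"
    then show "u x = fst (f p) x + snd (f p)" using f[of x] const[of x] unfolding rep_def by auto
  qed
qed

text \<open>Arbitrarily near p there are points p - s e strictly below the graph; a whole
  neighbourhood of such a point misses \<Omega>, so it is not in the closure. This keeps the
  boundary out of the interiors of the elements.\<close>

lemma lipschitz_domain_frontier_not_interior:
  assumes lip: "lipschitz_domain \<Omega> r L" and p: "p \<in> frontier \<Omega>"
  shows "p \<notin> interior (closure \<Omega>)"
proof
  assume "p \<in> interior (closure \<Omega>)"
  then obtain \<epsilon> where \<epsilon>: "\<epsilon> > 0" "ball p \<epsilon> \<subseteq> closure \<Omega>" by (meson mem_interior)
  have r: "r > 0" and L: "L > 0" using lip by (auto simp: lipschitz_domain_def)
  have "\<forall>p\<in>frontier \<Omega>. \<exists>e \<psi>. norm e = 1 \<and> \<psi> 0 = 0 \<and>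
      L-lipschitz_on {y \<in> ball 0 r. y \<bullet> e = 0} \<psi> \<and>
      \<Omega> \<inter> ball p r = {x \<in> ball p r. (x - p) \<bullet> e > \<psi> ((x - p) - ((x - p) \<bullet> e) *\<^sub>R e)}"
    using lip unfolding lipschitz_domain_def by (elim conjE)
  from bspec[OF this p] obtain e \<psi> where e: "norm e = 1" "\<psi> 0 = 0"
    "L-lipschitz_on {y \<in> ball 0 r. y \<bullet> e = 0} \<psi>"
    "\<Omega> \<inter> ball p r = {x \<in> ball p r. (x - p) \<bullet> e > \<psi> ((x - p) - ((x - p) \<bullet> e) *\<^sub>R e)}"
    by (elim exE conjE) rule
  \<comment> \<open>s < \<epsilon> would put p - s e into the closure, and 2 s < r keeps the points
    near it inside the ball where the graph describes \<Omega>.\<close>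
  define s where "s = min \<epsilon> r / 4"
  have s: "s > 0" "s < \<epsilon>" "2 * s < r" using \<epsilon> r by (auto simp: s_def)
  define y where "y = p - s *\<^sub>R e"
  \<comment> \<open>Chosen so that \<rho> + L \<rho> = s / 2: within \<rho> of y the height is below
    \<rho> - s, whereas the graph stays above - L \<rho>.\<close>
  define \<rho> where "\<rho> = s / (2 * (1 + L))"
  have \<rho>: "\<rho> > 0" "\<rho> + L * \<rho> < s"
  proof -
    show "\<rho> > 0" using s L by (simp add: \<rho>_def)
    have "\<rho> + L * \<rho> = (1 + L) * \<rho>" by algebra
    also have "\<dots> = s / 2" using L by (simp add: \<rho>_def divide_simps)
    finally show "\<rho> + L * \<rho> < s" using s by simp
  qed
  have \<rho>s: "\<rho> < s" using \<rho> L by (smt (verit) mult_nonneg_nonneg)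
  have "y \<in> closure \<Omega>"
    using \<epsilon>(2) s e(1) by (auto simp: y_def dist_norm)
  then obtain z where z: "z \<in> \<Omega>" "dist z y < \<rho>" using \<rho>(1) by (meson closure_approachable)
  define w where "w = z - y"
  have zp: "z - p = w - s *\<^sub>R e" by (simp add: w_def y_def)
  have nw: "norm w < \<rho>" using z by (simp add: w_def dist_norm)
  have ee: "e \<bullet> e = 1" using e(1) by (simp add: norm_eq_1)
  have we: "\<bar>w \<bullet> e\<bar> \<le> norm w" using Cauchy_Schwarz_ineq2[of w e] e(1) by simp
  have "norm (z - p) \<le> norm w + s" unfolding zp using norm_triangle_ineq4[of w "s *\<^sub>R e"] e(1) s by simp
  then have "z \<in> ball p r" using nw \<rho>s s by (simp add: dist_norm norm_minus_commute)
  then have "(z - p) \<bullet> e > \<psi> ((z - p) - ((z - p) \<bullet> e) *\<^sub>R e)" using z(1) e(4) by blast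
  moreover have "(z - p) \<bullet> e = w \<bullet> e - s" by (simp add: zp inner_diff_left ee)
  moreover have "(z - p) - ((z - p) \<bullet> e) *\<^sub>R e = w - (w \<bullet> e) *\<^sub>R e"
    by (simp add: zp inner_diff_left ee algebra_simps)
  ultimately have gt: "w \<bullet> e - s > \<psi> (w - (w \<bullet> e) *\<^sub>R e)" by simp
  define q where "q = w - (w \<bullet> e) *\<^sub>R e"
  have qe: "q \<bullet> e = 0" by (simp add: q_def inner_diff_left ee)
  have nq: "norm q \<le> norm w"
  proof -
    have "w = q + (w \<bullet> e) *\<^sub>R e" by (simp add: q_def)
    then have "(norm w)\<^sup>2 = (norm q)\<^sup>2 + (norm ((w \<bullet> e) *\<^sub>R e))\<^sup>2"
      using norm_add_Pythagorean[of q "(w \<bullet> e) *\<^sub>R e"] qe by (simp add: orthogonal_def)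
    then have "(norm q)\<^sup>2 \<le> (norm w)\<^sup>2" by simp
    then show ?thesis by (simp add: power2_le_iff_abs_le)
  qed
  have "dist (\<psi> q) (\<psi> 0) \<le> L * dist q 0"
    by (rule lipschitz_onD[OF e(3)]) (use qe nq nw \<rho>s s r in \<open>auto\<close>)
  then have "\<bar>\<psi> q\<bar> \<le> L * norm q" by (simp add: e(2) dist_real_def)
  also have "\<dots> \<le> L * \<rho>" using L nq nw by (intro mult_left_mono) auto
  finally have "\<psi> q \<ge> - (L * \<rho>)" by linarith
  then show False using gt we nw \<rho> unfolding q_def[symmetric] by linarith
qed

text \<open>The frontier of a full-dimensional simplex is the union of its finitely many facets, and
  each facet has too small a dimension not to lie in a hyperplane.\<close>

lemma simplex_frontier_in_hyperplanes:
  fixes T :: "'a::euclidean_space set"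
  assumes "int DIM('a) simplex T"
  obtains H where "finite H" "frontier T \<subseteq> \<Union>H" "\<And>F. F \<in> H \<Longrightarrow> \<exists>a b. a \<noteq> 0 \<and> F \<subseteq> {x. a \<bullet> x = b}"
proof -
  obtain C where C: "finite C" "T = convex hull C" using assms unfolding simplex by blast
  have poly: "polyhedron T" using C by (simp add: polyhedron_convex_hull)
  have ad: "aff_dim T = int DIM('a)" by (rule aff_dim_simplex[OF assms])
  then have ri: "rel_interior T = interior T" by (intro rel_interior_interior) (simp only: aff_dim_eq_full)
  have cl: "closed T" using C by (simp add: finite_imp_compact_convex_hull compact_imp_closed)
  have "frontier T = \<Union>{F. F facet_of T}"
    using rel_boundary_of_polyhedron[OF poly] ri cl by (simp add: frontier_def)
  moreover have "\<exists>a b. a \<noteq> 0 \<and> F \<subseteq> {x. a \<bullet> x = b}" if "F facet_of T" for F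
  proof -
    have "aff_dim F < int DIM('a)" using that ad by (simp add: facet_of_def)
    from aff_lowdim_subset_hyperplane[OF this] show ?thesis by blast
  qed
  ultimately show ?thesis using that[of "{F. F facet_of T}"] finite_polyhedron_facets[OF poly] by auto
qed

section \<open>Displacements with vanishing symmetric gradient\<close>

definition sym_cgrad :: "(real ^ 'd \<Rightarrow> real ^ 'd) \<Rightarrow> real ^ 'd \<Rightarrow> real ^ 'd ^ 'd" where
  "sym_cgrad u x = sym_part (\<chi> i. cgrad (\<lambda>y. u y $ i) x)"

lemma sym_part_zero_imp_skew:
  fixes M :: "real ^ 'd ^ 'd"
  assumes "sym_part M = 0" shows "(M *v d) \<bullet> d = 0"
proof -
  have M: "M + transpose M = 0" using assms by (simp add: sym_part_def)
  have "M $ i $ j = - M $ j $ i" for i j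
  proof -
    have "(M + transpose M) $ i $ j = 0" using M by simp
    then show ?thesis by (simp add: transpose_def)
  qed
  then have "(\<Sum>i\<in>UNIV. \<Sum>j\<in>UNIV. M $ i $ j * d $ j * d $ i) = (\<Sum>i\<in>UNIV. \<Sum>j\<in>UNIV. - (M $ j $ i * d $ i * d $ j))"
    by (intro sum.cong refl) (metis mult.assoc mult.commute mult_minus_left)
  also have "\<dots> = - (\<Sum>i\<in>UNIV. \<Sum>j\<in>UNIV. M $ i $ j * d $ j * d $ i)"
    by (subst sum.swap) (simp add: sum_negf)
  finally have "(\<Sum>i\<in>UNIV. \<Sum>j\<in>UNIV. M $ i $ j * d $ j * d $ i) = 0" by linarith
  then show ?thesis by (simp add: inner_vec_def matrix_vector_mult_def sum_distrib_right)
qed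

context mesh_domain
begin

text \<open>On one element u is affine with skew matrix, which gives orthogonality for two points of
  that element. For two points of a ball, the component of u along the segment is constant on each
  of the finitely many closed pieces cut out by the elements, hence constant on the segment.\<close>

lemma sym_cgrad_zero_imp_orthogonal:
  fixes u :: "real ^ 'd \<Rightarrow> real ^ 'd"
  assumes u: "u \<in> PA" and z: "AE x in lebesgue_on \<Omega>. sym_cgrad u x = 0"
    and b: "ball p r \<subseteq> \<Omega>" "x \<in> ball p r" "y \<in> ball p r"
  shows "(u x - u y) \<bullet> (x - y) = 0"
proof -
  have skewT: "(u a - u b) \<bullet> (a - b) = 0" if T: "T \<in> \<T>" and a: "a \<in> T" and b: "b \<in> T" for T a b
  proof -
    have "\<exists>g c. (\<forall>x\<in>T. u x $ i = g \<bullet> x + c) \<and> (\<forall>x\<in>interior T. cgrad (\<lambda>y. u y $ i) x = g)" for i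
      using PA_gradE[OF PA_component[OF u] T] by metis
    then obtain g c where g: "\<And>i x. x \<in> T \<Longrightarrow> u x $ i = g i \<bullet> x + c i"
      "\<And>i x. x \<in> interior T \<Longrightarrow> cgrad (\<lambda>y. u y $ i) x = g i" by metis
    define M where "M = (\<chi> i. g i)"
    \<comment> \<open>The hypothesis holds only almost everywhere, but a nonempty open set is not
      null; one good point determines the constant gradient on T.\<close>
    have "\<exists>x\<in>interior T \<inter> \<Omega>. sym_cgrad u x = 0"
    proof (rule ccontr)
      assume *: "\<not> ?thesis"
      have "AE x in lebesgue. x \<in> \<Omega> \<longrightarrow> sym_cgrad u x = 0" using z dom_sets by (subst (asm) AE_restrict_space_iff) auto
      then have "AE x in lebesgue. x \<notin> interior T \<inter> \<Omega>" by eventually_elim (use * in auto)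
      then have "negligible (interior T \<inter> \<Omega>)"
        by (simp add: AE_iff_null_sets negligible_iff_null_sets completion.AE_iff_null_sets Int_def)
      moreover have "open (interior T \<inter> \<Omega>)" using open_dom by auto
      moreover have "interior T \<inter> \<Omega> \<noteq> {}"
      proof -
        obtain t where "t \<in> interior T" using mesh_interior_nonempty[OF T] by blast
        moreover then have "t \<in> closure \<Omega>" using mesh_subset[OF T] interior_subset by blast
        ultimately show ?thesis using open_Int_closure_eq_empty[OF open_interior, of T \<Omega>] by blast
      qed
      ultimately show False using open_not_negligible by blast
    qed
    then have "sym_part M = 0" using g(2) by (auto simp: sym_cgrad_def M_def)
    from sym_part_zero_imp_skew[OF this, of "a - b"]
    have "(M *v (a - b)) \<bullet> (a - b) = 0" .
    moreover have "M *v (a - b) = u a - u b"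
      using g(1)[OF a] g(1)[OF b]
      by (simp add: vec_eq_iff M_def matrix_vector_mult_def inner_vec_def right_diff_distrib sum_subtractf)
    ultimately show ?thesis by simp
  qed
  define U where "U T = {t. y + t *\<^sub>R (x - y) \<in> T}" for T
  have seg: "y + t *\<^sub>R (x - y) \<in> \<Omega>" if "t \<in> {0..1}" for t
  proof -
    have "y + t *\<^sub>R (x - y) = (1 - t) *\<^sub>R y + t *\<^sub>R x" by (simp add: algebra_simps)
    also have "\<dots> \<in> ball p r" using convex_ball[of p r] b(2,3) that by (simp add: convex_alt)
    finally show ?thesis using b(1) by blast
  qed
  \<comment> \<open>Lipschitz continuity with constant 0 expresses constancy in a form that glues
    over a finite closed cover.\<close>
  have "0-lipschitz_on {0..1} (\<lambda>t. u (y + t *\<^sub>R (x - y)) \<bullet> (x - y))"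
  proof (rule lipschitz_on_closed_Union[where I = \<T> and U = U])
    show "closed (U T)" if "T \<in> \<T>" for T
    proof -
      have "closed ((\<lambda>t. y + t *\<^sub>R (x - y)) -` T)"
        by (rule continuous_closed_vimage) (auto intro: mesh_closed that continuous_intros)
      then show ?thesis by (simp add: U_def vimage_def)
    qed
    show "{0..1} \<subseteq> (\<Union>T\<in>\<T>. U T)"
      using seg Union_mesh closure_subset[of \<Omega>] by (fastforce simp: U_def)
    show "0-lipschitz_on (U T) (\<lambda>t. u (y + t *\<^sub>R (x - y)) \<bullet> (x - y))" if T: "T \<in> \<T>" for T
    proof (rule lipschitz_onI)
      fix s t assume st: "s \<in> U T" "t \<in> U T"
      let ?a = "y + s *\<^sub>R (x - y)" and ?b = "y + t *\<^sub>R (x - y)"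
      have "(u ?a - u ?b) \<bullet> (?a - ?b) = 0" by (rule skewT[OF T]) (use st in \<open>auto simp: U_def\<close>)
      moreover have "?a - ?b = (s - t) *\<^sub>R (x - y)" by (simp add: algebra_simps)
      ultimately have "(u ?a - u ?b) \<bullet> (x - y) = 0 \<or> s = t" by (metis eq_iff_diff_eq_0 inner_scaleR_right mult_eq_0_iff)
      then show "dist (u ?a \<bullet> (x - y)) (u ?b \<bullet> (x - y)) \<le> 0 * dist s t"
        by (auto simp: dist_real_def inner_diff_left)
    qed simp
  qed (use finite_mesh in auto)
  then have "dist (u (y + 1 *\<^sub>R (x - y)) \<bullet> (x - y)) (u (y + 0 *\<^sub>R (x - y)) \<bullet> (x - y)) \<le> 0 * dist (1::real) 0"
    by (rule lipschitz_onD) auto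
  then show ?thesis by (simp add: inner_diff_left)
qed

end

subsection \<open>The discrete spaces\<close>

locale cavity =
  fixes P :: "('d::finite) cavity_data" and h :: real
  assumes dim: "CARD('d) = 2 \<or> CARD('d) = 3"
    and data: "admissible P"
    and h_pos: "0 < h" and h_le: "h \<le> h0 P"
begin

abbreviation \<Omega> where "\<Omega> \<equiv> Omega P"

lemma geometry: "admissible_geometry P" and elasticity: "elasticity_field \<Omega> (xi0 P) (C0 P)"
  and delta_pos: "delta P > 0" and epsilon_pos: "epsilon P > 0" and gam_pos: "gam P > 0"
  and discretization: "admissible_discretization P"
  using data by (auto simp: admissible_def)

lemma bounded_Omega: "bounded \<Omega>" and lipschitz: "lipschitz_domain \<Omega> (r0 P) (L0 P)"
  and frontier_eq: "frontier \<Omega> = SigmaN P \<union> SigmaD P" and SigmaN_borel: "SigmaN P \<in> sets borel"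
  and closed_SigmaD: "closed (SigmaD P)" and SigmaD_pos: "emeasure surface_measure (SigmaD P) > 0"
  using geometry by (auto simp: admissible_geometry_def)

lemma open_Omega: "open \<Omega>" and connected_Omega: "connected \<Omega>" and Omega_nonempty: "\<Omega> \<noteq> {}"
  using lipschitz by (auto simp: lipschitz_domain_def)

lemma mesh_props: "triangulation (mesh P h)" "\<Union>(mesh P h) = closure \<Omega>"
  "T \<in> mesh P h \<Longrightarrow> int CARD('d) simplex T"
  using discretization h_pos h_le by (auto simp: admissible_discretization_def regular_triangulations_def)

sublocale mesh_domain \<Omega> "mesh P h"
  by unfold_locales (use mesh_props open_Omega bounded_Omega in \<open>auto simp: triangulation_def\<close>)

lemma Vh_eq: "Vh P h = PA" by (simp add: Vh_def)

lemma lifting_PA: "lifting_h P h \<in> PA"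
  and traction_pw_affine: "traction_h P h \<in> continuous_pw_affine (mesh P h) (SigmaN P)"
  using discretization h_pos h_le unfolding admissible_discretization_def Vh_eq[symmetric] by auto

lemma card_ge_2: "CARD('d) \<ge> 2" using dim by auto

lemma frontier_subset: "frontier \<Omega> \<subseteq> closure \<Omega>"
  by (simp add: frontier_def)

lemma bounded_frontier: "bounded (frontier \<Omega>)"
  by (rule bounded_subset[OF bounded_closure[OF bounded_Omega] frontier_subset])

text \<open>Every boundary point belongs to some element but not to its interior, so the boundary
  lies in the finitely many hyperplanes carrying facets of the mesh. A bounded part of a hyperplane
  has finite measure.\<close>

lemma surface_frontier_finite: "emeasure surface_measure (frontier \<Omega>) < \<infinity>"
proof -
  have "\<exists>H. finite H \<and> frontier T \<subseteq> \<Union>H \<and> (\<forall>F\<in>H. \<exists>a b. a \<noteq> 0 \<and> F \<subseteq> {x. a \<bullet> x = b})"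
    if "T \<in> mesh P h" for T
    by (rule simplex_frontier_in_hyperplanes[of T]) (use mesh_props(3)[OF that] in auto)
  then obtain H where H: "\<And>T. T \<in> mesh P h \<Longrightarrow> finite (H T)" "\<And>T. T \<in> mesh P h \<Longrightarrow> frontier T \<subseteq> \<Union>(H T)"
    "\<And>T F. T \<in> mesh P h \<Longrightarrow> F \<in> H T \<Longrightarrow> \<exists>a b. a \<noteq> 0 \<and> F \<subseteq> {x. a \<bullet> x = b}" by metis
  define HH where "HH = (\<Union>T\<in>mesh P h. H T)"
  have fin: "finite HH" using H(1) finite_mesh by (auto simp: HH_def)
  have sub: "frontier \<Omega> \<subseteq> \<Union>HH"
  proof
    fix x assume x: "x \<in> frontier \<Omega>"
    then obtain T where T: "T \<in> mesh P h" "x \<in> T" using frontier_subset Union_mesh by blast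
    have "x \<notin> interior T"
      using lipschitz_domain_frontier_not_interior[OF lipschitz x] interior_mono[OF mesh_subset[OF T(1)]] by blast
    then have "x \<in> frontier T" using T closure_subset[of T] by (auto simp: frontier_def)
    then obtain F where "F \<in> H T" "x \<in> F" using H(2)[OF T(1)] by blast
    then show "x \<in> \<Union>HH" using T(1) by (auto simp: HH_def)
  qed
  have "\<exists>a b. a \<noteq> 0 \<and> F \<subseteq> {x. a \<bullet> x = b}" if "F \<in> HH" for F using that H(3) by (auto simp: HH_def)
  then obtain a b where ab: "\<And>F. F \<in> HH \<Longrightarrow> a F \<noteq> 0 \<and> F \<subseteq> {x. a F \<bullet> x = b F}" by metis
  \<comment> \<open>Intersecting with the hyperplane instead of with F yields closed, hence Borel,
    sets.\<close>
  let ?S = "\<lambda>F. frontier \<Omega> \<inter> {x. a F \<bullet> x = b F}"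
  have cl: "closed (?S F)" for F by (intro closed_Int frontier_closed closed_hyperplane)
  have bd: "bounded (?S F)" for F
    using bounded_frontier by (intro bounded_Int) simp
  have fS: "emeasure surface_measure (?S F) < \<infinity>" if "F \<in> HH" for F
    unfolding emeasure_surface_measure[OF card_ge_2 borel_closed[OF cl]]
    by (rule hausdorff_outer_hyperplane_finite[OF card_ge_2 bd, of "a F"]) (use ab[OF that] in auto)
  have "emeasure surface_measure (frontier \<Omega>) \<le> emeasure surface_measure (\<Union>F\<in>HH. ?S F)"
  proof (rule emeasure_mono)
    show "frontier \<Omega> \<subseteq> (\<Union>F\<in>HH. ?S F)"
    proof
      fix x assume x: "x \<in> frontier \<Omega>"
      then obtain F where "F \<in> HH" "x \<in> F" using sub by blast
      then show "x \<in> (\<Union>F\<in>HH. ?S F)" using ab[of F] x by blast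
    qed
    show "(\<Union>F\<in>HH. ?S F) \<in> sets surface_measure"
      unfolding sets_surface_measure by (rule borel_closed, rule closed_UN[OF fin]) (rule ballI cl)+
  qed
  also have "\<dots> \<le> (\<Sum>F\<in>HH. emeasure surface_measure (?S F))"
    by (rule emeasure_subadditive_finite[OF fin]) (use cl in \<open>auto intro: borel_closed\<close>)
  also have "\<dots> < \<infinity>" using fin fS by (induction HH rule: finite_induct) auto
  finally show ?thesis .
qed

section \<open>Discrete spaces with vanishing trace\<close>

definition PA0 :: "(real ^ 'd) set \<Rightarrow> (real ^ 'd \<Rightarrow> real ^ 'd) set" where
  "PA0 S = {u \<in> PA. AE x in surface_on S. u x = 0}"

text \<open>These functions are continuous up to the boundary, so \<open>has_trace\<close> reduces
  to its first branch and the trace is the restriction.\<close>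

lemma H1_vec_zero_on_eq: "PA \<inter> H1_vec_zero_on \<Omega> S = PA0 S"
proof -
  have "has_trace_vec \<Omega> S u (\<lambda>_. 0) \<longleftrightarrow> (AE x in surface_on S. u x = 0)" if u: "u \<in> PA" for u :: "real ^ 'd \<Rightarrow> real ^ 'd"
  proof -
    have "has_trace_vec \<Omega> S u (\<lambda>_. 0) \<longleftrightarrow> (\<forall>i. AE x in surface_on S. u x $ i = 0)"
      using PA_continuous[OF PA_component[OF u]] by (simp add: has_trace_vec_def has_trace_def)
    also have "\<dots> \<longleftrightarrow> (AE x in surface_on S. \<forall>i. u x $ i = 0)" by (subst AE_all_countable) auto
    finally show ?thesis by (simp add: vec_eq_iff)
  qed
  then show ?thesis using PA_H1_vec by (auto simp: PA0_def H1_vec_zero_on_def)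
qed

lemma Vh_SigmaD_eq: "Vh_SigmaD P h = PA0 (SigmaD P)" and Vh_0_eq: "Vh_0 P h = PA0 (frontier \<Omega>)"
  by (simp_all add: Vh_SigmaD_def Vh_0_def Vh_eq H1_vec_zero_on_eq)

text \<open>Covers the zero condition on \<open>SigmaD P\<close> for the traction problem and on the
  whole boundary for the displacement problem, so that Korn's inequality and the Galerkin theory are
  developed only once.\<close>

definition essential_part :: "(real ^ 'd) set \<Rightarrow> bool" where
  "essential_part S \<longleftrightarrow> closed S \<and> SigmaD P \<subseteq> S \<and> S \<subseteq> frontier \<Omega>"

lemma essential_parts: "essential_part (SigmaD P)" "essential_part (frontier \<Omega>)"
  using closed_SigmaD frontier_eq frontier_closed[of \<Omega>] unfolding essential_part_def by blast+

lemma PA0_PA: "u \<in> PA0 S \<Longrightarrow> u \<in> PA" by (simp add: PA0_def)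

lemma PA0_lincomb: "u \<in> PA0 S \<Longrightarrow> w \<in> PA0 S \<Longrightarrow> (\<lambda>x. a *\<^sub>R u x + c *\<^sub>R w x) \<in> PA0 S"
  unfolding PA0_def using PA_lincomb[of u w a c] by (auto elim: eventually_elim2)

lemma PA0_zero: "(\<lambda>_. 0) \<in> PA0 S" by (simp add: PA0_def PA_zero)

lemma PA0_closed:
  assumes S: "essential_part S" and U: "\<And>n. U n \<in> PA0 S" and lim: "uniform_limit (closure \<Omega>) U u sequentially"
  shows "u \<in> PA0 S"
proof -
  have "u \<in> PA" using PA_closed[OF PA0_PA[OF U] lim] .
  moreover have "AE x in surface_on S. u x = 0"
  proof -
    have "AE x in surface_on S. \<forall>n. U n x = 0" using U by (subst AE_all_countable) (auto simp: PA0_def)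
    moreover have "AE x in surface_on S. x \<in> S"
      by (rule AE_I2) (simp add: space_restrict_space)
    ultimately show ?thesis
    proof eventually_elim
      case (elim x)
      then have "x \<in> closure \<Omega>" using S frontier_subset by (auto simp: essential_part_def)
      from tendsto_uniform_limitI[OF lim this] elim show ?case by (simp add: LIMSEQ_const_iff)
    qed
  qed
  ultimately show ?thesis by (simp add: PA0_def)
qed

text \<open>A displacement without strain is a rigid motion A x + b on \<Omega> and by continuity on
  the closure. If it is nonzero its zeros on \<open>SigmaD P\<close> form a null set, although u
  vanishes almost everywhere on this set of positive measure.\<close>

lemma rigid_kernel:
  assumes S: "essential_part S" and u: "u \<in> PA0 S" and z: "AE x in lebesgue_on \<Omega>. sym_cgrad u x = 0"
    and x: "x \<in> closure \<Omega>"
  shows "u x = 0"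
proof -
  obtain A b where A: "linear A" "\<And>y. A y \<bullet> y = 0" "\<And>x. x \<in> \<Omega> \<Longrightarrow> u x = A x + b"
    using rigid_if_locally_orthogonal[OF open_Omega connected_Omega, of u]
      sym_cgrad_zero_imp_orthogonal[OF PA0_PA[OF u] z] by metis
  have cA: "continuous_on X A" for X using A(1) by (simp add: linear_continuous_on linear_linear)
  have eq: "u x = A x + b" if "x \<in> closure \<Omega>" for x
  proof -
    have "continuous_on (closure \<Omega>) (\<lambda>x. u x - (A x + b))"
      by (rule continuous_on_diff[OF PA_continuous[OF PA0_PA[OF u]] continuous_on_add[OF cA continuous_on_const]])
    from continuous_constant_on_closure[OF this _ that, of 0] A(3) show ?thesis by simp
  qed
  have "(\<forall>x. A x = 0) \<and> b = 0"
  proof (rule ccontr)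
    assume ne: "\<not> ?thesis"
    define Z where "Z = SigmaD P \<inter> {x. A x + b = 0}"
    have "closed {x. A x + b = 0}" by (intro closed_Collect_eq continuous_intros cA)
    then have Zb: "Z \<in> sets borel" unfolding Z_def using closed_SigmaD by (intro borel_closed closed_Int)
    have bZ: "bounded Z"
      by (rule bounded_subset[OF bounded_frontier]) (auto simp: Z_def frontier_eq)
    have "hausdorff_outer (CARD('d) - 1) Z = 0"
      by (rule skew_affine_zero_set_null[OF card_ge_2 A(1,2) ne bZ]) (simp add: Z_def)
    then have Z0: "emeasure surface_measure Z = 0" by (simp add: emeasure_surface_measure[OF card_ge_2 Zb])
    have "AE x in surface_measure. x \<in> S \<longrightarrow> u x = 0"
      using u S by (subst AE_restrict_space_iff[symmetric]) (auto simp: PA0_def essential_part_def)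
    moreover have "AE x in surface_measure. x \<notin> Z"
      by (intro AE_not_in) (use Z0 Zb in \<open>auto simp: null_sets_def\<close>)
    ultimately have "AE x in surface_measure. x \<notin> SigmaD P"
    proof eventually_elim
      case (elim x)
      show ?case
      proof
        assume x: "x \<in> SigmaD P"
        then have "u x = 0" "x \<in> closure \<Omega>" using elim S frontier_subset by (auto simp: essential_part_def)
        then show False using elim eq[of x] x by (simp add: Z_def)
      qed
    qed
    then have "emeasure surface_measure (SigmaD P) = 0"
      using closed_SigmaD by (subst (asm) AE_iff_measurable[OF _ refl]) auto
    then show False using SigmaD_pos by simp
  qed
  then show ?thesis using eq[OF x] by simp
qed

section \<open>The traction functional\<close>

definition ell :: "(real ^ 'd \<Rightarrow> real ^ 'd) \<Rightarrow> real" where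
  "ell \<phi> = (LINT x|surface_on (SigmaN P). traction_h P h x \<bullet> \<phi> x)"

lemma SigmaN_subset: "SigmaN P \<subseteq> closure \<Omega>"
  using frontier_eq frontier_subset by blast

lemma surface_SigmaN_finite: "finite_measure (surface_on (SigmaN P))"
proof
  have "emeasure (surface_on (SigmaN P)) (SigmaN P) = emeasure surface_measure (SigmaN P)"
    using SigmaN_borel by (subst emeasure_restrict_space) auto
  also have "\<dots> \<le> emeasure surface_measure (frontier \<Omega>)"
    by (rule emeasure_mono) (simp_all add: frontier_eq[symmetric], use frontier_eq in blast)
  also have "\<dots> < \<infinity>" by (rule surface_frontier_finite)
  finally show "emeasure (surface_on (SigmaN P)) (space (surface_on (SigmaN P))) \<noteq> \<infinity>"
    by (simp add: space_restrict_space)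
qed

text \<open>\<open>SigmaN P\<close> need not be closed, so continuity alone gives no bound. On each
  element, however, the traction agrees with an affine map, which is bounded on the whole compact
  element.\<close>

lemma traction_bounded: obtains B where "B \<ge> 0" "\<And>x. x \<in> SigmaN P \<Longrightarrow> norm (traction_h P h x) \<le> B"
proof -
  have "bounded (traction_h P h ` (SigmaN P \<inter> T))" if T: "T \<in> mesh P h" for T
  proof -
    obtain l b where l: "linear l" "\<And>x. x \<in> SigmaN P \<inter> T \<Longrightarrow> traction_h P h x = l x + b"
      using traction_pw_affine T unfolding continuous_pw_affine_def by blast
    have "compact ((\<lambda>x. l x + b) ` T)"
      using l(1) mesh_compact[OF T]
      by (intro compact_continuous_image continuous_intros) (auto simp: linear_continuous_on linear_linear)
    moreover have "traction_h P h ` (SigmaN P \<inter> T) \<subseteq> (\<lambda>x. l x + b) ` T" using l(2) by auto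
    ultimately show ?thesis by (meson compact_imp_bounded bounded_subset)
  qed
  then have "bounded (\<Union>T\<in>mesh P h. traction_h P h ` (SigmaN P \<inter> T))" using finite_mesh by (intro bounded_UN) auto
  moreover have "traction_h P h ` SigmaN P \<subseteq> (\<Union>T\<in>mesh P h. traction_h P h ` (SigmaN P \<inter> T))"
    using SigmaN_subset Union_mesh by blast
  ultimately have "bounded (traction_h P h ` SigmaN P)" by (rule bounded_subset)
  then show ?thesis using that by (auto simp: bounded_pos intro: less_imp_le)
qed

lemma surface_measurable:
  fixes f :: "real ^ 'd \<Rightarrow> 'b::topological_space"
  assumes "continuous_on (SigmaN P) f"
  shows "f \<in> borel_measurable (surface_on (SigmaN P))"
proof -
  have "f \<in> borel_measurable (restrict_space borel (SigmaN P))"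
    by (rule borel_measurable_continuous_on_restrict[OF assms])
  moreover have "sets (surface_on (SigmaN P)) = sets (restrict_space borel (SigmaN P))"
    by (rule sets_restrict_space_cong) simp
  ultimately show ?thesis using measurable_cong_sets by blast
qed

text \<open>A bounded traction on a part of finite surface measure makes \<open>ell\<close>
  continuous for the sup norm.\<close>

lemma
  shows ell_integrable: "\<And>\<phi>. \<phi> \<in> PA \<Longrightarrow> integrable (surface_on (SigmaN P)) (\<lambda>x. traction_h P h x \<bullet> \<phi> x)"
    and ell_bound_ex: "\<exists>B\<ge>0. \<forall>\<phi>\<in>PA. \<forall>M. (\<forall>x\<in>closure \<Omega>. norm (\<phi> x) \<le> M) \<longrightarrow> \<bar>ell \<phi>\<bar> \<le> B * M"proof -
  interpret S: finite_measure "surface_on (SigmaN P)" by (rule surface_SigmaN_finite)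
  obtain B where B: "B \<ge> 0" "\<And>x. x \<in> SigmaN P \<Longrightarrow> norm (traction_h P h x) \<le> B" using traction_bounded by metis
  define m where "m = measure (surface_on (SigmaN P)) (SigmaN P)"
  have meas: "(\<lambda>x. traction_h P h x \<bullet> \<phi> x) \<in> borel_measurable (surface_on (SigmaN P))" if "\<phi> \<in> PA" for \<phi>
    using traction_pw_affine continuous_on_subset[OF PA_continuous[OF that] SigmaN_subset]
    by (intro surface_measurable continuous_intros) (simp add: continuous_pw_affine_def)
  have bd: "norm (traction_h P h x \<bullet> \<phi> x) \<le> B * M"
    if "\<And>x. x \<in> closure \<Omega> \<Longrightarrow> norm (\<phi> x) \<le> M" "x \<in> SigmaN P" for \<phi> M x
  proof -
    have "norm (traction_h P h x \<bullet> \<phi> x) \<le> norm (traction_h P h x) * norm (\<phi> x)"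
      by (simp add: Cauchy_Schwarz_ineq2)
    also have "\<dots> \<le> B * M" using B that SigmaN_subset by (intro mult_mono) auto
    finally show ?thesis .
  qed
  have int: "integrable (surface_on (SigmaN P)) (\<lambda>x. traction_h P h x \<bullet> \<phi> x)" if \<phi>: "\<phi> \<in> PA" for \<phi>
  proof -
    obtain M where "M \<ge> 0" "\<And>x. x \<in> closure \<Omega> \<Longrightarrow> norm (\<phi> x) \<le> M" using PA_bounded[OF \<phi>] by metis
    then show ?thesis
      by (intro S.integrable_const_bound[where B = "B * M"] meas \<phi> AE_I2 bd) (auto simp: space_restrict_space)
  qed
  have "\<bar>ell \<phi>\<bar> \<le> (B * m) * M" if \<phi>: "\<phi> \<in> PA" and M: "\<And>x. x \<in> closure \<Omega> \<Longrightarrow> norm (\<phi> x) \<le> M" for \<phi> M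
  proof -
    have "norm (ell \<phi>) \<le> (LINT x|surface_on (SigmaN P). norm (traction_h P h x \<bullet> \<phi> x))"
      unfolding ell_def by (rule integral_norm_bound)
    also have "\<dots> \<le> (LINT x|surface_on (SigmaN P). B * M)"
      by (intro integral_mono integrable_norm int \<phi> S.integrable_const bd M) (auto simp: space_restrict_space)
    also have "\<dots> = (B * m) * M" by (simp add: m_def space_restrict_space)
    finally show ?thesis by simp
  qed
  then show "\<exists>B\<ge>0. \<forall>\<phi>\<in>PA. \<forall>M. (\<forall>x\<in>closure \<Omega>. norm (\<phi> x) \<le> M) \<longrightarrow> \<bar>ell \<phi>\<bar> \<le> B * M"
    using B(1) by (intro exI[of _ "B * m"]) (simp add: m_def)
  show "integrable (surface_on (SigmaN P)) (\<lambda>x. traction_h P h x \<bullet> \<phi> x)" if "\<phi> \<in> PA" for \<phi>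
    by (rule int[OF that])
qed

lemma ell_bound:
  obtains B where "B \<ge> 0"
    "\<And>\<phi> M. \<phi> \<in> PA \<Longrightarrow> (\<And>x. x \<in> closure \<Omega> \<Longrightarrow> norm (\<phi> x) \<le> M) \<Longrightarrow> \<bar>ell \<phi>\<bar> \<le> B * M"
  using ell_bound_ex by blast

lemma ell_lincomb:
  assumes "\<phi> \<in> PA" "\<psi> \<in> PA"
  shows "ell (\<lambda>x. a *\<^sub>R \<phi> x + c *\<^sub>R \<psi> x) = a * ell \<phi> + c * ell \<psi>"
  unfolding ell_def inner_add_right inner_scaleR_right
  by (subst Bochner_Integration.integral_add) (use ell_integrable assms in auto)

end

subsection \<open>The elastic energy form\<close>

lemma norm_matrix_le:
  fixes M :: "real ^ 'n ^ 'm"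
  assumes "\<And>i j. \<bar>M $ i $ j\<bar> \<le> e"
  shows "norm M \<le> real CARD('m) * (real CARD('n) * e)"
proof -
  have "norm M \<le> (\<Sum>i\<in>UNIV. norm (M $ i))" unfolding norm_vec_def by (rule L2_set_le_sum) simp
  also have "\<dots> \<le> (\<Sum>i\<in>(UNIV::'m set). real CARD('n) * e)"
  proof (rule sum_mono)
    fix i
    have "norm (M $ i) \<le> (\<Sum>j\<in>UNIV. \<bar>M $ i $ j\<bar>)" by (rule norm_le_l1_cart)
    also have "\<dots> \<le> real CARD('n) * e" using assms by (intro sum_bounded_above) auto
    finally show "norm (M $ i) \<le> real CARD('n) * e" .
  qed
  finally show ?thesis by simp
qed

lemma matrix_entry_le_norm:
  fixes M :: "real ^ 'n ^ 'm" shows "\<bar>M $ i $ j\<bar> \<le> norm M"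
  by (rule order_trans[OF component_le_norm_cart Finite_Cartesian_Product.norm_nth_le])

lemma tensor_app_inner_bound:
  fixes C :: "'d::finite tensor4"
  assumes C: "\<And>i j k l. \<bar>C i j k l\<bar> \<le> M"
  shows "\<bar>tensor_app C A \<bullet> B\<bar> \<le> real CARD('d) ^ 4 * M * norm A * norm B"
proof -
  have M0: "M \<ge> 0" using C[of undefined undefined undefined undefined] by linarith
  have "\<bar>tensor_app C A $ i $ j\<bar> \<le> real CARD('d) * (real CARD('d) * (M * norm A))" for i j
  proof -
    have "\<bar>\<Sum>k\<in>UNIV. \<Sum>l\<in>UNIV. C i j k l * A $ k $ l\<bar> \<le> (\<Sum>k\<in>UNIV. \<bar>\<Sum>l\<in>UNIV. C i j k l * A $ k $ l\<bar>)"
      by (rule sum_abs)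
    also have "\<dots> \<le> (\<Sum>k\<in>(UNIV::'d set). real CARD('d) * (M * norm A))"
    proof (rule sum_mono)
      fix k
      have "\<bar>\<Sum>l\<in>UNIV. C i j k l * A $ k $ l\<bar> \<le> (\<Sum>l\<in>UNIV. \<bar>C i j k l * A $ k $ l\<bar>)" by (rule sum_abs)
      also have "\<dots> \<le> (\<Sum>l\<in>(UNIV::'d set). M * norm A)"
        using C M0 by (intro sum_mono) (auto simp: abs_mult intro!: mult_mono matrix_entry_le_norm)
      finally show "\<bar>\<Sum>l\<in>UNIV. C i j k l * A $ k $ l\<bar> \<le> real CARD('d) * (M * norm A)" by simp
    qed
    finally show ?thesis by (simp add: tensor_app_def)
  qed
  from norm_matrix_le[OF this] have "norm (tensor_app C A) \<le> real CARD('d) ^ 4 * M * norm A"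
    by (simp add: power4_eq_xxxx mult_ac)
  then have "norm (tensor_app C A) * norm B \<le> real CARD('d) ^ 4 * M * norm A * norm B"
    by (rule mult_right_mono) simp
  then show ?thesis using Cauchy_Schwarz_ineq2[of "tensor_app C A" B] by linarith
qed

lemma tensor_app_lincomb: "tensor_app C (a *\<^sub>R A + b *\<^sub>R B) = a *\<^sub>R tensor_app C A + b *\<^sub>R tensor_app C B"
  by (simp add: tensor_app_def vec_eq_iff sum.distrib sum_distrib_left algebra_simps)

lemma tensor_app_inner:
  "tensor_app C A \<bullet> B = (\<Sum>i\<in>UNIV. \<Sum>j\<in>UNIV. \<Sum>k\<in>UNIV. \<Sum>l\<in>UNIV. C i j k l * A $ k $ l * B $ i $ j)"
  by (simp add: tensor_app_def inner_vec_def sum_distrib_right)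

text \<open>The hypothesis exchanges the index pairs (i, j) and (k, l); the rest reorders the four
  sums.\<close>

lemma tensor_app_inner_swap:
  assumes "\<And>i j k l. C i j k l = C k l i j"
  shows "tensor_app C A \<bullet> B = tensor_app C B \<bullet> A"
proof -
  let ?f = "\<lambda>i j k l. C i j k l * A $ k $ l * B $ i $ j"
  have "tensor_app C A \<bullet> B = (\<Sum>i\<in>UNIV. \<Sum>j\<in>UNIV. \<Sum>k\<in>UNIV. \<Sum>l\<in>UNIV. ?f i j k l)"
    by (rule tensor_app_inner)
  also have "\<dots> = (\<Sum>i\<in>UNIV. \<Sum>k\<in>UNIV. \<Sum>j\<in>UNIV. \<Sum>l\<in>UNIV. ?f i j k l)"
    by (rule sum.cong[OF refl], rule sum.swap)
  also have "\<dots> = (\<Sum>k\<in>UNIV. \<Sum>i\<in>UNIV. \<Sum>j\<in>UNIV. \<Sum>l\<in>UNIV. ?f i j k l)"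
    by (rule sum.swap)
  also have "\<dots> = (\<Sum>k\<in>UNIV. \<Sum>i\<in>UNIV. \<Sum>l\<in>UNIV. \<Sum>j\<in>UNIV. ?f i j k l)"
    by (rule sum.cong[OF refl], rule sum.cong[OF refl], rule sum.swap)
  also have "\<dots> = (\<Sum>k\<in>UNIV. \<Sum>l\<in>UNIV. \<Sum>i\<in>UNIV. \<Sum>j\<in>UNIV. ?f i j k l)"
    by (rule sum.cong[OF refl], rule sum.swap)
  also have "\<dots> = (\<Sum>k\<in>UNIV. \<Sum>l\<in>UNIV. \<Sum>i\<in>UNIV. \<Sum>j\<in>UNIV. C k l i j * B $ i $ j * A $ k $ l)"
  proof -
    have "?f i j k l = C k l i j * B $ i $ j * A $ k $ l" for i j k l
      using assms[of i j k l] by simp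
    then show ?thesis by (intro sum.cong refl)
  qed
  also have "\<dots> = tensor_app C B \<bullet> A"
    by (rule tensor_app_inner[symmetric])
  finally show ?thesis .
qed

lemma sym_part_lincomb: "sym_part (a *\<^sub>R A + b *\<^sub>R B) = a *\<^sub>R sym_part A + b *\<^sub>R sym_part B"
  by (simp add: sym_part_def vec_eq_iff transpose_def algebra_simps)

lemma sym_part_nth: "sym_part A $ i $ j = (A $ i $ j + A $ j $ i) / 2"
  by (simp add: sym_part_def transpose_def)

context mesh_domain
begin

lemma sym_cgrad_lincomb:
  assumes "u \<in> PA" "w \<in> PA" "x \<in> mesh_int"
  shows "sym_cgrad (\<lambda>x. a *\<^sub>R u x + c *\<^sub>R w x) x = a *\<^sub>R sym_cgrad u x + c *\<^sub>R sym_cgrad w x"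
proof -
  have "(\<chi> i. cgrad (\<lambda>y. (a *\<^sub>R u y + c *\<^sub>R w y) $ i) x)
      = a *\<^sub>R (\<chi> i. cgrad (\<lambda>y. u y $ i) x) + c *\<^sub>R (\<chi> i. cgrad (\<lambda>y. w y $ i) x)"
    using cgrad_lincomb[OF PA_component[OF assms(1)] PA_component[OF assms(2)] assms(3)]
    by (simp add: vec_eq_iff)
  then show ?thesis unfolding sym_cgrad_def by (simp only: sym_part_lincomb)
qed

lemma sym_cgrad_const_on_mesh:
  assumes u: "u \<in> PA" and T: "T \<in> \<T>" "x \<in> interior T" "y \<in> interior T"
  shows "sym_cgrad u x = sym_cgrad u y"
proof -
  have "cgrad (\<lambda>z. u z $ i) x = cgrad (\<lambda>z. u z $ i) y" for i
    using PA_gradE[OF PA_component[OF u] T(1)] T by metis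
  then show ?thesis by (simp add: sym_cgrad_def)
qed

lemma sym_cgrad_bound:
  obtains C where "C \<ge> 0"
    "\<And>(u :: real ^ 'd \<Rightarrow> real ^ 'd) e x. u \<in> PA \<Longrightarrow> (\<And>x. x \<in> closure \<Omega> \<Longrightarrow> norm (u x) \<le> e) \<Longrightarrow> x \<in> mesh_int \<Longrightarrow>
       norm (sym_cgrad u x) \<le> C * e"
proof -
  obtain C where C: "C \<ge> 0" "\<And>(u :: real ^ 'd \<Rightarrow> real) e x. u \<in> PA \<Longrightarrow> (\<And>x. x \<in> closure \<Omega> \<Longrightarrow> \<bar>u x\<bar> \<le> e) \<Longrightarrow> x \<in> mesh_int \<Longrightarrow>
       norm (cgrad u x) \<le> C * e" using inverse_estimate by metis
  show ?thesis
  proof (rule that[of "real CARD('d) * (real CARD('d) * C)"])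
    fix u :: "real ^ 'd \<Rightarrow> real ^ 'd" and e x
    assume u: "u \<in> PA" and e: "\<And>x. x \<in> closure \<Omega> \<Longrightarrow> norm (u x) \<le> e" and x: "x \<in> mesh_int"
    have n: "norm (cgrad (\<lambda>y. u y $ i) x) \<le> C * e" for i
      by (rule C(2)[OF PA_component[OF u] _ x]) (rule order_trans[OF component_le_norm_cart e])
    have c: "\<bar>cgrad (\<lambda>y. u y $ i) x $ j\<bar> \<le> C * e" for i j
      by (rule order_trans[OF component_le_norm_cart n])
    have "\<bar>sym_cgrad u x $ i $ j\<bar> \<le> C * e" for i j
      using c[of i j] c[of j i] unfolding sym_cgrad_def sym_part_nth by (simp add: abs_le_iff)
    from norm_matrix_le[OF this] show "norm (sym_cgrad u x) \<le> real CARD('d) * (real CARD('d) * C) * e" by (simp add: mult.assoc)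
  qed (use C in simp)
qed

lemma sym_cgrad_tendsto:
  assumes U: "\<And>n. U n \<in> PA" and u: "u \<in> PA" and lim: "uniform_limit (closure \<Omega>) U u sequentially"
    and x: "x \<in> mesh_int"
  shows "(\<lambda>n. sym_cgrad (U n) x) \<longlonglongrightarrow> sym_cgrad u x"
proof (rule tendstoI)
  fix e :: real assume e: "e > 0"
  obtain C where C: "C \<ge> 0" "\<And>(u :: real ^ 'd \<Rightarrow> real ^ 'd) e x. u \<in> PA \<Longrightarrow> (\<And>x. x \<in> closure \<Omega> \<Longrightarrow> norm (u x) \<le> e) \<Longrightarrow> x \<in> mesh_int \<Longrightarrow>
       norm (sym_cgrad u x) \<le> C * e" using sym_cgrad_bound by metis
  have "e / (C + 1) > 0" using e C(1) by simp
  from uniform_limitD[OF lim this] show "\<forall>\<^sub>F n in sequentially. dist (sym_cgrad (U n) x) (sym_cgrad u x) < e"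
  proof eventually_elim
    case (elim n)
    have "norm (sym_cgrad (\<lambda>x. U n x - u x) x) \<le> C * (e / (C + 1))"
      by (rule C(2)[OF PA_diff[OF U u] _ x]) (use elim in \<open>auto simp: dist_norm intro: less_imp_le\<close>)
    also have "\<dots> < e" using e C(1) by (simp add: field_simps)
    finally show "dist (sym_cgrad (U n) x) (sym_cgrad u x) < e"
      using sym_cgrad_lincomb[OF U u x, of 1 n "-1"] by (simp add: dist_norm)
  qed
qed

lemma sym_grad_eq_sg:
  assumes u: "u \<in> PA" shows "AE x in lebesgue_on \<Omega>. sym_grad \<Omega> u x = sym_cgrad u x"
proof -
  have "AE x in lebesgue_on \<Omega>. \<forall>i. weak_grad \<Omega> (\<lambda>y. u y $ i) x = cgrad (\<lambda>y. u y $ i) x"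
    by (subst AE_all_countable) (use weak_grad_eq_cgrad[OF PA_component[OF u]] in auto)
  then show ?thesis by eventually_elim (simp add: sym_grad_def sym_cgrad_def weak_jacobian_def)
qed

text \<open>An algebra of functions that are integrable on the bounded domain; closure under sums
  and products settles the integrability side conditions structurally.\<close>

definition bounded_measurable :: "(real ^ 'd \<Rightarrow> real) \<Rightarrow> bool" where
  "bounded_measurable f \<longleftrightarrow> f \<in> borel_measurable (lebesgue_on \<Omega>) \<and> (\<exists>B. AE x in lebesgue_on \<Omega>. \<bar>f x\<bar> \<le> B)"

lemma bounded_measurable_integrable:
  assumes "bounded_measurable f" shows "integrable (lebesgue_on \<Omega>) f"
proof -
  obtain B where "AE x in lebesgue_on \<Omega>. norm (f x) \<le> B" "f \<in> borel_measurable (lebesgue_on \<Omega>)"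
    using assms by (auto simp: bounded_measurable_def)
  then show ?thesis by (rule integrable_const_bound)
qed

lemma bounded_measurable_const: "bounded_measurable (\<lambda>_. c)"
  unfolding bounded_measurable_def by auto

lemma bounded_measurable_add:
  assumes "bounded_measurable f" "bounded_measurable g" shows "bounded_measurable (\<lambda>x. f x + g x)"
proof -
  obtain B B' where "AE x in lebesgue_on \<Omega>. \<bar>f x\<bar> \<le> B" "AE x in lebesgue_on \<Omega>. \<bar>g x\<bar> \<le> B'"
    using assms by (auto simp: bounded_measurable_def)
  then have "AE x in lebesgue_on \<Omega>. \<bar>f x + g x\<bar> \<le> B + B'" by eventually_elim linarith
  then show ?thesis using assms by (auto simp: bounded_measurable_def)
qed

lemma bounded_measurable_mult:
  assumes "bounded_measurable f" "bounded_measurable g" shows "bounded_measurable (\<lambda>x. f x * g x)"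
proof -
  obtain B B' where "AE x in lebesgue_on \<Omega>. \<bar>f x\<bar> \<le> B" "AE x in lebesgue_on \<Omega>. \<bar>g x\<bar> \<le> B'"
    using assms by (auto simp: bounded_measurable_def)
  then have "AE x in lebesgue_on \<Omega>. \<bar>f x * g x\<bar> \<le> \<bar>B\<bar> * \<bar>B'\<bar>"
    by eventually_elim (auto simp: abs_mult intro!: mult_mono)
  then show ?thesis using assms by (auto simp: bounded_measurable_def)
qed

lemma bounded_measurable_diff: "bounded_measurable f \<Longrightarrow> bounded_measurable g \<Longrightarrow> bounded_measurable (\<lambda>x. f x - g x)"
  using bounded_measurable_add[of f "\<lambda>x. (-1) * g x"] bounded_measurable_mult[OF bounded_measurable_const[of "-1"], of g] by simp

lemma bounded_measurable_PA:
  assumes u: "u \<in> PA" shows "bounded_measurable u"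
proof -
  obtain B where "\<And>x. x \<in> closure \<Omega> \<Longrightarrow> norm (u x) \<le> B" using PA_bounded[OF u] by metis
  then have "AE x in lebesgue_on \<Omega>. \<bar>u x\<bar> \<le> B" using closure_subset[of \<Omega>] by (intro AE_domI) auto
  then show ?thesis using PA_measurable[OF u] by (auto simp: bounded_measurable_def)
qed

lemma bounded_measurable_cgrad_inner:
  fixes u w :: "real ^ 'd \<Rightarrow> real"
  assumes u: "u \<in> PA" and w: "w \<in> PA" shows "bounded_measurable (\<lambda>x. cgrad u x \<bullet> cgrad w x)"
proof -
  obtain B where B: "B \<ge> 0" "\<And>x. x \<in> mesh_int \<Longrightarrow> norm (cgrad u x) \<le> B" using cgrad_bounded[OF u] by metis
  obtain B' where B': "B' \<ge> 0" "\<And>x. x \<in> mesh_int \<Longrightarrow> norm (cgrad w x) \<le> B'" using cgrad_bounded[OF w] by metis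
  have "AE x in lebesgue_on \<Omega>. \<bar>cgrad u x \<bullet> cgrad w x\<bar> \<le> B * B'"
    by (rule AE_domI) (use B B' in \<open>auto intro!: order_trans[OF Cauchy_Schwarz_ineq2] mult_mono\<close>)
  moreover have "(\<lambda>x. cgrad u x \<bullet> cgrad w x) \<in> borel_measurable (lebesgue_on \<Omega>)"
    by (intro borel_measurable_inner cgrad_measurable u w)
  ultimately show ?thesis by (auto simp: bounded_measurable_def)
qed

end

text \<open>The direct method without a topology on X: only the values along sequences are used, and
  they make the image of Q a compact set of reals, which has a least element.\<close>

lemma exists_minimizer_seq:
  fixes Q :: "'x \<Rightarrow> real"
  assumes ne: "X \<noteq> {}"
    and comp: "\<And>f. (\<And>n. f n \<in> X) \<Longrightarrow> \<exists>r w. strict_mono (r :: nat \<Rightarrow> nat) \<and> w \<in> X \<and> (\<lambda>n. Q (f (r n))) \<longlonglongrightarrow> Q w"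
  shows "\<exists>w\<in>X. \<forall>y\<in>X. Q w \<le> Q y"
proof -
  have "seq_compact (Q ` X)"
  proof (rule seq_compactI)
    fix g :: "nat \<Rightarrow> real" assume "\<forall>n. g n \<in> Q ` X"
    then have "\<exists>f. \<forall>n. f n \<in> X \<and> g n = Q (f n)" by (intro choice) auto
    then obtain f where f: "\<And>n. f n \<in> X" "\<And>n. g n = Q (f n)" by auto
    from comp[of f, OF f(1)] show "\<exists>l\<in>Q ` X. \<exists>r. strict_mono r \<and> (g \<circ> r) \<longlonglongrightarrow> l"
      unfolding comp_def f(2) by blast
  qed
  then have "compact (Q ` X)" by (simp add: compact_eq_seq_compact_metric)
  then obtain y where "y \<in> Q ` X" "\<forall>t\<in>Q ` X. y \<le> t" using compact_attains_inf[of "Q ` X"] ne by blast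
  then show ?thesis by auto
qed

text \<open>Divide by t and let t tend to 0 along 1 / (n + 1).\<close>

lemma first_variation_nonneg:
  fixes D q :: real
  assumes "\<And>t. 0 < t \<Longrightarrow> t \<le> 1 \<Longrightarrow> 0 \<le> t * D + t\<^sup>2 * q"
  shows "0 \<le> D"
proof (rule LIMSEQ_le_const)
  show "(\<lambda>n. D + 1 / real (Suc n) * q) \<longlonglongrightarrow> D"
    using tendsto_add[OF tendsto_const tendsto_mult[OF LIMSEQ_Suc[OF lim_1_over_n] tendsto_const], of D q] by simp
  have "0 \<le> D + 1 / real (Suc n) * q" for n
  proof -
    define t where "t = 1 / real (Suc n)"
    have t: "0 < t" "t \<le> 1" by (auto simp: t_def)
    have "0 \<le> t * (D + t * q)" using assms[OF t] by (simp add: power2_eq_square algebra_simps)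
    then have "0 \<le> D + t * q" using t by (simp add: zero_le_mult_iff)
    then show ?thesis unfolding t_def .
  qed
  then show "\<exists>N. \<forall>n\<ge>N. 0 \<le> D + 1 / real (Suc n) * q" by blast
qed

context cavity
begin

definition energy_density :: "(real ^ 'd \<Rightarrow> real ^ 'd) \<Rightarrow> (real ^ 'd \<Rightarrow> real ^ 'd) \<Rightarrow> real ^ 'd \<Rightarrow> real" where
  "energy_density u w x = tensor_app (C0 P x) (sym_cgrad u x) \<bullet> sym_cgrad w x"

text \<open>The weight \<theta> will be \<open>theta v\<close> for the elastic problems and 1 as the
  reference energy in Korn's inequality.\<close>

definition energy_form :: "(real ^ 'd \<Rightarrow> real) \<Rightarrow> (real ^ 'd \<Rightarrow> real ^ 'd) \<Rightarrow> (real ^ 'd \<Rightarrow> real ^ 'd) \<Rightarrow> real" where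
  "energy_form \<theta> u w = (LINT x|lebesgue_on \<Omega>. \<theta> x * energy_density u w x)"

text \<open>The displacements are quantified inside the almost-everywhere statement: C0 is bounded
  off a single null set, which thus serves all of them and in particular all members of a sequence
  at once.\<close>

lemma energy_density_bound:
  obtains C where "C \<ge> 0"
    "AE x in lebesgue_on \<Omega>. \<forall>u w a b. u \<in> PA \<longrightarrow> w \<in> PA \<longrightarrow>
        (\<forall>y\<in>closure \<Omega>. norm (u y) \<le> a) \<longrightarrow> (\<forall>y\<in>closure \<Omega>. norm (w y) \<le> b) \<longrightarrow> \<bar>energy_density u w x\<bar> \<le> C * a * b"
proof -
  obtain M where M: "AE x in lebesgue_on \<Omega>. \<forall>i j k l. \<bar>C0 P x i j k l\<bar> \<le> M"
    using elasticity by (auto simp: elasticity_field_def)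
  obtain C where C: "C \<ge> 0" "\<And>(u :: real ^ 'd \<Rightarrow> real ^ 'd) e x. u \<in> PA \<Longrightarrow> (\<And>x. x \<in> closure \<Omega> \<Longrightarrow> norm (u x) \<le> e) \<Longrightarrow> x \<in> mesh_int \<Longrightarrow>
       norm (sym_cgrad u x) \<le> C * e" using sym_cgrad_bound by metis
  obtain y0 where y0: "y0 \<in> closure \<Omega>" using Omega_nonempty closure_subset by blast
  show ?thesis
  proof (rule that[of "real CARD('d) ^ 4 * \<bar>M\<bar> * C * C"])
    show "AE x in lebesgue_on \<Omega>. \<forall>u w a b. u \<in> PA \<longrightarrow> w \<in> PA \<longrightarrow>
        (\<forall>y\<in>closure \<Omega>. norm (u y) \<le> a) \<longrightarrow> (\<forall>y\<in>closure \<Omega>. norm (w y) \<le> b) \<longrightarrow>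
        \<bar>energy_density u w x\<bar> \<le> real CARD('d) ^ 4 * \<bar>M\<bar> * C * C * a * b"
      using M AE_mesh_int
    proof eventually_elim
      case (elim x)
      show ?case
      proof (intro allI impI)
        fix u w :: "real ^ 'd \<Rightarrow> real ^ 'd" and a b
        assume *: "u \<in> PA" "w \<in> PA" "\<forall>y\<in>closure \<Omega>. norm (u y) \<le> a" "\<forall>y\<in>closure \<Omega>. norm (w y) \<le> b"
        have a: "a \<ge> 0" using *(3) y0 norm_ge_zero order_trans by blast
        have n: "norm (sym_cgrad u x) \<le> C * a" "norm (sym_cgrad w x) \<le> C * b" using * elim by (auto intro!: C(2))
        have "\<bar>energy_density u w x\<bar> \<le> real CARD('d) ^ 4 * \<bar>M\<bar> * norm (sym_cgrad u x) * norm (sym_cgrad w x)"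
          unfolding energy_density_def by (rule tensor_app_inner_bound) (use elim(1) in \<open>auto intro: order_trans[OF _ abs_ge_self]\<close>)
        also have "\<dots> \<le> real CARD('d) ^ 4 * \<bar>M\<bar> * (C * a) * (C * b)"
          using n a C(1) by (intro mult_mono) auto
        finally show "\<bar>energy_density u w x\<bar> \<le> real CARD('d) ^ 4 * \<bar>M\<bar> * C * C * a * b" by (simp add: mult_ac)
      qed
    qed
  qed (use C in simp)
qed

lemma energy_density_measurable:
  assumes u: "u \<in> PA" and w: "w \<in> PA" shows "energy_density u w \<in> borel_measurable (lebesgue_on \<Omega>)"
proof -
  have C: "(\<lambda>x. C0 P x i j k l) \<in> borel_measurable (lebesgue_on \<Omega>)" for i j k l
    using elasticity by (auto simp: elasticity_field_def)
  have "(\<lambda>x. sym_cgrad z x $ i $ j) \<in> borel_measurable (lebesgue_on \<Omega>)" if "z \<in> PA" for z i j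
    by (rule measurable_if_const_on_mesh) (use sym_cgrad_const_on_mesh[OF that] in metis)
  then show ?thesis unfolding energy_density_def[abs_def] tensor_app_inner
    by (intro borel_measurable_sum borel_measurable_times C) (use u w in auto)
qed

lemma bounded_measurable_em:
  assumes u: "u \<in> PA" and w: "w \<in> PA" shows "bounded_measurable (energy_density u w)"
proof -
  obtain a where a: "\<And>x. x \<in> closure \<Omega> \<Longrightarrow> norm (u x) \<le> a" using PA_bounded[OF u] by metis
  obtain b where b: "\<And>x. x \<in> closure \<Omega> \<Longrightarrow> norm (w x) \<le> b" using PA_bounded[OF w] by metis
  obtain C where "AE x in lebesgue_on \<Omega>. \<forall>u w a b. u \<in> PA \<longrightarrow> w \<in> PA \<longrightarrow>
        (\<forall>y\<in>closure \<Omega>. norm (u y) \<le> a) \<longrightarrow> (\<forall>y\<in>closure \<Omega>. norm (w y) \<le> b) \<longrightarrow> \<bar>energy_density u w x\<bar> \<le> C * a * b"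
    using energy_density_bound by blast
  then have "AE x in lebesgue_on \<Omega>. \<bar>energy_density u w x\<bar> \<le> C * a * b"
    by eventually_elim (use u w a b in blast)
  then show ?thesis using energy_density_measurable[OF u w] by (auto simp: bounded_measurable_def)
qed

lemma energy_density_lincomb_left:
  assumes "u \<in> PA" "u' \<in> PA" "x \<in> mesh_int"
  shows "energy_density (\<lambda>x. a *\<^sub>R u x + c *\<^sub>R u' x) w x = a * energy_density u w x + c * energy_density u' w x"
  unfolding energy_density_def sym_cgrad_lincomb[OF assms] tensor_app_lincomb by (simp add: inner_add_left)

lemma energy_density_swap: "AE x in lebesgue_on \<Omega>. \<forall>u w. energy_density u w x = energy_density w u x"
proof -
  have "AE x in lebesgue_on \<Omega>. \<forall>i j k l. C0 P x i j k l = C0 P x j i k l \<and> C0 P x i j k l = C0 P x k l i j"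
    using elasticity by (auto simp: elasticity_field_def)
  then show ?thesis
    by eventually_elim (auto simp: energy_density_def intro!: tensor_app_inner_swap)
qed

lemma energy_density_elliptic: "AE x in lebesgue_on \<Omega>. \<forall>u. energy_density u u x \<ge> xi0 P * (norm (sym_cgrad u x))\<^sup>2"
proof -
  have "AE x in lebesgue_on \<Omega>. \<forall>A. tensor_app (C0 P x) (sym_part A) \<bullet> sym_part A \<ge> xi0 P * (norm (sym_part A))\<^sup>2"
    using elasticity by (auto simp: elasticity_field_def)
  then show ?thesis by eventually_elim (simp add: energy_density_def sym_cgrad_def)
qed

lemma xi0_pos: "xi0 P > 0" using elasticity by (simp add: elasticity_field_def)

lemma energy_form_lincomb_left:
  assumes \<theta>: "bounded_measurable \<theta>" and u: "u \<in> PA" "u' \<in> PA" and w: "w \<in> PA"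
  shows "energy_form \<theta> (\<lambda>x. a *\<^sub>R u x + c *\<^sub>R u' x) w = a * energy_form \<theta> u w + c * energy_form \<theta> u' w"
proof -
  have "energy_form \<theta> (\<lambda>x. a *\<^sub>R u x + c *\<^sub>R u' x) w = (LINT x|lebesgue_on \<Omega>. a * (\<theta> x * energy_density u w x) + c * (\<theta> x * energy_density u' w x))"
    unfolding energy_form_def
    by (rule lebesgue_on_integral_cong_AE[OF dom_sets AE_domI]) (simp add: energy_density_lincomb_left[OF u] algebra_simps)
  also have "\<dots> = a * energy_form \<theta> u w + c * energy_form \<theta> u' w"
    unfolding energy_form_def
    by (subst Bochner_Integration.integral_add)
      (use bounded_measurable_integrable[OF bounded_measurable_mult[OF \<theta> bounded_measurable_em]] u w in auto)
  finally show ?thesis .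
qed

lemma energy_form_swap: "energy_form \<theta> u w = energy_form \<theta> w u"
  unfolding energy_form_def
  by (rule lebesgue_on_integral_cong_AE[OF dom_sets]) (use energy_density_swap in \<open>eventually_elim, auto\<close>)

lemma energy_form_lincomb_right:
  assumes "bounded_measurable \<theta>" "u \<in> PA" "u' \<in> PA" "w \<in> PA"
  shows "energy_form \<theta> w (\<lambda>x. a *\<^sub>R u x + c *\<^sub>R u' x) = a * energy_form \<theta> w u + c * energy_form \<theta> w u'"
  using energy_form_lincomb_left[OF assms] energy_form_swap by metis

lemma energy_form_bound:
  obtains C where "C \<ge> 0"
    "\<And>\<theta> t u w a b. bounded_measurable \<theta> \<Longrightarrow> (\<And>x. x \<in> \<Omega> \<Longrightarrow> \<bar>\<theta> x\<bar> \<le> t) \<Longrightarrow> u \<in> PA \<Longrightarrow> w \<in> PA \<Longrightarrow>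
        (\<And>y. y \<in> closure \<Omega> \<Longrightarrow> norm (u y) \<le> a) \<Longrightarrow> (\<And>y. y \<in> closure \<Omega> \<Longrightarrow> norm (w y) \<le> b) \<Longrightarrow>
        \<bar>energy_form \<theta> u w\<bar> \<le> C * t * a * b"
proof -
  obtain C where C: "C \<ge> 0" "AE x in lebesgue_on \<Omega>. \<forall>u w a b. u \<in> PA \<longrightarrow> w \<in> PA \<longrightarrow>
        (\<forall>y\<in>closure \<Omega>. norm (u y) \<le> a) \<longrightarrow> (\<forall>y\<in>closure \<Omega>. norm (w y) \<le> b) \<longrightarrow> \<bar>energy_density u w x\<bar> \<le> C * a * b"
    using energy_density_bound by blast
  define m where "m = measure (lebesgue_on \<Omega>) \<Omega>"
  show ?thesis
  proof (rule that[of "C * m"])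
    show "C * m \<ge> 0" using C by (simp add: m_def)
    fix \<theta> t a b and u w :: "real ^ 'd \<Rightarrow> real ^ 'd"
    assume \<theta>: "bounded_measurable \<theta>" "\<And>x. x \<in> \<Omega> \<Longrightarrow> \<bar>\<theta> x\<bar> \<le> t" and u: "u \<in> PA" and w: "w \<in> PA"
      and a: "\<And>y. y \<in> closure \<Omega> \<Longrightarrow> norm (u y) \<le> a" and b: "\<And>y. y \<in> closure \<Omega> \<Longrightarrow> norm (w y) \<le> b"
    have i: "integrable (lebesgue_on \<Omega>) (\<lambda>x. \<theta> x * energy_density u w x)" by (intro bounded_measurable_integrable bounded_measurable_mult \<theta> bounded_measurable_em u w)
    have "\<bar>energy_form \<theta> u w\<bar> \<le> (LINT x|lebesgue_on \<Omega>. \<bar>\<theta> x * energy_density u w x\<bar>)"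
      unfolding energy_form_def by (rule integral_abs_bound)
    also have "\<dots> \<le> (LINT x|lebesgue_on \<Omega>. t * (C * a * b))"
    proof (rule integral_mono_AE)
      show "AE x in lebesgue_on \<Omega>. \<bar>\<theta> x * energy_density u w x\<bar> \<le> t * (C * a * b)"
        using C(2) AE_space
      proof eventually_elim
        case (elim x)
        then have "\<bar>energy_density u w x\<bar> \<le> C * a * b" using u w a b by blast
        moreover have "\<bar>\<theta> x\<bar> \<le> t" using elim \<theta> by simp
        ultimately show ?case unfolding abs_mult by (intro mult_mono) auto
      qed
    qed (use i in auto)
    also have "\<dots> = C * m * t * a * b" by (simp add: m_def)
    finally show "\<bar>energy_form \<theta> u w\<bar> \<le> C * m * t * a * b" .
  qed
qed

text \<open>Uniform convergence of the displacements gives pointwise convergence of their gradients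
  off the skeleton, and the sup bounds supply a constant dominating function. For the weights
  pointwise convergence is enough.\<close>

lemma energy_form_tendsto:
  assumes \<theta>n: "\<And>n. bounded_measurable (\<theta>n n)" "\<And>n x. x \<in> \<Omega> \<Longrightarrow> \<bar>\<theta>n n x\<bar> \<le> t"
    and \<theta>: "bounded_measurable \<theta>" "\<And>x. x \<in> \<Omega> \<Longrightarrow> (\<lambda>n. \<theta>n n x) \<longlonglongrightarrow> \<theta> x"
    and U: "\<And>n. U n \<in> PA" "u \<in> PA" "uniform_limit (closure \<Omega>) U u sequentially"
    and W: "\<And>n. W n \<in> PA" "w \<in> PA" "uniform_limit (closure \<Omega>) W w sequentially"
    and a: "\<And>n y. y \<in> closure \<Omega> \<Longrightarrow> norm (U n y) \<le> a" and b: "\<And>n y. y \<in> closure \<Omega> \<Longrightarrow> norm (W n y) \<le> b"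
  shows "(\<lambda>n. energy_form (\<theta>n n) (U n) (W n)) \<longlonglongrightarrow> energy_form \<theta> u w"
proof -
  obtain C where C: "C \<ge> 0" "AE x in lebesgue_on \<Omega>. \<forall>u w a b. u \<in> PA \<longrightarrow> w \<in> PA \<longrightarrow>
        (\<forall>y\<in>closure \<Omega>. norm (u y) \<le> a) \<longrightarrow> (\<forall>y\<in>closure \<Omega>. norm (w y) \<le> b) \<longrightarrow> \<bar>energy_density u w x\<bar> \<le> C * a * b"
    using energy_density_bound by blast
  show ?thesis
    unfolding energy_form_def
  proof (rule integral_dominated_convergence[where w = "\<lambda>_. t * (C * a * b)"])
    show "(\<lambda>x. \<theta> x * energy_density u w x) \<in> borel_measurable (lebesgue_on \<Omega>)"
      using bounded_measurable_mult[OF \<theta>(1) bounded_measurable_em[OF U(2) W(2)]] by (simp add: bounded_measurable_def)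
    show "(\<lambda>x. \<theta>n n x * energy_density (U n) (W n) x) \<in> borel_measurable (lebesgue_on \<Omega>)" for n
      using bounded_measurable_mult[OF \<theta>n(1) bounded_measurable_em[OF U(1) W(1)]] by (simp add: bounded_measurable_def)
    show "integrable (lebesgue_on \<Omega>) (\<lambda>_. t * (C * a * b))" by simp
    show "AE x in lebesgue_on \<Omega>. (\<lambda>n. \<theta>n n x * energy_density (U n) (W n) x) \<longlonglongrightarrow> \<theta> x * energy_density u w x"
    proof (rule AE_domI)
      fix x assume x: "x \<in> \<Omega>" "x \<in> mesh_int"
      show "(\<lambda>n. \<theta>n n x * energy_density (U n) (W n) x) \<longlonglongrightarrow> \<theta> x * energy_density u w x"
        unfolding energy_density_def tensor_app_inner
        by (intro tendsto_mult tendsto_sum tendsto_const tendsto_vec_nth \<theta>(2) x sym_cgrad_tendsto U W)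
    qed
    show "AE x in lebesgue_on \<Omega>. norm (\<theta>n n x * energy_density (U n) (W n) x) \<le> t * (C * a * b)" for n
      using C(2) AE_space
    proof eventually_elim
      case (elim x)
      then have "\<bar>energy_density (U n) (W n) x\<bar> \<le> C * a * b" using U W a b by blast
      moreover have "\<bar>\<theta>n n x\<bar> \<le> t" using elim \<theta>n by simp
      ultimately show ?case unfolding real_norm_def abs_mult by (intro mult_mono) auto
    qed
  qed
qed

text \<open>Ellipticity makes the density nonnegative, so the integrand is monotone in the
  weight.\<close>

lemma energy_form_mono:
  assumes \<theta>: "bounded_measurable \<theta>" "\<And>x. x \<in> \<Omega> \<Longrightarrow> m \<le> \<theta> x" and u: "u \<in> PA"
  shows "m * energy_form (\<lambda>_. 1) u u \<le> energy_form \<theta> u u"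
proof -
  have "m * energy_form (\<lambda>_. 1) u u = (LINT x|lebesgue_on \<Omega>. m * energy_density u u x)" by (simp add: energy_form_def)
  also have "\<dots> \<le> energy_form \<theta> u u"
    unfolding energy_form_def
  proof (rule integral_mono_AE)
    show "AE x in lebesgue_on \<Omega>. m * energy_density u u x \<le> \<theta> x * energy_density u u x"
      using energy_density_elliptic AE_space
    proof eventually_elim
      case (elim x)
      then have "energy_density u u x \<ge> 0" using xi0_pos by (meson mult_nonneg_nonneg less_imp_le order_trans zero_le_power2)
      then show ?case using \<theta>(2) elim by (intro mult_right_mono) auto
    qed
  qed (intro bounded_measurable_integrable bounded_measurable_mult bounded_measurable_const \<theta> bounded_measurable_em u)+
  finally show ?thesis .
qed

lemma energy_form_nonneg: "u \<in> PA \<Longrightarrow> 0 \<le> energy_form (\<lambda>_. 1) u u"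
  using energy_form_mono[of "\<lambda>_. 1" 0 u] bounded_measurable_const by simp

lemma energy_form_zero_imp_sg_zero:
  assumes u: "u \<in> PA" and z: "energy_form (\<lambda>_. 1) u u = 0"
  shows "AE x in lebesgue_on \<Omega>. sym_cgrad u x = 0"
proof -
  have nn: "AE x in lebesgue_on \<Omega>. 0 \<le> energy_density u u x"
    using energy_density_elliptic
    by eventually_elim (meson mult_nonneg_nonneg less_imp_le order_trans zero_le_power2 xi0_pos)
  have "AE x in lebesgue_on \<Omega>. energy_density u u x = 0"
    using integral_nonneg_eq_0_iff_AE[OF bounded_measurable_integrable[OF bounded_measurable_em[OF u u]] nn] z by (simp add: energy_form_def)
  then show ?thesis
    using energy_density_elliptic
  proof eventually_elim
    case (elim x)
    then have "xi0 P * (norm (sym_cgrad u x))\<^sup>2 \<le> 0" by metis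
    then show ?case using xi0_pos by (simp add: mult_le_0_iff)
  qed
qed

section \<open>Korn's inequality on the discrete spaces\<close>

lemma PA_attains_max:
  fixes u :: "real ^ 'd \<Rightarrow> 'b::real_normed_vector"
  assumes u: "u \<in> PA"
  obtains y where "y \<in> closure \<Omega>" "\<And>x. x \<in> closure \<Omega> \<Longrightarrow> norm (u x) \<le> norm (u y)"
proof -
  have "closure \<Omega> \<noteq> {}" using Omega_nonempty by simp
  from continuous_attains_sup[OF compact_closure_dom this continuous_on_norm[OF PA_continuous[OF u]]]
  show ?thesis using that by blast
qed

text \<open>Korn's inequality with the sup norm on the left. The weight 1 is sufficient because
  every weight \<open>theta v\<close> with v in \<open>Kh P h\<close> is at least
  \<open>min 1 (delta P)\<close>.\<close>

definition coercive_const :: "(real ^ 'd) set \<Rightarrow> real \<Rightarrow> bool" where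
  "coercive_const S \<kappa> \<longleftrightarrow> \<kappa> > 0 \<and> (\<forall>u\<in>PA0 S. \<forall>x\<in>closure \<Omega>. (norm (u x))\<^sup>2 \<le> \<kappa> * energy_form (\<lambda>_. 1) u u)"

text \<open>Counterexamples scaled to sup norm 1, attained at the points \<open>Y (r n)\<close>,
  have energy at most 1 / (n + 1). A uniform limit of a subsequence has zero energy and hence
  vanishes, which contradicts the value 1 at these points.\<close>

lemma korn:
  assumes S: "essential_part S" shows "\<exists>\<kappa>. coercive_const S \<kappa>"
proof (rule ccontr)
  assume "\<not> ?thesis"
  then have "\<exists>u x. u \<in> PA0 S \<and> x \<in> closure \<Omega> \<and> (norm (u x))\<^sup>2 > real (Suc n) * energy_form (\<lambda>_. 1) u u" for n
    unfolding coercive_const_def by (metis not_le of_nat_0_less_iff zero_less_Suc)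
  then obtain U X where U: "\<And>n. U n \<in> PA0 S" "\<And>n. X n \<in> closure \<Omega>"
    "\<And>n. (norm (U n (X n)))\<^sup>2 > real (Suc n) * energy_form (\<lambda>_. 1) (U n) (U n)" by metis
  have UPA: "U n \<in> PA" for n by (rule PA0_PA[OF U(1)])
  have "\<exists>y. y \<in> closure \<Omega> \<and> (\<forall>x\<in>closure \<Omega>. norm (U n x) \<le> norm (U n y))" for n
    using PA_attains_max[OF UPA[of n]] by metis
  then obtain Y where Y: "\<And>n. Y n \<in> closure \<Omega>" "\<And>n x. x \<in> closure \<Omega> \<Longrightarrow> norm (U n x) \<le> norm (U n (Y n))" by metis
  define M where "M n = norm (U n (Y n))" for n
  have M2: "real (Suc n) * energy_form (\<lambda>_. 1) (U n) (U n) < (M n)\<^sup>2" for n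
  proof -
    have "(norm (U n (X n)))\<^sup>2 \<le> (M n)\<^sup>2" unfolding M_def by (rule power_mono[OF Y(2)[OF U(2)]]) simp
    then show ?thesis using U(3)[of n] by linarith
  qed
  have Mpos: "M n > 0" for n
  proof -
    have "0 \<le> real (Suc n) * energy_form (\<lambda>_. 1) (U n) (U n)" using energy_form_nonneg[OF UPA] by simp
    then have "(M n)\<^sup>2 > 0" using M2[of n] by linarith
    then show ?thesis by (simp add: M_def)
  qed
  define W where "W n x = (1 / M n) *\<^sub>R U n x" for n x
  have W: "W n \<in> PA0 S" for n
    using PA0_lincomb[OF U(1)[of n] U(1)[of n], of "1 / M n" 0] by (simp add: W_def[abs_def])
  have WPA: "W n \<in> PA" for n by (rule PA0_PA[OF W])
  have Wb: "norm (W n x) \<le> 1" if "x \<in> closure \<Omega>" for n x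
    using Y(2)[OF that, of n] Mpos[of n] by (simp add: W_def M_def divide_le_eq_1)
  have WY: "norm (W n (Y n)) = 1" for n using Mpos[of n] by (simp add: W_def) (simp add: M_def)
  have I3W: "energy_form (\<lambda>_. 1) (W n) (W n) \<le> 1 / real (Suc n)" for n
  proof -
    have Weq: "(\<lambda>x. (1 / M n) *\<^sub>R U n x + 0 *\<^sub>R U n x) = W n" by (simp add: W_def[abs_def])
    have "energy_form (\<lambda>_. 1) (W n) (W n) = (1 / M n) * energy_form (\<lambda>_. 1) (U n) (W n)"
      using energy_form_lincomb_left[OF bounded_measurable_const UPA[of n] UPA[of n] WPA[of n], of 1 "1 / M n" 0] unfolding Weq by simp
    also have "energy_form (\<lambda>_. 1) (U n) (W n) = (1 / M n) * energy_form (\<lambda>_. 1) (U n) (U n)"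
      using energy_form_lincomb_right[OF bounded_measurable_const UPA[of n] UPA[of n] UPA[of n], of 1 "1 / M n" 0] unfolding Weq by simp
    finally have "energy_form (\<lambda>_. 1) (W n) (W n) = (1 / M n) * ((1 / M n) * energy_form (\<lambda>_. 1) (U n) (U n))" .
    also have "\<dots> = energy_form (\<lambda>_. 1) (U n) (U n) / (M n)\<^sup>2" by (simp add: power2_eq_square)
    also have "\<dots> \<le> 1 / real (Suc n)"
      using M2[of n] Mpos[of n] by (simp add: divide_le_eq le_divide_eq mult.commute)
    finally show ?thesis .
  qed
  obtain r w where r: "strict_mono (r :: nat \<Rightarrow> nat)" "w \<in> PA"
    "uniform_limit (closure \<Omega>) (\<lambda>n. W (r n)) w sequentially"
    using PA_compact[of W 1, OF WPA Wb] by blast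
  have wV: "w \<in> PA0 S" by (rule PA0_closed[OF S W r(3)])
  have "(\<lambda>n. energy_form (\<lambda>_. 1) (W (r n)) (W (r n))) \<longlonglongrightarrow> energy_form (\<lambda>_. 1) w w"
    by (rule energy_form_tendsto[where t = 1 and a = 1 and b = 1]) (use bounded_measurable_const WPA r Wb in auto)
  moreover have "(\<lambda>n. 1 / real (Suc (r n))) \<longlonglongrightarrow> 0"
    using LIMSEQ_subseq_LIMSEQ[OF LIMSEQ_Suc[OF lim_1_over_n] r(1)] by (simp add: comp_def)
  ultimately have "energy_form (\<lambda>_. 1) w w \<le> 0"
    by (rule LIMSEQ_le) (use I3W in blast)
  then have "energy_form (\<lambda>_. 1) w w = 0" using energy_form_nonneg[OF r(2)] by simp
  then have w0: "w x = 0" if "x \<in> closure \<Omega>" for x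
    using rigid_kernel[OF S wV energy_form_zero_imp_sg_zero[OF r(2)] that] by simp
  have "\<forall>\<^sub>F n in sequentially. \<forall>x\<in>closure \<Omega>. dist (W (r n) x) (w x) < 1 / 2"
    by (rule uniform_limitD[OF r(3)]) simp
  then obtain n where "\<forall>x\<in>closure \<Omega>. dist (W (r n) x) (w x) < 1 / 2"
    by (auto simp: eventually_sequentially)
  then have "dist (W (r n) (Y (r n))) (w (Y (r n))) < 1 / 2" using Y(1) by blast
  then show False using w0[OF Y(1)] WY by simp
qed

subsection \<open>Galerkin solutions\<close>

lemma galerkin_energy_lower:
  assumes \<kappa>: "coercive_const S \<kappa>" and \<theta>: "bounded_measurable \<theta>" "\<And>x. x \<in> \<Omega> \<Longrightarrow> m \<le> \<theta> x" and m: "m > 0"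
    and u: "u \<in> PA0 S" and x: "x \<in> closure \<Omega>"
  shows "m * (norm (u x))\<^sup>2 \<le> \<kappa> * energy_form \<theta> u u"
proof -
  have "m * (norm (u x))\<^sup>2 \<le> m * (\<kappa> * energy_form (\<lambda>_. 1) u u)"
    using \<kappa> u x m unfolding coercive_const_def by (intro mult_left_mono) auto
  also have "\<dots> = \<kappa> * (m * energy_form (\<lambda>_. 1) u u)" by algebra
  also have "\<dots> \<le> \<kappa> * energy_form \<theta> u u"
    using energy_form_mono[OF \<theta> PA0_PA[OF u]] \<kappa> by (intro mult_left_mono) (auto simp: coercive_const_def)
  finally show ?thesis .
qed

text \<open>Test the equation with the solution and evaluate coercivity at a point where its norm is
  maximal: a square on the left, a linear term on the right.\<close>

lemma galerkin_bound:
  assumes \<kappa>: "coercive_const S \<kappa>" and \<theta>: "bounded_measurable \<theta>" "\<And>x. x \<in> \<Omega> \<Longrightarrow> m \<le> \<theta> x" and m: "m > 0"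
    and w: "w \<in> PA0 S" and eq: "energy_form \<theta> w w = F w"
    and F: "\<And>M. (\<And>x. x \<in> closure \<Omega> \<Longrightarrow> norm (w x) \<le> M) \<Longrightarrow> \<bar>F w\<bar> \<le> B * M" and B: "B \<ge> 0"
    and x: "x \<in> closure \<Omega>"
  shows "norm (w x) \<le> \<kappa> * B / m"
proof -
  obtain y where y: "y \<in> closure \<Omega>" "\<And>x. x \<in> closure \<Omega> \<Longrightarrow> norm (w x) \<le> norm (w y)"
    using PA_attains_max[OF PA0_PA[OF w]] by blast
  have k: "\<kappa> > 0" using \<kappa> by (simp add: coercive_const_def)
  have "m * (norm (w y))\<^sup>2 \<le> \<kappa> * F w" using galerkin_energy_lower[OF \<kappa> \<theta> m w y(1)] eq by simp
  also have "\<dots> \<le> \<kappa> * (B * norm (w y))" using F[OF y(2)] k by (intro mult_left_mono) auto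
  finally have *: "m * (norm (w y))\<^sup>2 \<le> \<kappa> * B * norm (w y)" by simp
  have "norm (w y) \<le> \<kappa> * B / m"
  proof (cases "norm (w y) = 0")
    case True then show ?thesis using k B m by simp
  next
    case False
    then have "norm (w y) * (m * norm (w y)) \<le> norm (w y) * (\<kappa> * B)"
      using * by (simp add: power2_eq_square mult_ac)
    then have "m * norm (w y) \<le> \<kappa> * B" using False by simp
    then show ?thesis using m by (simp add: le_divide_eq mult.commute)
  qed
  then show ?thesis using y(2)[OF x] by linarith
qed

lemma uniform_limit_norm_le:
  assumes "uniform_limit X U u sequentially" "x \<in> X" "\<And>n. norm (U n x) \<le> R"
  shows "norm (u x) \<le> R"
  by (rule LIMSEQ_le_const2[OF tendsto_norm[OF tendsto_uniform_limitI[OF assms(1,2)]]]) (use assms(3) in blast)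

text \<open>The solution minimises the energy Q. A minimiser over a sup-norm ball exists by
  compactness, and the radius is large enough to make it a global one, so that the first variation
  vanishes.\<close>

lemma galerkin_exists:
  assumes S: "essential_part S" and \<theta>: "bounded_measurable \<theta>" "\<And>x. x \<in> \<Omega> \<Longrightarrow> \<bar>\<theta> x\<bar> \<le> t" "\<And>x. x \<in> \<Omega> \<Longrightarrow> m \<le> \<theta> x"
    and m: "m > 0" and B: "B \<ge> 0"
    and Flin: "\<And>\<phi> \<psi> a c. \<phi> \<in> PA0 S \<Longrightarrow> \<psi> \<in> PA0 S \<Longrightarrow> F (\<lambda>x. a *\<^sub>R \<phi> x + c *\<^sub>R \<psi> x) = a * F \<phi> + c * F \<psi>"
    and Fb: "\<And>\<phi> M. \<phi> \<in> PA0 S \<Longrightarrow> (\<And>x. x \<in> closure \<Omega> \<Longrightarrow> norm (\<phi> x) \<le> M) \<Longrightarrow> \<bar>F \<phi>\<bar> \<le> B * M"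
  shows "\<exists>w\<in>PA0 S. \<forall>\<phi>\<in>PA0 S. energy_form \<theta> w \<phi> = F \<phi>"
proof -
  obtain \<kappa> where \<kappa>: "coercive_const S \<kappa>" using korn[OF S] by blast
  have k: "\<kappa> > 0" using \<kappa> by (simp add: coercive_const_def)
  define Q where "Q w = energy_form \<theta> w w / 2 - F w" for w
  \<comment> \<open>If the sup norm M of y exceeds R, then m M is at least 2 \<kappa> B. Coercivity
    then gives energy at least 2 B M, so Q y is nonnegative, whereas Q vanishes at 0.\<close>
  define R where "R = 2 * \<kappa> * B / m"
  have R0: "R \<ge> 0" using k B m by (simp add: R_def)
  define X where "X = {w \<in> PA0 S. \<forall>x\<in>closure \<Omega>. norm (w x) \<le> R}"
  have zX: "(\<lambda>_. 0) \<in> X" using PA0_zero R0 by (simp add: X_def)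
  have Q0: "Q (\<lambda>_. 0) = 0"
    using energy_form_lincomb_left[OF \<theta>(1) PA0_PA[OF PA0_zero] PA0_PA[OF PA0_zero] PA0_PA[OF PA0_zero], of 0 0]
      Flin[OF PA0_zero PA0_zero, of 0 0] by (simp add: Q_def)
  have "\<exists>w\<in>X. \<forall>y\<in>X. Q w \<le> Q y"
  proof (rule exists_minimizer_seq)
    show "X \<noteq> {}" using zX by blast
    fix f :: "nat \<Rightarrow> real ^ 'd \<Rightarrow> real ^ 'd" assume f: "\<And>n. f n \<in> X"
    have fV: "f n \<in> PA0 S" and fb: "x \<in> closure \<Omega> \<Longrightarrow> norm (f n x) \<le> R" for n x using f by (auto simp: X_def)
    obtain r w where r: "strict_mono (r :: nat \<Rightarrow> nat)" "w \<in> PA" "uniform_limit (closure \<Omega>) (\<lambda>n. f (r n)) w sequentially"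
      using PA_compact[of f R, OF PA0_PA[OF fV] fb] by blast
    have wV: "w \<in> PA0 S" by (rule PA0_closed[OF S fV r(3)])
    have "norm (w x) \<le> R" if "x \<in> closure \<Omega>" for x
      by (rule uniform_limit_norm_le[OF r(3) that]) (rule fb[OF that])
    then have wX: "w \<in> X" using wV by (simp add: X_def)
    have I: "(\<lambda>n. energy_form \<theta> (f (r n)) (f (r n))) \<longlonglongrightarrow> energy_form \<theta> w w"
      by (rule energy_form_tendsto[where t = t and a = R and b = R]) (use \<theta> PA0_PA[OF fV] r fb in auto)
    have Fl: "(\<lambda>n. F (f (r n))) \<longlonglongrightarrow> F w"
    proof (rule tendstoI)
      fix e :: real assume e: "e > 0"
      then have "e / (B + 1) > 0" using B by simp
      from uniform_limitD[OF r(3) this] show "\<forall>\<^sub>F n in sequentially. dist (F (f (r n))) (F w) < e"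
      proof eventually_elim
        case (elim n)
        let ?d = "\<lambda>x. 1 *\<^sub>R f (r n) x + (-1) *\<^sub>R w x"
        have "\<bar>F ?d\<bar> \<le> B * (e / (B + 1))"
          by (rule Fb[OF PA0_lincomb[OF fV wV]]) (use elim in \<open>auto simp: dist_norm intro: less_imp_le\<close>)
        also have "\<dots> < e" using e B by (simp add: field_simps)
        finally show ?case using Flin[OF fV wV, of 1 "r n" "-1"] by (simp add: dist_real_def)
      qed
    qed
    have "(\<lambda>n. Q (f (r n))) \<longlonglongrightarrow> Q w" unfolding Q_def by (intro tendsto_intros I Fl) simp
    then show "\<exists>r w. strict_mono r \<and> w \<in> X \<and> (\<lambda>n. Q (f (r n))) \<longlonglongrightarrow> Q w" using r(1) wX by blast
  qed
  then obtain w where w: "w \<in> X" "\<And>y. y \<in> X \<Longrightarrow> Q w \<le> Q y" by blast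
  have wV: "w \<in> PA0 S" using w(1) by (simp add: X_def)
  have min: "Q w \<le> Q y" if y: "y \<in> PA0 S" for y
  proof (cases "y \<in> X")
    case False
    then obtain x0 where x0: "x0 \<in> closure \<Omega>" "norm (y x0) > R" using y by (auto simp: X_def not_le)
    obtain z where z: "z \<in> closure \<Omega>" "\<And>x. x \<in> closure \<Omega> \<Longrightarrow> norm (y x) \<le> norm (y z)"
      using PA_attains_max[OF PA0_PA[OF y]] by blast
    define M where "M = norm (y z)"
    have MR: "M > R" using z(2)[OF x0(1)] x0(2) by (simp add: M_def)
    have "m * M \<ge> 2 * \<kappa> * B" using MR m by (simp add: R_def divide_less_eq mult.commute less_imp_le)
    then have "2 * \<kappa> * B * M \<le> m * M * M" using MR R0 by (intro mult_right_mono) auto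
    also have "\<dots> \<le> \<kappa> * energy_form \<theta> y y"
      using galerkin_energy_lower[OF \<kappa> \<theta>(1,3) m y z(1)] by (simp add: M_def power2_eq_square mult.assoc)
    finally have "\<kappa> * (2 * (B * M)) \<le> \<kappa> * energy_form \<theta> y y" by (simp add: mult_ac)
    then have "2 * (B * M) \<le> energy_form \<theta> y y" using k by simp
    moreover have "\<bar>F y\<bar> \<le> B * M" using Fb[OF y z(2)] by (simp add: M_def)
    ultimately have "0 \<le> Q y" unfolding Q_def by linarith
    then show ?thesis using w(2)[OF zX] Q0 by linarith
  qed (rule w(2))
  have var: "0 \<le> s * (energy_form \<theta> w \<phi> - F \<phi>) + s\<^sup>2 * (energy_form \<theta> \<phi> \<phi> / 2)" if \<phi>: "\<phi> \<in> PA0 S" for \<phi> s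
  proof -
    let ?y = "\<lambda>x. 1 *\<^sub>R w x + s *\<^sub>R \<phi> x"
    have yV: "?y \<in> PA0 S" by (rule PA0_lincomb[OF wV \<phi>])
    note PA = PA0_PA[OF wV] PA0_PA[OF \<phi>] PA0_PA[OF yV]
    have "energy_form \<theta> ?y ?y = energy_form \<theta> w ?y + s * energy_form \<theta> \<phi> ?y"
      using energy_form_lincomb_left[OF \<theta>(1) PA(1,2,3), of 1 s] by simp
    also have "energy_form \<theta> w ?y = energy_form \<theta> w w + s * energy_form \<theta> w \<phi>"
      using energy_form_lincomb_right[OF \<theta>(1) PA(1,2,1), of 1 s] by simp
    also have "energy_form \<theta> \<phi> ?y = energy_form \<theta> w \<phi> + s * energy_form \<theta> \<phi> \<phi>"
      using energy_form_lincomb_right[OF \<theta>(1) PA(1,2,2), of 1 s] energy_form_swap[of \<theta> \<phi> w] by simp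
    finally have "energy_form \<theta> ?y ?y = energy_form \<theta> w w + s * energy_form \<theta> w \<phi> + s * (energy_form \<theta> w \<phi> + s * energy_form \<theta> \<phi> \<phi>)" .
    moreover have "F ?y = F w + s * F \<phi>" using Flin[OF wV \<phi>, of 1 s] by simp
    ultimately have "Q ?y = Q w + (s * (energy_form \<theta> w \<phi> - F \<phi>) + s\<^sup>2 * (energy_form \<theta> \<phi> \<phi> / 2))"
      by (simp add: Q_def field_simps power2_eq_square)
    then show ?thesis using min[OF yV] by linarith
  qed
  have "energy_form \<theta> w \<phi> = F \<phi>" if \<phi>: "\<phi> \<in> PA0 S" for \<phi>
  proof (rule antisym)
    \<comment> \<open>The space is linear, so variations of both signs are allowed and the
      inequality becomes an equation.\<close>
    have "0 \<le> - (energy_form \<theta> w \<phi> - F \<phi>)"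
    proof (rule first_variation_nonneg)
      fix s :: real
      show "0 \<le> s * - (energy_form \<theta> w \<phi> - F \<phi>) + s\<^sup>2 * (energy_form \<theta> \<phi> \<phi> / 2)"         using var[OF \<phi>, of "- s"] by (simp only: mult_minus_left mult_minus_right power2_minus)
    qed
    then show "energy_form \<theta> w \<phi> \<le> F \<phi>" by simp
    have "0 \<le> energy_form \<theta> w \<phi> - F \<phi>" by (rule first_variation_nonneg) (rule var[OF \<phi>])
    then show "F \<phi> \<le> energy_form \<theta> w \<phi>" by simp
  qed
  then show ?thesis using wV by blast
qed

text \<open>The scalar factor by which C_delta(v) differs from C0, owing to C1 =
  \<open>delta P\<close> times C0.\<close>

definition theta :: "(real ^ 'd \<Rightarrow> real) \<Rightarrow> real ^ 'd \<Rightarrow> real" where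
  "theta v x = 1 + (delta P - 1) * v x"

lemma tensor_app_scale: "tensor_app (\<lambda>i j k l. c * C i j k l) A = c *\<^sub>R tensor_app C A"
  by (simp add: tensor_app_def vec_eq_iff sum_distrib_left mult.assoc)

lemma elastic_form_eq:
  assumes u: "u \<in> PA" and w: "w \<in> PA" shows "elastic_form P v u w = energy_form (theta v) u w"
  unfolding elastic_form_def energy_form_def
proof (rule lebesgue_on_integral_cong_AE[OF dom_sets])
  have "C_delta P v x = (\<lambda>i j k l. theta v x * C0 P x i j k l)" for x
    by (intro ext) (simp add: C_delta_def C_diff_def C1_def theta_def algebra_simps)
  then have "tensor_app (C_delta P v x) A = theta v x *\<^sub>R tensor_app (C0 P x) A" for x A
    by (simp add: tensor_app_scale)
  then have "tensor_app (C_delta P v x) A \<bullet> B = theta v x * (tensor_app (C0 P x) A \<bullet> B)" for x A B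
    by simp
  note * = this
  show "AE x in lebesgue_on \<Omega>. tensor_app (C_delta P v x) (sym_grad \<Omega> u x) \<bullet> sym_grad \<Omega> w x = theta v x * energy_density u w x"
    using sym_grad_eq_sg[OF u] sym_grad_eq_sg[OF w] by eventually_elim (simp add: energy_density_def *)
qed

lemma shape_term_eq:
  assumes u: "u \<in> PA" shows "shape_term P \<eta> u = (delta P - 1) * (LINT x|lebesgue_on \<Omega>. \<eta> x * energy_density u u x)"
proof -
  have "C_diff P x = (\<lambda>i j k l. (delta P - 1) * C0 P x i j k l)" for x
    by (intro ext) (simp add: C_diff_def C1_def algebra_simps)
  then have "tensor_app (C_diff P x) A = (delta P - 1) *\<^sub>R tensor_app (C0 P x) A" for x A
    by (simp add: tensor_app_scale)
  then have *: "tensor_app (C_diff P x) A \<bullet> B = (delta P - 1) * (tensor_app (C0 P x) A \<bullet> B)" for x A B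
    by simp
  have "shape_term P \<eta> u = (LINT x|lebesgue_on \<Omega>. (delta P - 1) * (\<eta> x * energy_density u u x))"
    unfolding shape_term_def
    by (rule lebesgue_on_integral_cong_AE[OF dom_sets])
      (use sym_grad_eq_sg[OF u] in \<open>eventually_elim, simp add: energy_density_def *\<close>)
  then show ?thesis by simp
qed

subsection \<open>The discrete phase-field functions\<close>

lemma Kh_PA: "v \<in> Kh P h \<Longrightarrow> v \<in> PA"
  by (simp add: Kh_def Vh_eq)

lemma Kh_iff:
  "v \<in> Kh P h \<longleftrightarrow> v \<in> PA \<and> (AE x in lebesgue_on \<Omega>. 0 \<le> v x \<and> v x \<le> 1) \<and>
     (AE x in lebesgue_on (boundary_layer P). v x = 0)"
  using PA_H1 by (auto simp: Kh_def Vh_eq K_def)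

text \<open>The constraints are imposed almost everywhere; continuity upgrades them to every point
  of the closure.\<close>

lemma Kh_range:
  assumes v: "v \<in> Kh P h" and x: "x \<in> closure \<Omega>" shows "0 \<le> v x" "v x \<le> 1"
proof -
  have "v x \<in> {0..1}"
    by (rule AE_closed_imp_closure[OF PA_continuous[OF Kh_PA[OF v]] _ _ x]) (use v in \<open>auto simp: Kh_iff\<close>)
  then show "0 \<le> v x" "v x \<le> 1" by auto
qed

lemma Kh_abs: "v \<in> Kh P h \<Longrightarrow> x \<in> closure \<Omega> \<Longrightarrow> norm (v x) \<le> 1"
  using Kh_range by fastforce

lemma Kh_convex:
  assumes v: "v \<in> Kh P h" and w: "w \<in> Kh P h" and t: "0 \<le> t" "t \<le> 1"
  shows "(\<lambda>x. v x + t * (w x - v x)) \<in> Kh P h"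
proof -
  have eq: "v x + t * (w x - v x) = (1 - t) * v x + t * w x" for x by algebra
  have "(\<lambda>x. v x + t * (w x - v x)) \<in> PA"
    unfolding eq by (rule PA_lincomb_real[OF Kh_PA[OF v] Kh_PA[OF w]])
  moreover have "AE x in lebesgue_on \<Omega>. 0 \<le> v x + t * (w x - v x) \<and> v x + t * (w x - v x) \<le> 1"
  proof (rule AE_domI)
    fix x assume "x \<in> \<Omega>"
    then have "x \<in> closure \<Omega>" using closure_subset by blast
    note r = Kh_range[OF v this] Kh_range[OF w this]
    have "(1 - t) * v x + t * w x \<le> (1 - t) * 1 + t * 1" using r t by (intro add_mono mult_left_mono) auto
    then show "0 \<le> v x + t * (w x - v x) \<and> v x + t * (w x - v x) \<le> 1"
      unfolding eq using r t by simp
  qed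
  moreover have "AE x in lebesgue_on (boundary_layer P). v x = 0" "AE x in lebesgue_on (boundary_layer P). w x = 0"
    using v w by (auto simp: Kh_iff)
  then have "AE x in lebesgue_on (boundary_layer P). v x + t * (w x - v x) = 0"
    by eventually_elim simp
  ultimately show ?thesis by (simp add: Kh_iff)
qed

lemma Kh_closed:
  assumes V: "\<And>n. V n \<in> Kh P h" and lim: "uniform_limit (closure \<Omega>) V v sequentially"
  shows "v \<in> Kh P h"
proof -
  have pw: "(\<lambda>n. V n x) \<longlonglongrightarrow> v x" if "x \<in> closure \<Omega>" for x by (rule tendsto_uniform_limitI[OF lim that])
  have "v \<in> PA" by (rule PA_closed[OF Kh_PA[OF V] lim])
  moreover have "AE x in lebesgue_on \<Omega>. 0 \<le> v x \<and> v x \<le> 1"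
  proof (rule AE_domI)
    fix x assume "x \<in> \<Omega>"
    then have x: "x \<in> closure \<Omega>" using closure_subset by blast
    show "0 \<le> v x \<and> v x \<le> 1"
      using LIMSEQ_le_const[OF pw[OF x], of 0] LIMSEQ_le_const2[OF pw[OF x], of 1] Kh_range[OF V x] by blast
  qed
  moreover have "AE x in lebesgue_on (boundary_layer P). v x = 0"
  proof -
    have "AE x in lebesgue_on (boundary_layer P). \<forall>n. V n x = 0"
      using V by (subst AE_all_countable) (auto simp: Kh_iff)
    moreover have "AE x in lebesgue_on (boundary_layer P). x \<in> boundary_layer P"
      by (rule AE_I2) (simp add: space_restrict_space)
    ultimately show ?thesis
    proof eventually_elim
      case (elim x)
      then have "x \<in> closure \<Omega>" using closure_subset by (auto simp: boundary_layer_def)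
      from pw[OF this] elim show ?case by (simp add: LIMSEQ_const_iff)
    qed
  qed
  ultimately show ?thesis by (simp add: Kh_iff)
qed

lemma Kh_compact:
  assumes V: "\<And>n. V n \<in> Kh P h"
  obtains r v where "strict_mono (r :: nat \<Rightarrow> nat)" "v \<in> Kh P h"
    "uniform_limit (closure \<Omega>) (\<lambda>n. V (r n)) v sequentially"
proof -
  obtain r v where r: "strict_mono (r :: nat \<Rightarrow> nat)" "uniform_limit (closure \<Omega>) (\<lambda>n. V (r n)) v sequentially"
    using PA_compact[of V 1, OF Kh_PA[OF V] Kh_abs[OF V]] by blast
  show ?thesis by (rule that[OF r(1) Kh_closed[OF V r(2)] r(2)])
qed

text \<open>\<open>theta v x\<close> is the convex combination of 1 and \<open>delta P\<close> with
  weight v x.\<close>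

lemma theta_bounds:
  assumes v: "v \<in> Kh P h" and x: "x \<in> \<Omega>"
  shows "min 1 (delta P) \<le> theta v x" "\<bar>theta v x\<bar> \<le> 1 + delta P"
proof -
  have "x \<in> closure \<Omega>" using x closure_subset by blast
  note r = Kh_range[OF v this]
  have eq: "theta v x = (1 - v x) * 1 + v x * delta P" by (simp add: theta_def algebra_simps)
  have "min 1 (delta P) = (1 - v x) * min 1 (delta P) + v x * min 1 (delta P)" by (simp add: algebra_simps)
  also have "\<dots> \<le> theta v x" unfolding eq using r by (intro add_mono mult_left_mono) auto
  finally show *: "min 1 (delta P) \<le> theta v x" .
  have "theta v x \<le> 1 * 1 + 1 * delta P" unfolding eq using r delta_pos by (intro add_mono mult_right_mono) auto
  then show "\<bar>theta v x\<bar> \<le> 1 + delta P" using * delta_pos by (simp add: abs_le_iff min_def split: if_splits)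
qed

lemma theta_min_pos: "min 1 (delta P) > 0" using delta_pos by simp

lemma bounded_measurable_theta: "v \<in> PA \<Longrightarrow> bounded_measurable (theta v)"
  unfolding theta_def[abs_def] by (intro bounded_measurable_add bounded_measurable_mult bounded_measurable_const bounded_measurable_PA)

subsection \<open>The discrete displacements\<close>

lemma solves_N_iff:
  "solves_N P h v u \<longleftrightarrow> u \<in> PA0 (SigmaD P) \<and> (\<forall>\<phi>\<in>PA0 (SigmaD P). energy_form (theta v) u \<phi> = ell \<phi>)"
  unfolding solves_N_def Vh_SigmaD_eq ell_def using elastic_form_eq PA0_PA by (metis (no_types, lifting))

lemma solves_D_PA: "(\<lambda>x. u x - lifting_h P h x) \<in> PA0 S \<Longrightarrow> u \<in> PA"
  using PA_add[OF PA0_PA lifting_PA] by fastforce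

text \<open>Subtracting the lifting leads to a problem with zero boundary values, whose right-hand
  side is the form applied to the lifting. In this shape the Galerkin results apply.\<close>

lemma solves_D_iff:
  assumes v: "v \<in> PA"
  shows "solves_D P h v u \<longleftrightarrow> (\<lambda>x. u x - lifting_h P h x) \<in> PA0 (frontier \<Omega>) \<and>
    (\<forall>\<psi>\<in>PA0 (frontier \<Omega>). energy_form (theta v) (\<lambda>x. u x - lifting_h P h x) \<psi> = - energy_form (theta v) (lifting_h P h) \<psi>)"
proof -
  have "elastic_form P v u \<psi> = 0 \<longleftrightarrow>
      energy_form (theta v) (\<lambda>x. u x - lifting_h P h x) \<psi> = - energy_form (theta v) (lifting_h P h) \<psi>"
    if u: "u \<in> PA" and \<psi>: "\<psi> \<in> PA" for \<psi>
    using energy_form_lincomb_left[OF bounded_measurable_theta[OF v] u lifting_PA \<psi>, of 1 "-1"] elastic_form_eq[OF u \<psi>] by auto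
  then show ?thesis
    unfolding solves_D_def Vh_0_eq using solves_D_PA PA0_PA by (metis (no_types, lifting))
qed

text \<open>The constant does not depend on v, because \<open>theta v\<close> is bounded by
  \<open>1 + delta P\<close> uniformly over \<open>Kh P h\<close>.\<close>

lemma lifting_functional_bound:
  obtains B where "B \<ge> 0" "\<And>v \<phi> M. v \<in> Kh P h \<Longrightarrow> \<phi> \<in> PA \<Longrightarrow> (\<And>x. x \<in> closure \<Omega> \<Longrightarrow> norm (\<phi> x) \<le> M) \<Longrightarrow>
     \<bar>- energy_form (theta v) (lifting_h P h) \<phi>\<bar> \<le> B * M"
proof -
  obtain C where C: "C \<ge> 0"
    "\<And>\<theta> t u w a b. bounded_measurable \<theta> \<Longrightarrow> (\<And>x. x \<in> \<Omega> \<Longrightarrow> \<bar>\<theta> x\<bar> \<le> t) \<Longrightarrow> u \<in> PA \<Longrightarrow> w \<in> PA \<Longrightarrow>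
        (\<And>y. y \<in> closure \<Omega> \<Longrightarrow> norm (u y) \<le> a) \<Longrightarrow> (\<And>y. y \<in> closure \<Omega> \<Longrightarrow> norm (w y) \<le> b) \<Longrightarrow>
        \<bar>energy_form \<theta> u w\<bar> \<le> C * t * a * b" using energy_form_bound by blast
  obtain a where a: "a \<ge> 0" "\<And>x. x \<in> closure \<Omega> \<Longrightarrow> norm (lifting_h P h x) \<le> a" using PA_bounded[OF lifting_PA] by blast
  show ?thesis
  proof (rule that[of "C * (1 + delta P) * a"])
    show "C * (1 + delta P) * a \<ge> 0" using C a delta_pos by simp
    fix v M and \<phi> :: "real ^ 'd \<Rightarrow> real ^ 'd"
    assume "v \<in> Kh P h" "\<phi> \<in> PA" "\<And>x. x \<in> closure \<Omega> \<Longrightarrow> norm (\<phi> x) \<le> M"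
    then show "\<bar>- energy_form (theta v) (lifting_h P h) \<phi>\<bar> \<le> C * (1 + delta P) * a * M"
      using C(2)[OF bounded_measurable_theta[OF Kh_PA] theta_bounds(2) lifting_PA _ a(2)] by simp
  qed
qed

text \<open>The weight is bounded below by a positive constant, so a solution exists and the choice
  operator in \<open>uN\<close> selects one.\<close>

lemma uN_solves: assumes v: "v \<in> Kh P h" shows "solves_N P h v (uN P h v)"
proof -
  obtain B where B: "B \<ge> 0"     "\<And>\<phi> M. \<phi> \<in> PA \<Longrightarrow> (\<And>x. x \<in> closure \<Omega> \<Longrightarrow> norm (\<phi> x) \<le> M) \<Longrightarrow> \<bar>ell \<phi>\<bar> \<le> B * M"
    using ell_bound by blast
  have "\<exists>w\<in>PA0 (SigmaD P). \<forall>\<phi>\<in>PA0 (SigmaD P). energy_form (theta v) w \<phi> = ell \<phi>"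
    by (rule galerkin_exists[OF essential_parts(1) bounded_measurable_theta[OF Kh_PA[OF v]] theta_bounds(2,1)[OF v] theta_min_pos B(1)])
      (use B(2) ell_lincomb PA0_PA in blast)+
  then show ?thesis unfolding uN_def by (intro someI_ex[of "solves_N P h v"]) (auto simp: solves_N_iff)
qed

lemma uD_solves: assumes v: "v \<in> Kh P h" shows "solves_D P h v (uD P h v)"
proof -
  obtain B where B: "B \<ge> 0" "\<And>v \<phi> M. v \<in> Kh P h \<Longrightarrow> \<phi> \<in> PA \<Longrightarrow> (\<And>x. x \<in> closure \<Omega> \<Longrightarrow> norm (\<phi> x) \<le> M) \<Longrightarrow>
     \<bar>- energy_form (theta v) (lifting_h P h) \<phi>\<bar> \<le> B * M" using lifting_functional_bound by blast
  have "\<exists>w\<in>PA0 (frontier \<Omega>). \<forall>\<phi>\<in>PA0 (frontier \<Omega>). energy_form (theta v) w \<phi> = - energy_form (theta v) (lifting_h P h) \<phi>"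
  proof (rule galerkin_exists[OF essential_parts(2) bounded_measurable_theta[OF Kh_PA[OF v]] theta_bounds(2,1)[OF v] theta_min_pos B(1)])
    fix \<phi> \<psi> a c assume "\<phi> \<in> PA0 (frontier \<Omega>)" "\<psi> \<in> PA0 (frontier \<Omega>)"
    then show "- energy_form (theta v) (lifting_h P h) (\<lambda>x. a *\<^sub>R \<phi> x + c *\<^sub>R \<psi> x)
        = a * - energy_form (theta v) (lifting_h P h) \<phi> + c * - energy_form (theta v) (lifting_h P h) \<psi>"
      by (simp add: energy_form_lincomb_right[OF bounded_measurable_theta[OF Kh_PA[OF v]] PA0_PA PA0_PA lifting_PA])
  qed (use B(2)[OF v] PA0_PA in blast)+
  then obtain w where w: "w \<in> PA0 (frontier \<Omega>)" "\<forall>\<phi>\<in>PA0 (frontier \<Omega>). energy_form (theta v) w \<phi> = - energy_form (theta v) (lifting_h P h) \<phi>" by blast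
  have "solves_D P h v (\<lambda>x. w x + lifting_h P h x)"
    using w by (simp add: solves_D_iff[OF Kh_PA[OF v]])
  then show ?thesis unfolding uD_def by (rule someI[of "solves_D P h v"])
qed

lemma uN_PA: "v \<in> Kh P h \<Longrightarrow> uN P h v \<in> PA"
  using uN_solves[of v] PA0_PA by (auto simp: solves_N_iff)

lemma uD_PA: "v \<in> Kh P h \<Longrightarrow> uD P h v \<in> PA"
  using uD_solves[of v] solves_D_PA by (auto simp: solves_D_iff[OF Kh_PA])

lemma uN_bounded:
  obtains R where "R \<ge> 0" "\<And>v x. v \<in> Kh P h \<Longrightarrow> x \<in> closure \<Omega> \<Longrightarrow> norm (uN P h v x) \<le> R"
proof -
  obtain \<kappa> where \<kappa>: "coercive_const (SigmaD P) \<kappa>" using korn[OF essential_parts(1)] by blast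
  obtain B where B: "B \<ge> 0"     "\<And>\<phi> M. \<phi> \<in> PA \<Longrightarrow> (\<And>x. x \<in> closure \<Omega> \<Longrightarrow> norm (\<phi> x) \<le> M) \<Longrightarrow> \<bar>ell \<phi>\<bar> \<le> B * M"
    using ell_bound by blast
  show ?thesis
  proof (rule that[of "\<kappa> * B / min 1 (delta P)"])
    show "\<kappa> * B / min 1 (delta P) \<ge> 0" using \<kappa> B(1) theta_min_pos by (simp add: coercive_const_def)
    fix v x assume v: "v \<in> Kh P h" and x: "x \<in> closure \<Omega>"
    have s: "uN P h v \<in> PA0 (SigmaD P)" "energy_form (theta v) (uN P h v) (uN P h v) = ell (uN P h v)"
      using uN_solves[OF v] by (auto simp: solves_N_iff)
    show "norm (uN P h v x) \<le> \<kappa> * B / min 1 (delta P)"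
      by (rule galerkin_bound[where F = ell, OF \<kappa> bounded_measurable_theta[OF Kh_PA[OF v]] theta_bounds(1)[OF v] theta_min_pos s
            B(2)[OF PA0_PA[OF s(1)]] B(1) x])
  qed
qed

text \<open>Coercivity bounds the part with zero boundary values; adding the sup norm of the lifting
  bounds the displacement. Both bounds are kept because the compactness argument runs on the first
  part.\<close>

lemma uD_bounded:
  obtains R where "R \<ge> 0" "\<And>v x. v \<in> Kh P h \<Longrightarrow> x \<in> closure \<Omega> \<Longrightarrow> norm (uD P h v x) \<le> R"
    "\<And>v x. v \<in> Kh P h \<Longrightarrow> x \<in> closure \<Omega> \<Longrightarrow> norm (uD P h v x - lifting_h P h x) \<le> R"
proof -
  obtain \<kappa> where \<kappa>: "coercive_const (frontier \<Omega>) \<kappa>" using korn[OF essential_parts(2)] by blast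
  obtain B where B: "B \<ge> 0" "\<And>v \<phi> M. v \<in> Kh P h \<Longrightarrow> \<phi> \<in> PA \<Longrightarrow> (\<And>x. x \<in> closure \<Omega> \<Longrightarrow> norm (\<phi> x) \<le> M) \<Longrightarrow>
     \<bar>- energy_form (theta v) (lifting_h P h) \<phi>\<bar> \<le> B * M" using lifting_functional_bound by blast
  obtain a where a: "a \<ge> 0" "\<And>x. x \<in> closure \<Omega> \<Longrightarrow> norm (lifting_h P h x) \<le> a" using PA_bounded[OF lifting_PA] by blast
  define R where "R = \<kappa> * B / min 1 (delta P)"
  have R: "R \<ge> 0" unfolding R_def using \<kappa> B(1) theta_min_pos by (simp add: coercive_const_def)
  have w: "norm (uD P h v x - lifting_h P h x) \<le> R" if v: "v \<in> Kh P h" and x: "x \<in> closure \<Omega>" for v x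
  proof -
    let ?w = "\<lambda>x. uD P h v x - lifting_h P h x"
    have s: "?w \<in> PA0 (frontier \<Omega>)" "energy_form (theta v) ?w ?w = - energy_form (theta v) (lifting_h P h) ?w"
      using uD_solves[OF v] by (auto simp: solves_D_iff[OF Kh_PA[OF v]])
    show ?thesis
      unfolding R_def
      by (rule galerkin_bound[where F = "\<lambda>\<phi>. - energy_form (theta v) (lifting_h P h) \<phi>" and w = ?w,
            OF \<kappa> bounded_measurable_theta[OF Kh_PA[OF v]] theta_bounds(1)[OF v] theta_min_pos s
            B(2)[OF v PA0_PA[OF s(1)]] B(1) x])
  qed
  show ?thesis
  proof (rule that[of "R + a"])
    fix v x assume vx: "v \<in> Kh P h" "x \<in> closure \<Omega>"
    show "norm (uD P h v x) \<le> R + a"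
      using w[OF vx] a(2)[OF vx(2)] norm_triangle_ineq[of "uD P h v x - lifting_h P h x" "lifting_h P h x"] by simp
    show "norm (uD P h v x - lifting_h P h x) \<le> R + a" using w[OF vx] a(1) by simp
  qed (use R a in simp)
qed

text \<open>By compactness a subsequence of the solutions converges, its limit solves the limit
  problem, and coercivity forces this limit to agree with w on the closure.\<close>

lemma galerkin_tendsto:
  assumes S: "essential_part S" and V: "\<And>n. V n \<in> Kh P h" and v: "v \<in> Kh P h"
    and lim: "uniform_limit (closure \<Omega>) V v sequentially"
    and W: "\<And>n. W n \<in> PA0 S" "\<And>n x. x \<in> closure \<Omega> \<Longrightarrow> norm (W n x) \<le> R"
    and Weq: "\<And>n \<phi>. \<phi> \<in> PA0 S \<Longrightarrow> energy_form (theta (V n)) (W n) \<phi> = F n \<phi>"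
    and F: "\<And>\<phi>. \<phi> \<in> PA0 S \<Longrightarrow> (\<lambda>n. F n \<phi>) \<longlonglongrightarrow> F0 \<phi>"
    and w: "w \<in> PA0 S" and weq: "\<And>\<phi>. \<phi> \<in> PA0 S \<Longrightarrow> energy_form (theta v) w \<phi> = F0 \<phi>"
  obtains r where "strict_mono (r :: nat \<Rightarrow> nat)" "uniform_limit (closure \<Omega>) (\<lambda>n. W (r n)) w sequentially"
proof -
  obtain r w' where r: "strict_mono (r :: nat \<Rightarrow> nat)" "w' \<in> PA" "uniform_limit (closure \<Omega>) (\<lambda>n. W (r n)) w' sequentially"
    using PA_compact[of W R, OF PA0_PA[OF W(1)] W(2)] by blast
  have w': "w' \<in> PA0 S" by (rule PA0_closed[OF S W(1) r(3)])
  have eq: "energy_form (theta v) w' \<phi> = F0 \<phi>" if \<phi>: "\<phi> \<in> PA0 S" for \<phi>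
  proof -
    obtain b where b: "\<And>x. x \<in> closure \<Omega> \<Longrightarrow> norm (\<phi> x) \<le> b" using PA_bounded[OF PA0_PA[OF \<phi>]] by blast
    have "(\<lambda>n. energy_form (theta (V (r n))) (W (r n)) \<phi>) \<longlonglongrightarrow> energy_form (theta v) w' \<phi>"
    proof (rule energy_form_tendsto[where t = "1 + delta P" and a = R and b = b])
      fix x assume "x \<in> \<Omega>"
      then have x: "x \<in> closure \<Omega>" using closure_subset by blast
      have "(\<lambda>n. V (r n) x) \<longlonglongrightarrow> v x"
        using LIMSEQ_subseq_LIMSEQ[OF tendsto_uniform_limitI[OF lim x] r(1)] by (simp add: comp_def)
      then show "(\<lambda>n. theta (V (r n)) x) \<longlonglongrightarrow> theta v x" unfolding theta_def by (intro tendsto_intros)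
      show "\<bar>theta (V (r n)) x\<bar> \<le> 1 + delta P" for n by (rule theta_bounds(2)[OF V \<open>x \<in> \<Omega>\<close>])
    qed (use bounded_measurable_theta[OF Kh_PA[OF V]] bounded_measurable_theta[OF Kh_PA[OF v]] PA0_PA[OF W(1)] PA0_PA[OF \<phi>] W(2) r b in \<open>auto intro: uniform_limit_const\<close>)
    moreover have "(\<lambda>n. F (r n) \<phi>) \<longlonglongrightarrow> F0 \<phi>"
      using LIMSEQ_subseq_LIMSEQ[OF F[OF \<phi>] r(1)] by (simp add: comp_def)
    ultimately show ?thesis using LIMSEQ_unique Weq[OF \<phi>] by simp
  qed
  obtain \<kappa> where \<kappa>: "coercive_const S \<kappa>" using korn[OF S] by blast
  let ?d = "\<lambda>x. 1 *\<^sub>R w' x + (-1) *\<^sub>R w x"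
  have dV: "?d \<in> PA0 S" by (rule PA0_lincomb[OF w' w])
  have "energy_form (theta v) ?d ?d = 0"
    using energy_form_lincomb_left[OF bounded_measurable_theta[OF Kh_PA[OF v]] PA0_PA[OF w'] PA0_PA[OF w] PA0_PA[OF dV], of 1 "-1"]
      eq[OF dV] weq[OF dV] by simp
  then have d0: "norm (?d x) \<le> 0" if "x \<in> closure \<Omega>" for x
    using galerkin_energy_lower[OF \<kappa> bounded_measurable_theta[OF Kh_PA[OF v]] theta_bounds(1)[OF v] theta_min_pos dV that]
      theta_min_pos by (simp add: mult_le_0_iff)
  have "uniform_limit (closure \<Omega>) (\<lambda>n. W (r n)) w sequentially"
    by (rule uniform_limit_cong'[THEN iffD1, OF _ _ r(3)]) (use d0 in auto)
  with r(1) show ?thesis using that by blast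
qed

lemma uN_tendsto:
  assumes V: "\<And>n. V n \<in> Kh P h" and v: "v \<in> Kh P h" and lim: "uniform_limit (closure \<Omega>) V v sequentially"
  obtains r where "strict_mono (r :: nat \<Rightarrow> nat)"
    "uniform_limit (closure \<Omega>) (\<lambda>n. uN P h (V (r n))) (uN P h v) sequentially"
proof -
  obtain R where R: "R \<ge> 0" "\<And>v x. v \<in> Kh P h \<Longrightarrow> x \<in> closure \<Omega> \<Longrightarrow> norm (uN P h v x) \<le> R"
    using uN_bounded by blast
  have sol: "solves_N P h (V n) (uN P h (V n))" "solves_N P h v (uN P h v)" for n
    using uN_solves V v by auto
  show ?thesis
    by (rule galerkin_tendsto[OF essential_parts(1) V v lim, of "\<lambda>n. uN P h (V n)" R "\<lambda>_. ell" ell "uN P h v"])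
      (use sol R(2)[OF V] that in \<open>auto simp: solves_N_iff\<close>)
qed

lemma uD_tendsto:
  assumes V: "\<And>n. V n \<in> Kh P h" and v: "v \<in> Kh P h" and lim: "uniform_limit (closure \<Omega>) V v sequentially"
  obtains r where "strict_mono (r :: nat \<Rightarrow> nat)"
    "uniform_limit (closure \<Omega>) (\<lambda>n. uD P h (V (r n))) (uD P h v) sequentially"
proof -
  obtain R where "R \<ge> 0" "\<And>v x. v \<in> Kh P h \<Longrightarrow> x \<in> closure \<Omega> \<Longrightarrow> norm (uD P h v x) \<le> R"
    and R: "\<And>v x. v \<in> Kh P h \<Longrightarrow> x \<in> closure \<Omega> \<Longrightarrow> norm (uD P h v x - lifting_h P h x) \<le> R"
    using uD_bounded by metis
  have sol: "solves_D P h (V n) (uD P h (V n))" "solves_D P h v (uD P h v)" for n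
    using uD_solves V v by auto
  have F: "(\<lambda>n. - energy_form (theta (V n)) (lifting_h P h) \<phi>) \<longlonglongrightarrow> - energy_form (theta v) (lifting_h P h) \<phi>"
    if \<phi>: "\<phi> \<in> PA0 (frontier \<Omega>)" for \<phi>
  proof (rule tendsto_minus)
    obtain a where a: "\<And>x. x \<in> closure \<Omega> \<Longrightarrow> norm (lifting_h P h x) \<le> a" using PA_bounded[OF lifting_PA] by blast
    obtain b where b: "\<And>x. x \<in> closure \<Omega> \<Longrightarrow> norm (\<phi> x) \<le> b" using PA_bounded[OF PA0_PA[OF \<phi>]] by blast
    show "(\<lambda>n. energy_form (theta (V n)) (lifting_h P h) \<phi>) \<longlonglongrightarrow> energy_form (theta v) (lifting_h P h) \<phi>"
    proof (rule energy_form_tendsto[where t = "1 + delta P" and a = a and b = b])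
      fix x assume "x \<in> \<Omega>"
      then have x: "x \<in> closure \<Omega>" using closure_subset by blast
      show "(\<lambda>n. theta (V n) x) \<longlonglongrightarrow> theta v x"
        unfolding theta_def by (intro tendsto_intros tendsto_uniform_limitI[OF lim x])
      show "\<bar>theta (V n) x\<bar> \<le> 1 + delta P" for n by (rule theta_bounds(2)[OF V \<open>x \<in> \<Omega>\<close>])
    qed (use bounded_measurable_theta[OF Kh_PA[OF V]] bounded_measurable_theta[OF Kh_PA[OF v]] lifting_PA PA0_PA[OF \<phi>] a b in \<open>auto intro: uniform_limit_const\<close>)
  qed
  obtain r where r: "strict_mono (r :: nat \<Rightarrow> nat)"
    "uniform_limit (closure \<Omega>) (\<lambda>n x. uD P h (V (r n)) x - lifting_h P h x) (\<lambda>x. uD P h v x - lifting_h P h x) sequentially"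
    by (rule galerkin_tendsto[OF essential_parts(2) V v lim, of "\<lambda>n x. uD P h (V n) x - lifting_h P h x" R
        "\<lambda>n \<phi>. - energy_form (theta (V n)) (lifting_h P h) \<phi>" "\<lambda>\<phi>. - energy_form (theta v) (lifting_h P h) \<phi>" "\<lambda>x. uD P h v x - lifting_h P h x"])
      (use sol R[OF V] F in \<open>auto simp: solves_D_iff[OF Kh_PA[OF V]] solves_D_iff[OF Kh_PA[OF v]]\<close>)
  have "uniform_limit (closure \<Omega>) (\<lambda>n x. (uD P h (V (r n)) x - lifting_h P h x) + lifting_h P h x)
      (\<lambda>x. (uD P h v x - lifting_h P h x) + lifting_h P h x) sequentially"
    by (rule uniform_limit_add[OF r(2) uniform_limit_const])
  then show ?thesis using that r(1) by simp
qed

end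

subsection \<open>Convergence in \<open>W\<^sup>1\<^sup>,\<^sup>\<infinity>\<close>\<close>

lemma tendsto_zero_ennrealI:
  fixes f :: "'a \<Rightarrow> ennreal"
  assumes "\<And>e. e > 0 \<Longrightarrow> \<forall>\<^sub>F n in F. f n \<le> ennreal e"
  shows "(f \<longlongrightarrow> 0) F"
proof (rule order_tendstoI)
  fix a :: ennreal assume a: "0 < a"
  obtain e where e: "e > 0" "ennreal e < a"
  proof (cases a)
    case (real r)
    then have "ennreal (r / 2) < a" "r / 2 > 0" using a by (auto simp: ennreal_less_iff)
    then show ?thesis using that by blast
  next
    case top then show ?thesis using that[of 1] by simp
  qed
  from assms[OF e(1)] show "\<forall>\<^sub>F n in F. f n < a" by eventually_elim (use e(2) in auto)
qed auto

context mesh_domain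
begin

lemma W1inf_norm_bound:
  obtains C where "C \<ge> 0"
    "\<And>w e. w \<in> PA \<Longrightarrow> e \<ge> 0 \<Longrightarrow> (\<And>x. x \<in> closure \<Omega> \<Longrightarrow> \<bar>w x\<bar> \<le> e) \<Longrightarrow> W1inf_norm \<Omega> w \<le> ennreal (C * e)"
proof -
  obtain C where C: "C \<ge> 0" "\<And>(u :: real ^ 'd \<Rightarrow> real) e x. u \<in> PA \<Longrightarrow> (\<And>x. x \<in> closure \<Omega> \<Longrightarrow> \<bar>u x\<bar> \<le> e) \<Longrightarrow> x \<in> mesh_int \<Longrightarrow>
       norm (cgrad u x) \<le> C * e" using inverse_estimate by metis
  show ?thesis
  proof (rule that[of "1 + C"])
    fix w :: "real ^ 'd \<Rightarrow> real" and e :: real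
    assume w: "w \<in> PA" and e: "e \<ge> 0" and we: "\<And>x. x \<in> closure \<Omega> \<Longrightarrow> \<bar>w x\<bar> \<le> e"
    have "esssup (lebesgue_on \<Omega>) (\<lambda>x. ennreal \<bar>w x\<bar>) \<le> ennreal e"
    proof (rule esssup_I)
      show "(\<lambda>x. ennreal \<bar>w x\<bar>) \<in> borel_measurable (lebesgue_on \<Omega>)" using PA_measurable[OF w] by simp
      show "AE x in lebesgue_on \<Omega>. ennreal \<bar>w x\<bar> \<le> ennreal e"
        by (rule AE_domI) (use we closure_subset in \<open>blast intro: ennreal_leI\<close>)
    qed
    moreover have "esssup (lebesgue_on \<Omega>) (\<lambda>x. ennreal (norm (weak_grad \<Omega> w x))) \<le> ennreal (C * e)"
    proof (rule esssup_I)
      show "(\<lambda>x. ennreal (norm (weak_grad \<Omega> w x))) \<in> borel_measurable (lebesgue_on \<Omega>)"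
        using weak_grad_measurable[OF w] by simp
      show "AE x in lebesgue_on \<Omega>. ennreal (norm (weak_grad \<Omega> w x)) \<le> ennreal (C * e)"
        using weak_grad_eq_cgrad[OF w] AE_mesh_int
        by eventually_elim (use C(2)[OF w we] in \<open>auto intro: ennreal_leI\<close>)
    qed
    ultimately have "W1inf_norm \<Omega> w \<le> ennreal e + ennreal (C * e)" unfolding W1inf_norm_def by (rule add_mono)
    also have "\<dots> = ennreal ((1 + C) * e)" using e C(1) by (simp add: ennreal_plus[symmetric] algebra_simps del: ennreal_plus)
    finally show "W1inf_norm \<Omega> w \<le> ennreal ((1 + C) * e)" .
  qed (use C in simp)
qed

lemma W1inf_norm_tendsto:
  assumes V: "\<And>n. V n \<in> PA" and v: "v \<in> PA" and lim: "uniform_limit (closure \<Omega>) V v sequentially"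
  shows "(\<lambda>n. W1inf_norm \<Omega> (\<lambda>x. V n x - v x)) \<longlonglongrightarrow> 0"
proof (rule tendsto_zero_ennrealI)
  fix e :: real assume e: "e > 0"
  obtain C where C: "C \<ge> 0"
    "\<And>w e. w \<in> PA \<Longrightarrow> e \<ge> 0 \<Longrightarrow> (\<And>x. x \<in> closure \<Omega> \<Longrightarrow> \<bar>w x\<bar> \<le> e) \<Longrightarrow> W1inf_norm \<Omega> w \<le> ennreal (C * e)"
    using W1inf_norm_bound by blast
  have d: "e / (C + 1) > 0" using e C(1) by simp
  from uniform_limitD[OF lim d] show "\<forall>\<^sub>F n in sequentially. W1inf_norm \<Omega> (\<lambda>x. V n x - v x) \<le> ennreal e"
  proof eventually_elim
    case (elim n)
    have "W1inf_norm \<Omega> (\<lambda>x. V n x - v x) \<le> ennreal (C * (e / (C + 1)))"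
      by (rule C(2)[OF PA_diff[OF V v]]) (use d elim in \<open>auto simp: dist_real_def intro: less_imp_le\<close>)
    also have "\<dots> \<le> ennreal e" using e C(1) by (intro ennreal_leI) (simp add: field_simps)
    finally show ?case .
  qed
qed

lemma W1inf_norm_vec_bound:
  obtains C where "C \<ge> 0"
    "\<And>(u :: real ^ 'd \<Rightarrow> real ^ 'd) e. u \<in> PA \<Longrightarrow> e \<ge> 0 \<Longrightarrow> (\<And>x. x \<in> closure \<Omega> \<Longrightarrow> norm (u x) \<le> e) \<Longrightarrow>
        W1inf_norm_vec \<Omega> u \<le> ennreal (C * e)"
proof -
  obtain C where C: "C \<ge> 0" "\<And>(u :: real ^ 'd \<Rightarrow> real) e x. u \<in> PA \<Longrightarrow> (\<And>x. x \<in> closure \<Omega> \<Longrightarrow> \<bar>u x\<bar> \<le> e) \<Longrightarrow> x \<in> mesh_int \<Longrightarrow>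
       norm (cgrad u x) \<le> C * e" using inverse_estimate by metis
  define d where "d = real CARD('d)"
  show ?thesis
  proof (rule that[of "1 + d * (d * C)"])
    fix u :: "real ^ 'd \<Rightarrow> real ^ 'd" and e :: real
    assume u: "u \<in> PA" and e: "e \<ge> 0" and ue: "\<And>x. x \<in> closure \<Omega> \<Longrightarrow> norm (u x) \<le> e"
    have "esssup (lebesgue_on \<Omega>) (\<lambda>x. ennreal (norm (u x))) \<le> ennreal e"
    proof (rule esssup_I)
      show "(\<lambda>x. ennreal (norm (u x))) \<in> borel_measurable (lebesgue_on \<Omega>)" using PA_measurable[OF u] by simp
      show "AE x in lebesgue_on \<Omega>. ennreal (norm (u x)) \<le> ennreal e"
        by (rule AE_domI) (use ue closure_subset in \<open>blast intro: ennreal_leI\<close>)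
    qed
    moreover have "esssup (lebesgue_on \<Omega>) (\<lambda>x. ennreal (norm (weak_jacobian \<Omega> u x))) \<le> ennreal (d * (d * (C * e)))"
    proof -
      define D where "D x = (\<chi> i. cgrad (\<lambda>y. u y $ i) x)" for x
      have "AE x in lebesgue_on \<Omega>. \<forall>i. weak_grad \<Omega> (\<lambda>y. u y $ i) x = cgrad (\<lambda>y. u y $ i) x"
        by (subst AE_all_countable) (use weak_grad_eq_cgrad[OF PA_component[OF u]] in auto)
      then have ae: "AE x in lebesgue_on \<Omega>. D x = weak_jacobian \<Omega> u x"
        by eventually_elim (simp add: D_def weak_jacobian_def)
      have "D \<in> borel_measurable (lebesgue_on \<Omega>)"
      proof (rule measurable_if_const_on_mesh)
        fix T x y assume T: "T \<in> \<T>" "x \<in> interior T" "y \<in> interior T"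
        have "cgrad (\<lambda>z. u z $ i) x = cgrad (\<lambda>z. u z $ i) y" for i
          using PA_gradE[OF PA_component[OF u] T(1)] T by metis
        then show "D x = D y" unfolding D_def by simp
      qed
      then have meas: "weak_jacobian \<Omega> u \<in> borel_measurable (lebesgue_on \<Omega>)"
        by (rule lebesgue_on_borel_measurable_cong_AE[OF dom_sets]) (use ae in simp)
      show ?thesis
      proof (rule esssup_I)
        show "(\<lambda>x. ennreal (norm (weak_jacobian \<Omega> u x))) \<in> borel_measurable (lebesgue_on \<Omega>)" using meas by simp
        show "AE x in lebesgue_on \<Omega>. ennreal (norm (weak_jacobian \<Omega> u x)) \<le> ennreal (d * (d * (C * e)))"
          using ae AE_mesh_int
        proof eventually_elim
          case (elim x)
          have "norm (cgrad (\<lambda>y. u y $ i) x) \<le> C * e" for i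
            by (rule C(2)[OF PA_component[OF u] _ elim(2)]) (rule order_trans[OF component_le_norm_cart ue])
          then have "\<bar>D x $ i $ j\<bar> \<le> C * e" for i j
            unfolding D_def using component_le_norm_cart[of "cgrad (\<lambda>y. u y $ i) x" j] order_trans by simp blast
          from norm_matrix_le[OF this] show ?case using elim(1) by (intro ennreal_leI) (simp add: d_def)
        qed
      qed
    qed
    ultimately have "W1inf_norm_vec \<Omega> u \<le> ennreal e + ennreal (d * (d * (C * e)))"
      unfolding W1inf_norm_vec_def by (rule add_mono)
    also have "\<dots> = ennreal ((1 + d * (d * C)) * e)"
      using e C(1) by (simp add: ennreal_plus[symmetric] algebra_simps d_def del: ennreal_plus)
    finally show "W1inf_norm_vec \<Omega> u \<le> ennreal ((1 + d * (d * C)) * e)" .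
  qed (use C in \<open>simp add: d_def\<close>)
qed

end

context cavity
begin

text \<open>The sup bounds are uniform in v, and the inverse estimate extends them to the gradients.
  The norms are finite before \<open>enn2real\<close> is applied, so no infinite norm is hidden by
  its default value. This confines the arguments of the time step constant to a bounded
  square.\<close>

lemma displacement_norms_bounded:
  obtains R where "\<And>v. v \<in> Kh P h \<Longrightarrow> norm_uN P h v \<in> {0..R}" "\<And>v. v \<in> Kh P h \<Longrightarrow> norm_uD P h v \<in> {0..R}"
proof -
  obtain C where C: "C \<ge> 0"
    "\<And>(u :: real ^ 'd \<Rightarrow> real ^ 'd) e. u \<in> PA \<Longrightarrow> e \<ge> 0 \<Longrightarrow> (\<And>x. x \<in> closure \<Omega> \<Longrightarrow> norm (u x) \<le> e) \<Longrightarrow>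
        W1inf_norm_vec \<Omega> u \<le> ennreal (C * e)" using W1inf_norm_vec_bound by blast
  obtain RN where RN: "RN \<ge> 0" "\<And>v x. v \<in> Kh P h \<Longrightarrow> x \<in> closure \<Omega> \<Longrightarrow> norm (uN P h v x) \<le> RN"
    using uN_bounded by blast
  obtain RD where RD: "RD \<ge> 0" "\<And>v x. v \<in> Kh P h \<Longrightarrow> x \<in> closure \<Omega> \<Longrightarrow> norm (uD P h v x) \<le> RD"
    using uD_bounded by metis
  define R where "R = max (C * RN) (C * RD)"
  have "norm_uN P h v \<in> {0..R}" if v: "v \<in> Kh P h" for v
  proof -
    have "norm_uN P h v \<le> C * RN"
      unfolding norm_uN_def by (rule enn2real_leI[OF _ C(2)[OF uN_PA[OF v] RN(1) RN(2)[OF v]]]) (use C RN in simp)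
    then show ?thesis by (simp add: R_def norm_uN_def)
  qed
  moreover have "norm_uD P h v \<in> {0..R}" if v: "v \<in> Kh P h" for v
  proof -
    have "norm_uD P h v \<le> C * RD"
      unfolding norm_uD_def by (rule enn2real_leI[OF _ C(2)[OF uD_PA[OF v] RD(1) RD(2)[OF v]]]) (use C RD in simp)
    then show ?thesis by (simp add: R_def norm_uD_def)
  qed
  ultimately show ?thesis using that by blast
qed

text \<open>Every term of the energy is nonnegative except the boundary work, which does not depend
  on v.\<close>

lemma energy_bounded_below: obtains m where "\<And>v. v \<in> Kh P h \<Longrightarrow> m \<le> J P h v"
proof (rule that[of "- (LINT x|surface_on (SigmaN P). lifting_h P h x \<bullet> traction_h P h x)"])
  fix v assume v: "v \<in> Kh P h"
  have e0: "0 \<le> elastic_form P v u u" if u: "u \<in> PA" for u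
  proof -
    have "0 \<le> min 1 (delta P) * energy_form (\<lambda>_. 1) u u" using energy_form_nonneg[OF u] theta_min_pos by simp
    also have "\<dots> \<le> energy_form (theta v) u u" by (rule energy_form_mono[OF bounded_measurable_theta[OF Kh_PA[OF v]] theta_bounds(1)[OF v] u])
    finally show ?thesis by (simp add: elastic_form_eq[OF u u])
  qed
  have "0 \<le> (LINT x|lebesgue_on \<Omega>. epsilon P * (norm (weak_grad \<Omega> v x))\<^sup>2 + 1 / epsilon P * (v x * (1 - v x)))"
  proof (rule integral_nonneg_AE, rule AE_domI)
    fix x assume "x \<in> \<Omega>"
    then have "x \<in> closure \<Omega>" using closure_subset by blast
    from Kh_range[OF v this] show "0 \<le> epsilon P * (norm (weak_grad \<Omega> v x))\<^sup>2 + 1 / epsilon P * (v x * (1 - v x))"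
      using epsilon_pos by (intro add_nonneg_nonneg mult_nonneg_nonneg) auto
  qed
  then have "0 \<le> gam P * (LINT x|lebesgue_on \<Omega>. epsilon P * (norm (weak_grad \<Omega> v x))\<^sup>2 + 1 / epsilon P * (v x * (1 - v x)))"
    using gam_pos by simp
  then show "- (LINT x|surface_on (SigmaN P). lifting_h P h x \<bullet> traction_h P h x) \<le> J P h v"
    using e0[OF uN_PA[OF v]] e0[OF uD_PA[OF v]] unfolding J_def by linarith
qed

subsection \<open>The variational inequality of one step\<close>

text \<open>The explicit part of the scheme: everything evaluated at the old iterate, written as the
  coefficient of the direction. The factor (\<open>delta P\<close> - 1) / 2 is the scalar form of
  half of C1 - C0.\<close>

definition reaction :: "(real ^ 'd \<Rightarrow> real) \<Rightarrow> real ^ 'd \<Rightarrow> real" where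
  "reaction v x = (delta P - 1) / 2 * (energy_density (uD P h v) (uD P h v) x - energy_density (uN P h v) (uN P h v) x)
     + gam P / epsilon P * (1 - 2 * v x)"

text \<open>The left-hand side of the scheme in direction \<open>\<eta>\<close>, with \<open>s\<close> in place of \<open>1 / \<tau>\<close>; for \<open>s = 0\<close> and
  \<open>w = v\<close> it is the derivative of the energy.\<close>

definition variation :: "(real ^ 'd \<Rightarrow> real) \<Rightarrow> (real ^ 'd \<Rightarrow> real) \<Rightarrow> real \<Rightarrow> (real ^ 'd \<Rightarrow> real) \<Rightarrow> real" where
  "variation v w s \<eta> = (LINT x|lebesgue_on \<Omega>. s * ((w x - v x) * \<eta> x) + reaction v x * \<eta> x
     + 2 * gam P * epsilon P * (cgrad w x \<bullet> cgrad \<eta> x))"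

lemma bounded_measurable_bcoef: "v \<in> Kh P h \<Longrightarrow> bounded_measurable (reaction v)"
  unfolding reaction_def[abs_def] by (intro bounded_measurable_add bounded_measurable_mult bounded_measurable_diff bounded_measurable_const bounded_measurable_em bounded_measurable_PA uN_PA uD_PA Kh_PA)

lemma variation_eq:
  assumes v: "v \<in> Kh P h" and w: "w \<in> PA" and \<eta>: "\<eta> \<in> PA"
  shows "variation v w s \<eta> = s * (LINT x|lebesgue_on \<Omega>. (w x - v x) * \<eta> x)
    - 1/2 * shape_term P \<eta> (uN P h v) + 1/2 * shape_term P \<eta> (uD P h v)
    + 2 * gam P * epsilon P * (LINT x|lebesgue_on \<Omega>. weak_grad \<Omega> w x \<bullet> weak_grad \<Omega> \<eta> x)
    + gam P / epsilon P * (LINT x|lebesgue_on \<Omega>. (1 - 2 * v x) * \<eta> x)"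
proof -
  define f1 where "f1 x = (w x - v x) * \<eta> x" for x
  define f2 where "f2 x = \<eta> x * energy_density (uD P h v) (uD P h v) x" for x
  define f3 where "f3 x = \<eta> x * energy_density (uN P h v) (uN P h v) x" for x
  define f4 where "f4 x = (1 - 2 * v x) * \<eta> x" for x
  define f5 where "f5 x = cgrad w x \<bullet> cgrad \<eta> x" for x
  define k where "k = (delta P - 1) / 2"
  have i: "integrable (lebesgue_on \<Omega>) f1" "integrable (lebesgue_on \<Omega>) f2" "integrable (lebesgue_on \<Omega>) f3"
    "integrable (lebesgue_on \<Omega>) f4" "integrable (lebesgue_on \<Omega>) f5"
    unfolding f1_def[abs_def] f2_def[abs_def] f3_def[abs_def] f4_def[abs_def] f5_def[abs_def]
    by (intro bounded_measurable_integrable bounded_measurable_mult bounded_measurable_diff bounded_measurable_const bounded_measurable_em bounded_measurable_cgrad_inner bounded_measurable_PA uN_PA uD_PA v w \<eta> Kh_PA[OF v])+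
  have "variation v w s \<eta> = (LINT x|lebesgue_on \<Omega>. s * f1 x + (k * f2 x + ((- k) * f3 x
      + (gam P / epsilon P * f4 x + 2 * gam P * epsilon P * f5 x))))"
    unfolding variation_def reaction_def f1_def f2_def f3_def f4_def f5_def k_def
    by (intro Bochner_Integration.integral_cong refl) algebra
  also have "\<dots> = s * integral\<^sup>L (lebesgue_on \<Omega>) f1 + (k * integral\<^sup>L (lebesgue_on \<Omega>) f2 + ((- k) * integral\<^sup>L (lebesgue_on \<Omega>) f3
      + (gam P / epsilon P * integral\<^sup>L (lebesgue_on \<Omega>) f4 + 2 * gam P * epsilon P * integral\<^sup>L (lebesgue_on \<Omega>) f5)))"
    using i by simp
  also have "integral\<^sup>L (lebesgue_on \<Omega>) f5 = (LINT x|lebesgue_on \<Omega>. weak_grad \<Omega> w x \<bullet> weak_grad \<Omega> \<eta> x)"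
    unfolding f5_def
    by (rule lebesgue_on_integral_cong_AE[OF dom_sets])
      (use weak_grad_eq_cgrad[OF w] weak_grad_eq_cgrad[OF \<eta>] in \<open>eventually_elim, simp\<close>)
  finally show ?thesis
    by (simp add: shape_term_eq uN_PA uD_PA v k_def f1_def f2_def f3_def f4_def field_simps)
qed

lemma scheme_step_iff:
  assumes v: "v \<in> Kh P h"
  shows "scheme_step P h \<tau> v w \<longleftrightarrow> w \<in> Kh P h \<and> (\<forall>\<omega>\<in>Kh P h. variation v w (1 / \<tau>) (\<lambda>x. \<omega> x - w x) \<ge> 0)"
  unfolding scheme_step_def
  using variation_eq[OF v Kh_PA PA_diff[OF Kh_PA Kh_PA]] by auto

lemma J_deriv_eq:
  assumes v: "v \<in> Kh P h" and \<eta>: "\<eta> \<in> PA"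
  shows "J_deriv P h v \<eta> = variation v v 0 \<eta>"
  unfolding J_deriv_def variation_eq[OF v Kh_PA[OF v] \<eta>] by simp

text \<open>As for the energy density, one null set and one constant serve all phase fields; they
  provide the dominating function in the limits below.\<close>

lemma reaction_uniform_bound:
  obtains C where "C \<ge> 0" "AE x in lebesgue_on \<Omega>. \<forall>v\<in>Kh P h. \<bar>reaction v x\<bar> \<le> C"
proof -
  obtain C where C: "C \<ge> 0" "AE x in lebesgue_on \<Omega>. \<forall>u w a b. u \<in> PA \<longrightarrow> w \<in> PA \<longrightarrow>
        (\<forall>y\<in>closure \<Omega>. norm (u y) \<le> a) \<longrightarrow> (\<forall>y\<in>closure \<Omega>. norm (w y) \<le> b) \<longrightarrow> \<bar>energy_density u w x\<bar> \<le> C * a * b"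
    using energy_density_bound by blast
  obtain RN where RN: "RN \<ge> 0" "\<And>v x. v \<in> Kh P h \<Longrightarrow> x \<in> closure \<Omega> \<Longrightarrow> norm (uN P h v x) \<le> RN"
    using uN_bounded by blast
  obtain RD where RD: "RD \<ge> 0" "\<And>v x. v \<in> Kh P h \<Longrightarrow> x \<in> closure \<Omega> \<Longrightarrow> norm (uD P h v x) \<le> RD"
    using uD_bounded by metis
  define B where "B = \<bar>(delta P - 1) / 2\<bar> * (C * RD * RD + C * RN * RN) + gam P / epsilon P * 1"
  have "AE x in lebesgue_on \<Omega>. \<forall>v\<in>Kh P h. \<bar>reaction v x\<bar> \<le> B"
    using C(2) AE_space
  proof eventually_elim
    case (elim x)
    show ?case
    proof
      fix v assume v: "v \<in> Kh P h"
      have "x \<in> closure \<Omega>" using elim(2) closure_subset[of \<Omega>] by auto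
      then have "\<bar>1 - 2 * v x\<bar> \<le> 1" using Kh_range[OF v] by (simp add: abs_le_iff)
      then have 2: "\<bar>gam P / epsilon P * (1 - 2 * v x)\<bar> \<le> gam P / epsilon P * 1"
        using gam_pos epsilon_pos unfolding abs_mult by (intro mult_mono) auto
      have "\<bar>energy_density (uD P h v) (uD P h v) x\<bar> \<le> C * RD * RD" "\<bar>energy_density (uN P h v) (uN P h v) x\<bar> \<le> C * RN * RN"
        using elim(1) uD_PA[OF v] uN_PA[OF v] RD(2)[OF v] RN(2)[OF v] by blast+
      then have "\<bar>energy_density (uD P h v) (uD P h v) x - energy_density (uN P h v) (uN P h v) x\<bar> \<le> C * RD * RD + C * RN * RN" by linarith
      then have "\<bar>(delta P - 1) / 2 * (energy_density (uD P h v) (uD P h v) x - energy_density (uN P h v) (uN P h v) x)\<bar>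
          \<le> \<bar>(delta P - 1) / 2\<bar> * (C * RD * RD + C * RN * RN)"
        unfolding abs_mult by (rule mult_left_mono) simp
      then show "\<bar>reaction v x\<bar> \<le> B" unfolding reaction_def B_def using 2 by linarith
    qed
  qed
  moreover have "B \<ge> 0" unfolding B_def using C RN RD gam_pos epsilon_pos by simp
  ultimately show ?thesis using that by blast
qed

lemma Kh_cgrad_bound:
  obtains C where "C \<ge> 0" "\<And>v x. v \<in> Kh P h \<Longrightarrow> x \<in> mesh_int \<Longrightarrow> norm (cgrad v x) \<le> C"
proof -
  obtain C where C: "C \<ge> 0" "\<And>(u :: real ^ 'd \<Rightarrow> real) e x. u \<in> PA \<Longrightarrow> (\<And>x. x \<in> closure \<Omega> \<Longrightarrow> \<bar>u x\<bar> \<le> e) \<Longrightarrow> x \<in> mesh_int \<Longrightarrow>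
       norm (cgrad u x) \<le> C * e" using inverse_estimate by metis
  have "norm (cgrad v x) \<le> C" if "v \<in> Kh P h" "x \<in> mesh_int" for v x
    using C(2)[of v 1 x] Kh_PA[OF that(1)] Kh_abs[OF that(1)] that(2) by simp
  then show ?thesis using that C(1) by blast
qed

lemma Kh_diff_abs: "v \<in> Kh P h \<Longrightarrow> w \<in> Kh P h \<Longrightarrow> x \<in> closure \<Omega> \<Longrightarrow> \<bar>v x - w x\<bar> \<le> 1"
  using Kh_range[of v x] Kh_range[of w x] by (simp add: abs_le_iff)

lemma cgrad_diff:
  "u \<in> PA \<Longrightarrow> w \<in> PA \<Longrightarrow> x \<in> mesh_int \<Longrightarrow> cgrad (\<lambda>y. u y - w y) x = cgrad u x - cgrad w x"
  using cgrad_lincomb[of u w x 1 "-1"] by simp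

lemma reaction_tendsto:
  assumes V: "\<And>n. V n \<in> Kh P h" and v: "v \<in> Kh P h" and lim: "uniform_limit (closure \<Omega>) V v sequentially"
    and N: "uniform_limit (closure \<Omega>) (\<lambda>n. uN P h (V n)) (uN P h v) sequentially"
    and D: "uniform_limit (closure \<Omega>) (\<lambda>n. uD P h (V n)) (uD P h v) sequentially"
    and x: "x \<in> \<Omega>" "x \<in> mesh_int"
  shows "(\<lambda>n. reaction (V n) x) \<longlonglongrightarrow> reaction v x"
proof -
  have "x \<in> closure \<Omega>" using x closure_subset by blast
  note Vx = tendsto_uniform_limitI[OF lim this]
  have "(\<lambda>n. energy_density (U n) (U n) x) \<longlonglongrightarrow> energy_density u u x"
    if "\<And>n. U n \<in> PA" "u \<in> PA" "uniform_limit (closure \<Omega>) U u sequentially" for U u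
    unfolding energy_density_def tensor_app_inner
    by (intro tendsto_mult tendsto_sum tendsto_const tendsto_vec_nth sym_cgrad_tendsto x that)
  from this[OF uN_PA[OF V] uN_PA[OF v] N] this[OF uD_PA[OF V] uD_PA[OF v] D]
  show ?thesis unfolding reaction_def by (intro tendsto_intros Vx)
qed

text \<open>The inverse time steps need not converge. They are bounded, and old and new iterates
  have the same limit, so the time term disappears; the other terms converge by dominated
  convergence.\<close>

lemma variation_tendsto:
  assumes V: "\<And>n. V n \<in> Kh P h" and v: "v \<in> Kh P h" and lim: "uniform_limit (closure \<Omega>) V v sequentially"
    and N: "uniform_limit (closure \<Omega>) (\<lambda>n. uN P h (V n)) (uN P h v) sequentially"
    and D: "uniform_limit (closure \<Omega>) (\<lambda>n. uD P h (V n)) (uD P h v) sequentially"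
    and W: "\<And>n. W n \<in> Kh P h" "uniform_limit (closure \<Omega>) W v sequentially"
    and s: "\<And>n. \<bar>s n\<bar> \<le> B" and \<omega>: "\<omega> \<in> Kh P h"
  shows "(\<lambda>n. variation (V n) (W n) (s n) (\<lambda>x. \<omega> x - W n x)) \<longlonglongrightarrow> variation v v 0 (\<lambda>x. \<omega> x - v x)"
proof -
  obtain Cb where Cb: "Cb \<ge> 0" "AE x in lebesgue_on \<Omega>. \<forall>v\<in>Kh P h. \<bar>reaction v x\<bar> \<le> Cb" using reaction_uniform_bound by blast
  obtain Cg where Cg: "Cg \<ge> 0" "\<And>v x. v \<in> Kh P h \<Longrightarrow> x \<in> mesh_int \<Longrightarrow> norm (cgrad v x) \<le> Cg" using Kh_cgrad_bound by blast
  have ge: "gam P * epsilon P > 0" using gam_pos epsilon_pos by simp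
  note PAs = Kh_PA[OF V] Kh_PA[OF v] Kh_PA[OF W(1)] Kh_PA[OF \<omega>]
  have bm: "bounded_measurable (\<lambda>x. s * ((w x - v x) * (\<omega> x - w x)) + reaction v x * (\<omega> x - w x)
     + 2 * gam P * epsilon P * (cgrad w x \<bullet> cgrad (\<lambda>y. \<omega> y - w y) x))"
    if "v \<in> Kh P h" "w \<in> Kh P h" for v w s
    by (intro bounded_measurable_add bounded_measurable_mult bounded_measurable_diff bounded_measurable_const bounded_measurable_bcoef bounded_measurable_cgrad_inner bounded_measurable_PA PA_diff Kh_PA that \<omega>)
  define K where "K = B + Cb + 2 * gam P * epsilon P * (Cg * (Cg + Cg))"
  show ?thesis
    unfolding variation_def
  proof (rule integral_dominated_convergence[where w = "\<lambda>_. K"])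
    show "(\<lambda>x. 0 * ((v x - v x) * (\<omega> x - v x)) + reaction v x * (\<omega> x - v x)
       + 2 * gam P * epsilon P * (cgrad v x \<bullet> cgrad (\<lambda>y. \<omega> y - v y) x)) \<in> borel_measurable (lebesgue_on \<Omega>)"
      using bm[OF v v, of 0] unfolding bounded_measurable_def by blast
    show "(\<lambda>x. s n * ((W n x - V n x) * (\<omega> x - W n x)) + reaction (V n) x * (\<omega> x - W n x)
       + 2 * gam P * epsilon P * (cgrad (W n) x \<bullet> cgrad (\<lambda>y. \<omega> y - W n y) x)) \<in> borel_measurable (lebesgue_on \<Omega>)" for n
      using bm[OF V W(1), of "s n" n n] unfolding bounded_measurable_def by blast
    show "AE x in lebesgue_on \<Omega>. (\<lambda>n. s n * ((W n x - V n x) * (\<omega> x - W n x)) + reaction (V n) x * (\<omega> x - W n x)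
       + 2 * gam P * epsilon P * (cgrad (W n) x \<bullet> cgrad (\<lambda>y. \<omega> y - W n y) x)) \<longlonglongrightarrow>
       0 * ((v x - v x) * (\<omega> x - v x)) + reaction v x * (\<omega> x - v x)
       + 2 * gam P * epsilon P * (cgrad v x \<bullet> cgrad (\<lambda>y. \<omega> y - v y) x)"
    proof (rule AE_domI)
      fix x assume x: "x \<in> \<Omega>" "x \<in> mesh_int"
      then have xc: "x \<in> closure \<Omega>" using closure_subset by blast
      note Vx = tendsto_uniform_limitI[OF lim xc] and Wx = tendsto_uniform_limitI[OF W(2) xc]
      have g: "(\<lambda>n. cgrad (W n) x) \<longlonglongrightarrow> cgrad v x"
        by (rule tendsto_uniform_limitI[OF cgrad_uniform_limit[OF PAs(3,2) W(2)] x(2)])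
      have 1: "(\<lambda>n. s n * ((W n x - V n x) * (\<omega> x - W n x))) \<longlonglongrightarrow> 0"
      \<comment> \<open>Only the bound B on the coefficients enters; the difference of the iterates
        tends to zero at the point.\<close>
      proof (rule Lim_null_comparison)
        have "(\<lambda>n. B * \<bar>(W n x - V n x) * (\<omega> x - W n x)\<bar>) \<longlonglongrightarrow> B * \<bar>(v x - v x) * (\<omega> x - v x)\<bar>"
          by (intro tendsto_intros Vx Wx)
        then show "(\<lambda>n. B * \<bar>(W n x - V n x) * (\<omega> x - W n x)\<bar>) \<longlonglongrightarrow> 0" by simp
        show "\<forall>\<^sub>F n in sequentially. norm (s n * ((W n x - V n x) * (\<omega> x - W n x))) \<le> B * \<bar>(W n x - V n x) * (\<omega> x - W n x)\<bar>"
          using s by (intro always_eventually allI) (simp add: abs_mult mult_right_mono)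
      qed
      have 2: "(\<lambda>n. reaction (V n) x * (\<omega> x - W n x)) \<longlonglongrightarrow> reaction v x * (\<omega> x - v x)"
        by (intro tendsto_intros reaction_tendsto V v lim N D x Wx)
      have 3: "(\<lambda>n. 2 * gam P * epsilon P * (cgrad (W n) x \<bullet> cgrad (\<lambda>y. \<omega> y - W n y) x)) \<longlonglongrightarrow>
         2 * gam P * epsilon P * (cgrad v x \<bullet> cgrad (\<lambda>y. \<omega> y - v y) x)"
        unfolding cgrad_diff[OF PAs(4,3) x(2)] cgrad_diff[OF PAs(4,2) x(2)] by (intro tendsto_intros g)
      show "(\<lambda>n. s n * ((W n x - V n x) * (\<omega> x - W n x)) + reaction (V n) x * (\<omega> x - W n x)
       + 2 * gam P * epsilon P * (cgrad (W n) x \<bullet> cgrad (\<lambda>y. \<omega> y - W n y) x)) \<longlonglongrightarrow>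
       0 * ((v x - v x) * (\<omega> x - v x)) + reaction v x * (\<omega> x - v x)
       + 2 * gam P * epsilon P * (cgrad v x \<bullet> cgrad (\<lambda>y. \<omega> y - v y) x)"
        using tendsto_add[OF tendsto_add[OF 1 2] 3] by simp
    qed
    show "AE x in lebesgue_on \<Omega>. norm (s n * ((W n x - V n x) * (\<omega> x - W n x)) + reaction (V n) x * (\<omega> x - W n x)
       + 2 * gam P * epsilon P * (cgrad (W n) x \<bullet> cgrad (\<lambda>y. \<omega> y - W n y) x)) \<le> K" for n
      using Cb(2) AE_mesh_int AE_space
    proof eventually_elim
      case (elim x)
      have xc: "x \<in> closure \<Omega>" using elim(3) closure_subset[of \<Omega>] by auto
      have d: "\<bar>W n x - V n x\<bar> \<le> 1" "\<bar>\<omega> x - W n x\<bar> \<le> 1" using Kh_diff_abs V W(1) \<omega> xc by auto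
      have "\<bar>s n\<bar> * (\<bar>W n x - V n x\<bar> * \<bar>\<omega> x - W n x\<bar>) \<le> B * (1 * 1)"
        using d s[of n] by (intro mult_mono) (auto intro: order_trans[OF abs_ge_zero])
      then have 1: "\<bar>s n * ((W n x - V n x) * (\<omega> x - W n x))\<bar> \<le> B" by (simp add: abs_mult)
      have "\<bar>reaction (V n) x\<bar> * \<bar>\<omega> x - W n x\<bar> \<le> Cb * 1" using elim(1) V d Cb(1) by (intro mult_mono) auto
      then have 2: "\<bar>reaction (V n) x * (\<omega> x - W n x)\<bar> \<le> Cb" by (simp add: abs_mult)
      have "norm (cgrad \<omega> x - cgrad (W n) x) \<le> Cg + Cg"
        using Cg(2)[OF \<omega> elim(2)] Cg(2)[OF W(1) elim(2), of n] norm_triangle_ineq4[of "cgrad \<omega> x" "cgrad (W n) x"] by linarith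
      then have "norm (cgrad (W n) x) * norm (cgrad \<omega> x - cgrad (W n) x) \<le> Cg * (Cg + Cg)"
        using Cg(2)[OF W(1) elim(2), of n] Cg(1) by (intro mult_mono) auto
      then have "\<bar>cgrad (W n) x \<bullet> cgrad (\<lambda>y. \<omega> y - W n y) x\<bar> \<le> Cg * (Cg + Cg)"
        unfolding cgrad_diff[OF PAs(4,3) elim(2)] using Cauchy_Schwarz_ineq2 order_trans by blast
      then have 3: "\<bar>2 * gam P * epsilon P * (cgrad (W n) x \<bullet> cgrad (\<lambda>y. \<omega> y - W n y) x)\<bar>
          \<le> 2 * gam P * epsilon P * (Cg * (Cg + Cg))"
        using gam_pos epsilon_pos unfolding abs_mult[of "2 * gam P * epsilon P"] by (intro mult_mono) auto
      show ?case unfolding K_def real_norm_def using 1 2 3 by linarith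
    qed
  qed simp
qed

text \<open>The displacements are frozen at v, so the step is the first-order condition for
  minimising a quadratic functional over the convex set \<open>Kh P h\<close>.\<close>

lemma scheme_step_exists:
  assumes v: "v \<in> Kh P h" and \<tau>: "\<tau> > 0"
  shows "\<exists>w. scheme_step P h \<tau> v w"
proof -
  define s where "s = 1 / \<tau>"
  define q where "q w x = s / 2 * ((w x - v x) * (w x - v x)) + reaction v x * w x + gam P * epsilon P * (cgrad w x \<bullet> cgrad w x)" for w x
  define Q where "Q w = (LINT x|lebesgue_on \<Omega>. q w x)" for w
  have bmq: "bounded_measurable (q w)" if "w \<in> PA" for w
    unfolding q_def by (intro bounded_measurable_add bounded_measurable_mult bounded_measurable_diff bounded_measurable_const bounded_measurable_bcoef bounded_measurable_cgrad_inner bounded_measurable_PA Kh_PA[OF v] v that)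
  obtain Cb where Cb: "Cb \<ge> 0" "AE x in lebesgue_on \<Omega>. \<forall>v\<in>Kh P h. \<bar>reaction v x\<bar> \<le> Cb" using reaction_uniform_bound by blast
  obtain Cg where Cg: "Cg \<ge> 0" "\<And>v x. v \<in> Kh P h \<Longrightarrow> x \<in> mesh_int \<Longrightarrow> norm (cgrad v x) \<le> Cg" using Kh_cgrad_bound by blast
  have ge: "gam P * epsilon P > 0" using gam_pos epsilon_pos by simp
  have s0: "s > 0" using \<tau> by (simp add: s_def)
  have "\<exists>w\<in>Kh P h. \<forall>y\<in>Kh P h. Q w \<le> Q y"
  proof (rule exists_minimizer_seq)
    show "Kh P h \<noteq> {}" using v by blast
    fix f :: "nat \<Rightarrow> real ^ 'd \<Rightarrow> real" assume f: "\<And>n. f n \<in> Kh P h"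
    obtain r w where r: "strict_mono (r :: nat \<Rightarrow> nat)" "w \<in> Kh P h" "uniform_limit (closure \<Omega>) (\<lambda>n. f (r n)) w sequentially"
      using Kh_compact[of f, OF f] by blast
    have "(\<lambda>n. Q (f (r n))) \<longlonglongrightarrow> Q w"
      unfolding Q_def
    proof (rule integral_dominated_convergence[where w = "\<lambda>_. s / 2 + Cb + gam P * epsilon P * (Cg * Cg)"])
      show "q w \<in> borel_measurable (lebesgue_on \<Omega>)" "q (f (r n)) \<in> borel_measurable (lebesgue_on \<Omega>)" for n
        using bmq[OF Kh_PA[OF r(2)]] bmq[OF Kh_PA[OF f]] by (auto simp: bounded_measurable_def)
      show "AE x in lebesgue_on \<Omega>. (\<lambda>n. q (f (r n)) x) \<longlonglongrightarrow> q w x"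
      proof (rule AE_domI)
        fix x assume x: "x \<in> \<Omega>" "x \<in> mesh_int"
        then have xc: "x \<in> closure \<Omega>" using closure_subset by blast
        note fx = tendsto_uniform_limitI[OF r(3) xc]
        have g: "(\<lambda>n. cgrad (f (r n)) x) \<longlonglongrightarrow> cgrad w x"
          by (rule tendsto_uniform_limitI[OF cgrad_uniform_limit[OF Kh_PA[OF f] Kh_PA[OF r(2)] r(3)] x(2)])
        show "(\<lambda>n. q (f (r n)) x) \<longlonglongrightarrow> q w x" unfolding q_def by (intro tendsto_intros fx g)
      qed
      show "AE x in lebesgue_on \<Omega>. norm (q (f (r n)) x) \<le> s / 2 + Cb + gam P * epsilon P * (Cg * Cg)" for n
        using Cb(2) AE_mesh_int AE_space
      proof eventually_elim
        case (elim x)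
        let ?w = "f (r n)"
        have xc: "x \<in> closure \<Omega>" using elim(3) closure_subset[of \<Omega>] by auto
        have "\<bar>?w x - v x\<bar> \<le> 1" by (rule Kh_diff_abs[OF f v xc])
        then have "\<bar>?w x - v x\<bar> * \<bar>?w x - v x\<bar> \<le> 1 * 1" by (intro mult_mono) auto
        then have "s / 2 * (\<bar>?w x - v x\<bar> * \<bar>?w x - v x\<bar>) \<le> s / 2 * (1 * 1)" using s0 by (intro mult_left_mono) auto
        then have 1: "\<bar>s / 2 * ((?w x - v x) * (?w x - v x))\<bar> \<le> s / 2" using s0 by (simp add: abs_mult)
        have "\<bar>reaction v x\<bar> * \<bar>?w x\<bar> \<le> Cb * 1" using elim(1) v Kh_abs[OF f xc] Cb(1) by (intro mult_mono) auto
        then have 2: "\<bar>reaction v x * ?w x\<bar> \<le> Cb" by (simp add: abs_mult)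
        have "norm (cgrad ?w x) * norm (cgrad ?w x) \<le> Cg * Cg"
          using Cg(2)[OF f elim(2), of "r n"] Cg(1) by (intro mult_mono) auto
        then have "\<bar>cgrad ?w x \<bullet> cgrad ?w x\<bar> \<le> Cg * Cg" using Cauchy_Schwarz_ineq2 order_trans by blast
        then have 3: "\<bar>gam P * epsilon P * (cgrad ?w x \<bullet> cgrad ?w x)\<bar> \<le> gam P * epsilon P * (Cg * Cg)"
          using ge unfolding abs_mult[of "gam P * epsilon P"] by (intro mult_mono) auto
        show ?case unfolding q_def real_norm_def using 1 2 3 by linarith
      qed
    qed simp
    then show "\<exists>r w. strict_mono r \<and> w \<in> Kh P h \<and> (\<lambda>n. Q (f (r n))) \<longlonglongrightarrow> Q w" using r(1,2) by blast
  qed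
  then obtain w where w: "w \<in> Kh P h" "\<And>y. y \<in> Kh P h \<Longrightarrow> Q w \<le> Q y" by blast
  have "variation v w s (\<lambda>x. \<omega> x - w x) \<ge> 0" if \<omega>: "\<omega> \<in> Kh P h" for \<omega>
  proof -
    let ?\<eta> = "\<lambda>x. \<omega> x - w x"
    have \<eta>: "?\<eta> \<in> PA" by (rule PA_diff[OF Kh_PA[OF \<omega>] Kh_PA[OF w(1)]])
    define g where "g x = s * ((w x - v x) * ?\<eta> x) + reaction v x * ?\<eta> x + 2 * gam P * epsilon P * (cgrad w x \<bullet> cgrad ?\<eta> x)" for x
    \<comment> \<open>In the expansion of Q along w + t (\<omega> - w), g is the density of the
      first-order term and k that of the second-order term.\<close>
    define k where "k x = s / 2 * (?\<eta> x * ?\<eta> x) + gam P * epsilon P * (cgrad ?\<eta> x \<bullet> cgrad ?\<eta> x)" for x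
    have bmg: "bounded_measurable g"
      unfolding g_def by (intro bounded_measurable_add bounded_measurable_mult bounded_measurable_diff bounded_measurable_const bounded_measurable_bcoef bounded_measurable_cgrad_inner bounded_measurable_PA Kh_PA[OF v] Kh_PA[OF w(1)] Kh_PA[OF \<omega>] v \<eta>)
    have bmk: "bounded_measurable k"
      unfolding k_def by (intro bounded_measurable_add bounded_measurable_mult bounded_measurable_diff bounded_measurable_const bounded_measurable_cgrad_inner bounded_measurable_PA Kh_PA[OF w(1)] Kh_PA[OF \<omega>] \<eta>)
    have "0 \<le> variation v w s ?\<eta>"
    proof (rule first_variation_nonneg)
      fix t :: real assume t: "0 < t" "t \<le> 1"
      let ?y = "\<lambda>x. w x + t * ?\<eta> x"
      have y: "?y \<in> Kh P h" by (rule Kh_convex[OF w(1) \<omega>]) (use t in auto)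
      have "Q ?y = (LINT x|lebesgue_on \<Omega>. q w x + (t * g x + t\<^sup>2 * k x))"
        unfolding Q_def
      proof (rule lebesgue_on_integral_cong_AE[OF dom_sets AE_domI])
        fix x assume "x \<in> mesh_int"
        then have "cgrad ?y x = cgrad w x + t *\<^sub>R cgrad ?\<eta> x"
          using cgrad_lincomb[OF Kh_PA[OF w(1)] \<eta>, of x 1 t] by simp
        then show "q ?y x = q w x + (t * g x + t\<^sup>2 * k x)"
          unfolding q_def g_def k_def
          by (simp add: inner_add_left inner_add_right inner_commute[of "cgrad ?\<eta> x" "cgrad w x"])
            (simp add: field_simps power2_eq_square)
      qed
      also have "\<dots> = Q w + (t * variation v w s ?\<eta> + t\<^sup>2 * integral\<^sup>L (lebesgue_on \<Omega>) k)"
        using bounded_measurable_integrable[OF bmq[OF Kh_PA[OF w(1)]]] bounded_measurable_integrable[OF bmg] bounded_measurable_integrable[OF bmk]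
        unfolding Q_def variation_def g_def[symmetric] by simp
      finally show "0 \<le> t * variation v w s ?\<eta> + t\<^sup>2 * integral\<^sup>L (lebesgue_on \<Omega>) k"
        using w(2)[OF y] by linarith
    qed
    then show ?thesis .
  qed
  then show ?thesis using w(1) by (auto simp: scheme_step_iff[OF v] s_def)
qed

section \<open>Comparison of consecutive iterates\<close>

lemma Kh_L2_zero_imp_eq:
  assumes v: "v \<in> Kh P h" and w: "w \<in> Kh P h" and z: "(LINT x|lebesgue_on \<Omega>. (w x - v x)\<^sup>2) = 0"
    and x: "x \<in> closure \<Omega>"
  shows "w x = v x"
proof -
  have d: "(\<lambda>x. w x - v x) \<in> PA" by (rule PA_diff[OF Kh_PA[OF w] Kh_PA[OF v]])
  have "integrable (lebesgue_on \<Omega>) (\<lambda>x. (w x - v x)\<^sup>2)"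
    unfolding power2_eq_square by (intro bounded_measurable_integrable bounded_measurable_mult bounded_measurable_PA d)
  then have "AE x in lebesgue_on \<Omega>. (w x - v x)\<^sup>2 = 0"
    using z by (subst (asm) integral_nonneg_eq_0_iff_AE) auto
  then have "w x - v x \<in> {0}" by (intro AE_closed_imp_closure[OF PA_continuous[OF d] _ _ x]) auto
  then show ?thesis by simp
qed

lemma L2_dist_tendsto:
  assumes V: "\<And>n. V n \<in> Kh P h" "v \<in> Kh P h" "uniform_limit (closure \<Omega>) V v sequentially"
    and W: "\<And>n. W n \<in> Kh P h" "w \<in> Kh P h" "uniform_limit (closure \<Omega>) W w sequentially"
  shows "(\<lambda>n. LINT x|lebesgue_on \<Omega>. (W n x - V n x)\<^sup>2) \<longlonglongrightarrow> (LINT x|lebesgue_on \<Omega>. (w x - v x)\<^sup>2)"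
proof (rule integral_dominated_convergence[where w = "\<lambda>_. 1"])
  have bm: "bounded_measurable (\<lambda>x. (w x - v x)\<^sup>2)" if "v \<in> Kh P h" "w \<in> Kh P h" for v w
    unfolding power2_eq_square by (intro bounded_measurable_mult bounded_measurable_PA PA_diff Kh_PA that)
  show "(\<lambda>x. (w x - v x)\<^sup>2) \<in> borel_measurable (lebesgue_on \<Omega>)"
    "(\<lambda>x. (W n x - V n x)\<^sup>2) \<in> borel_measurable (lebesgue_on \<Omega>)" for n
    using bm[OF V(2) W(2)] bm[OF V(1) W(1)] unfolding bounded_measurable_def by blast+
  show "AE x in lebesgue_on \<Omega>. (\<lambda>n. (W n x - V n x)\<^sup>2) \<longlonglongrightarrow> (w x - v x)\<^sup>2"
  proof (rule AE_domI)
    fix x assume "x \<in> \<Omega>"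
    then have xc: "x \<in> closure \<Omega>" using closure_subset by blast
    show "(\<lambda>n. (W n x - V n x)\<^sup>2) \<longlonglongrightarrow> (w x - v x)\<^sup>2"
      by (intro tendsto_intros tendsto_uniform_limitI[OF V(3) xc] tendsto_uniform_limitI[OF W(3) xc])
  qed
  show "AE x in lebesgue_on \<Omega>. norm ((W n x - V n x)\<^sup>2) \<le> 1" for n
  proof (rule AE_domI)
    fix x assume "x \<in> \<Omega>"
    then have "x \<in> closure \<Omega>" using closure_subset by blast
    then have "\<bar>W n x - V n x\<bar> \<le> 1" by (rule Kh_diff_abs[OF W(1) V(1)])
    then show "norm ((W n x - V n x)\<^sup>2) \<le> 1" by (simp add: abs_square_le_1)
  qed
qed simp

lemma uniform_limit_subseq:
  assumes "uniform_limit X f l sequentially" "strict_mono (r :: nat \<Rightarrow> nat)"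
  shows "uniform_limit X (\<lambda>n. f (r n)) l sequentially"
  using filterlim_compose[OF assms(1) filterlim_subseq[OF assms(2)]] .

end

section \<open>Convergence of the scheme\<close>

theorem theorem6p2:
  fixes P :: "('d::finite) cavity_data" and h :: real and c\<^sub>1 :: "real \<Rightarrow> real \<Rightarrow> real"
  assumes dim: "CARD('d) = 2 \<or> CARD('d) = 3"
    and data: "admissible P"
    and h: "0 < h" "h \<le> h0 P"
    and c1: "time_step_constant P h c\<^sub>1"
  shows "\<exists>\<beta>>0. \<forall>v\<^sub>0 \<in> Kh P h. \<exists>(\<tau> :: nat \<Rightarrow> real) (v :: nat \<Rightarrow> real ^ 'd \<Rightarrow> real).
    v 0 = v\<^sub>0 \<and>
    (\<forall>n. scheme_step P h (\<tau> n) (v n) (v (Suc n))) \<and>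
    (\<forall>n. \<beta> \<le> \<tau> n \<and> \<tau> n \<le> 1 / (1 + c\<^sub>1 (norm_uN P h (v n)) (norm_uD P h (v n)))) \<and>
    (\<exists>(r :: nat \<Rightarrow> nat) v\<^sub>h. strict_mono r \<and> v\<^sub>h \<in> Kh P h \<and>
      (\<lambda>n. W1inf_norm (Omega P) (\<lambda>x. v (r n) x - v\<^sub>h x)) \<longlonglongrightarrow> 0 \<and>
      (\<forall>\<omega>\<^sub>h \<in> Kh P h. J_deriv P h v\<^sub>h (\<lambda>x. \<omega>\<^sub>h x - v\<^sub>h x) \<ge> 0))"
proof -
  interpret cavity P h by unfold_locales (use dim data h in auto)
  define cc where "cc v = c\<^sub>1 (norm_uN P h v) (norm_uD P h v)" for v
  obtain R where R: "\<And>v. v \<in> Kh P h \<Longrightarrow> norm_uN P h v \<in> {0..R}" "\<And>v. v \<in> Kh P h \<Longrightarrow> norm_uD P h v \<in> {0..R}"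
    using displacement_norms_bounded by blast
  obtain M where M: "\<And>a b. a \<in> {0..R} \<Longrightarrow> b \<in> {0..R} \<Longrightarrow> c\<^sub>1 a b \<le> M"
    using c1 unfolding time_step_constant_def by meson
  \<comment> \<open>Values of \<open>enn2real\<close> are nonnegative, so positivity of
    \<open>c\<^sub>1\<close> applies at every v.\<close>
  have cpos: "cc v > 0" for v
    using c1 unfolding time_step_constant_def cc_def norm_uN_def norm_uD_def by simp
  have cM: "cc v \<le> \<bar>M\<bar>" if "v \<in> Kh P h" for v
    using M[OF R(1)[OF that] R(2)[OF that]] by (simp add: cc_def)
  have decr: "(LINT x|lebesgue_on \<Omega>. (w x - v x)\<^sup>2) + J P h w \<le> J P h v"
    if "v \<in> Kh P h" "scheme_step P h (1 / (1 + cc v)) v w" for v w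
  proof -
    have "0 < 1 / (1 + cc v)" using cpos[of v] by simp
    then show ?thesis using c1 that unfolding time_step_constant_def cc_def by blast
  qed
  \<comment> \<open>M bounds \<open>c\<^sub>1\<close> on the square that contains the displacement
    norms of all members of \<open>Kh P h\<close>, whatever the initial guess. The absolute value
    keeps the denominator positive in any case.\<close>
  define \<beta> where "\<beta> = 1 / (1 + \<bar>M\<bar>)"
  have \<beta>: "\<beta> > 0" by (simp add: \<beta>_def add_pos_nonneg)
  have \<beta>le: "\<beta> \<le> 1 / (1 + cc v)" if "v \<in> Kh P h" for v
    unfolding \<beta>_def using cM[OF that] cpos[of v] by (intro divide_left_mono mult_pos_pos) auto
  have "\<exists>w. scheme_step P h (1 / (1 + cc v)) v w" if "v \<in> Kh P h" for v
    by (rule scheme_step_exists[OF that]) (use cpos[of v] in simp)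
  \<comment> \<open>One step with the largest admissible time step is selected at every v; iterating
    this map produces the sequence.\<close>
  then obtain nxt where nxt: "\<And>v. v \<in> Kh P h \<Longrightarrow> scheme_step P h (1 / (1 + cc v)) v (nxt v)" by metis
  have main: "\<exists>(\<tau> :: nat \<Rightarrow> real) (v :: nat \<Rightarrow> real ^ 'd \<Rightarrow> real).
    v 0 = v\<^sub>0 \<and>
    (\<forall>n. scheme_step P h (\<tau> n) (v n) (v (Suc n))) \<and>
    (\<forall>n. \<beta> \<le> \<tau> n \<and> \<tau> n \<le> 1 / (1 + c\<^sub>1 (norm_uN P h (v n)) (norm_uD P h (v n)))) \<and>
    (\<exists>(r :: nat \<Rightarrow> nat) v\<^sub>h. strict_mono r \<and> v\<^sub>h \<in> Kh P h \<and>
      (\<lambda>n. W1inf_norm \<Omega> (\<lambda>x. v (r n) x - v\<^sub>h x)) \<longlonglongrightarrow> 0 \<and>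
      (\<forall>\<omega>\<^sub>h \<in> Kh P h. J_deriv P h v\<^sub>h (\<lambda>x. \<omega>\<^sub>h x - v\<^sub>h x) \<ge> 0))"
    if v0: "v\<^sub>0 \<in> Kh P h" for v\<^sub>0
  proof -
    define v where "v = rec_nat v\<^sub>0 (\<lambda>_. nxt)"
    have vS: "v (Suc n) = nxt (v n)" for n by (simp add: v_def)
    have vK: "v n \<in> Kh P h" for n
      by (induction n) (use v0 nxt in \<open>auto simp: v_def scheme_step_def\<close>)
    define \<tau> where "\<tau> n = 1 / (1 + cc (v n))" for n
    have step: "scheme_step P h (\<tau> n) (v n) (v (Suc n))" for n
      unfolding \<tau>_def vS by (rule nxt[OF vK])
    define E where "E n = (LINT x|lebesgue_on \<Omega>. (v (Suc n) x - v n x)\<^sup>2)" for n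
    have E0: "E n \<ge> 0" for n unfolding E_def by simp
    have dec: "E n + J P h (v (Suc n)) \<le> J P h (v n)" for n
      unfolding E_def by (rule decr[OF vK]) (use step in \<open>simp add: \<tau>_def\<close>)
    obtain m where m: "\<And>v. v \<in> Kh P h \<Longrightarrow> m \<le> J P h v" using energy_bounded_below by blast
    have "decseq (\<lambda>n. J P h (v n))"
      by (rule decseq_SucI) (use dec E0 in \<open>smt (verit)\<close>)
    then obtain l where l: "(\<lambda>n. J P h (v n)) \<longlonglongrightarrow> l"
      using decseq_convergent[of "\<lambda>n. J P h (v n)" m] m[OF vK] by blast
    have E: "E \<longlonglongrightarrow> 0"
    proof (rule tendsto_sandwich[OF _ _ tendsto_const])
      show "\<forall>\<^sub>F n in sequentially. 0 \<le> E n" using E0 by simp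
      have "E n \<le> J P h (v n) - J P h (v (Suc n))" for n using dec[of n] by linarith
      then show "\<forall>\<^sub>F n in sequentially. E n \<le> J P h (v n) - J P h (v (Suc n))" by simp
      show "(\<lambda>n. J P h (v n) - J P h (v (Suc n))) \<longlonglongrightarrow> 0"
        using tendsto_diff[OF l LIMSEQ_Suc[OF l]] by simp
    qed
    \<comment> \<open>Four nested extractions follow, for the iterates, their successors and the two
      displacements; passing to a further subsequence preserves the limits already found.\<close>
    obtain r1 vh where r1: "strict_mono (r1 :: nat \<Rightarrow> nat)" and vh: "vh \<in> Kh P h"
      and lim1: "uniform_limit (closure \<Omega>) (\<lambda>n. v (r1 n)) vh sequentially" using Kh_compact[of v, OF vK] by blast
    obtain r2 wh where r2: "strict_mono (r2 :: nat \<Rightarrow> nat)" and wh: "wh \<in> Kh P h"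
      and lim2: "uniform_limit (closure \<Omega>) (\<lambda>n. v (Suc (r1 (r2 n)))) wh sequentially"
      using Kh_compact[of "\<lambda>n. v (Suc (r1 n))", OF vK] by blast
    have lim12: "uniform_limit (closure \<Omega>) (\<lambda>n. v (r1 (r2 n))) vh sequentially"
      by (rule uniform_limit_subseq[OF lim1 r2])
    obtain r3 where r3: "strict_mono (r3 :: nat \<Rightarrow> nat)"
      "uniform_limit (closure \<Omega>) (\<lambda>n. uN P h (v (r1 (r2 (r3 n))))) (uN P h vh) sequentially"
      using uN_tendsto[OF vK vh lim12] by blast
    have lim123: "uniform_limit (closure \<Omega>) (\<lambda>n. v (r1 (r2 (r3 n)))) vh sequentially"
      by (rule uniform_limit_subseq[OF lim12 r3(1)])
    obtain r4 where r4: "strict_mono (r4 :: nat \<Rightarrow> nat)"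
      "uniform_limit (closure \<Omega>) (\<lambda>n. uD P h (v (r1 (r2 (r3 (r4 n)))))) (uD P h vh) sequentially"
      using uD_tendsto[OF vK vh lim123] by blast
    define r where "r n = r1 (r2 (r3 (r4 n)))" for n
    have r: "strict_mono r"
      unfolding r_def using r1 r2 r3(1) r4(1) by (auto simp: strict_mono_def)
    have V: "uniform_limit (closure \<Omega>) (\<lambda>n. v (r n)) vh sequentially"
      unfolding r_def by (rule uniform_limit_subseq[OF lim123 r4(1)])
    have N: "uniform_limit (closure \<Omega>) (\<lambda>n. uN P h (v (r n))) (uN P h vh) sequentially"
      unfolding r_def by (rule uniform_limit_subseq[OF r3(2) r4(1)])
    have D: "uniform_limit (closure \<Omega>) (\<lambda>n. uD P h (v (r n))) (uD P h vh) sequentially"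
      unfolding r_def by (rule r4(2))
    have W': "uniform_limit (closure \<Omega>) (\<lambda>n. v (Suc (r n))) wh sequentially"
      unfolding r_def by (rule uniform_limit_subseq[OF uniform_limit_subseq[OF lim2 r3(1)] r4(1)])
    have "(\<lambda>n. E (r n)) \<longlonglongrightarrow> (LINT x|lebesgue_on \<Omega>. (wh x - vh x)\<^sup>2)"
      unfolding E_def by (rule L2_dist_tendsto[OF vK vh V vK wh W'])
    moreover have "(\<lambda>n. E (r n)) \<longlonglongrightarrow> 0" using LIMSEQ_subseq_LIMSEQ[OF E r] by (simp add: comp_def)
    ultimately have "(LINT x|lebesgue_on \<Omega>. (wh x - vh x)\<^sup>2) = 0" using LIMSEQ_unique by blast
    then have "wh x = vh x" if "x \<in> closure \<Omega>" for x using Kh_L2_zero_imp_eq[OF vh wh _ that] by blast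
    \<comment> \<open>The two limits agree on the closure of \<Omega>, which is where the uniform
      convergence is measured.\<close>
    then have W: "uniform_limit (closure \<Omega>) (\<lambda>n. v (Suc (r n))) vh sequentially"
      by (intro uniform_limit_cong'[THEN iffD1, OF _ _ W']) auto
    have \<beta>\<tau>: "\<beta> \<le> \<tau> n" for n unfolding \<tau>_def by (rule \<beta>le[OF vK])
    have "J_deriv P h vh (\<lambda>x. \<omega> x - vh x) \<ge> 0" if \<omega>: "\<omega> \<in> Kh P h" for \<omega>
    proof -
      \<comment> \<open>This is where the positive lower bound on the time steps enters: it keeps
        their inverses bounded.\<close>
      have sb: "\<bar>1 / \<tau> n\<bar> \<le> 1 / \<beta>" for n
        using \<beta>\<tau>[of n] \<beta> by (simp add: frac_le)
      have "(\<lambda>n. variation (v (r n)) (v (Suc (r n))) (1 / \<tau> (r n)) (\<lambda>x. \<omega> x - v (Suc (r n)) x))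
          \<longlonglongrightarrow> variation vh vh 0 (\<lambda>x. \<omega> x - vh x)"
        by (rule variation_tendsto[OF vK vh V N D vK W sb \<omega>])
      moreover have "0 \<le> variation (v (r n)) (v (Suc (r n))) (1 / \<tau> (r n)) (\<lambda>x. \<omega> x - v (Suc (r n)) x)" for n
        using step[of "r n"] \<omega> by (simp add: scheme_step_iff[OF vK])
      ultimately have "0 \<le> variation vh vh 0 (\<lambda>x. \<omega> x - vh x)" by (intro LIMSEQ_le_const) auto
      then show ?thesis by (simp add: J_deriv_eq[OF vh PA_diff[OF Kh_PA[OF \<omega>] Kh_PA[OF vh]]])
    qed
    moreover have "(\<lambda>n. W1inf_norm \<Omega> (\<lambda>x. v (r n) x - vh x)) \<longlonglongrightarrow> 0"
      by (rule W1inf_norm_tendsto[OF Kh_PA[OF vK] Kh_PA[OF vh] V])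
    ultimately show ?thesis
      using step \<beta>\<tau> r vh
      by (intro exI[of _ \<tau>] exI[of _ v] conjI exI[of _ r] exI[of _ vh]) (auto simp: v_def \<tau>_def cc_def)
  qed
  show ?thesis using \<beta> main by blast
qed

end
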